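(* The finite Hilbert transform $T_{\log}\colon L\log L\to L^1$ is not weakly compact. Consequently, neither is the integration operator $I_{m_{L^1}}\colon L^1(m_{L^1})\to L^1$.
   Context: $\mu$ is Lebesgue measure on the Borel $\sigma$-algebra $\mathcal B$ of $(-1,1)$, $L^0$ is the space of (a.e.-equivalence classes of) $\mathbb C$-valued measurable functions on $(-1,1)$, and $L^p=L^p(\mu)$. The finite Hilbert transform of $f\in L^1$ is $T(f)(t):=\lim_{\varepsilon\to0^+}\frac1\pi\left(\int_{-1}^{t-\varepsilon}+\int_{t+\varepsilon}^1\right)\frac{f(x)}{x-t}\,dx$, which exists for a.e. $t\in(-1,1)$ and is measurable. $T$ maps $L^2$ boundedly into $L^2$. For $f\in L^0$, $f^*$ is the decreasing rearrangement (the right-continuous inverse of the distribution function $\lambda\mapsto\mu(\{|f|>\lambda\})$). $L\log L$ is the space of all $f\in L^0$ with $\|f\|_{L\log L}:=\int_0^2 f^*(t)\log(2e/t)\,dt<\infty$, equipped with this norm (equivalently, $\int_{-1}^1|f|\log^+|f|\,dx<\infty$). It is known that $T$ maps $L\log L$ boundedly into $L^1$; $T_{\log}\colon L\log L\to L^1$ denotes the resulting operator. $m_{L^1}\colon\mathcal B\to L^1$ is the set function $m_{L^1}(A):=T(\chi_A)$, which is $\sigma$-additive (a vector measure). For $g\in L^\infty=(L^1)^*$, $\langle m_{L^1},g\rangle(A):=\langle m_{L^1}(A),g\rangle=\int_{-1}^1 m_{L^1}(A)\,g\,d\mu$ is a complex measure, with variation measure $|\langle m_{L^1},g\rangle|$.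 A $\mathcal B$-measurable $f\colon(-1,1)\to\mathbb C$ is $m_{L^1}$-integrable if it is $\langle m_{L^1},g\rangle$-integrable for every $g\in L^\infty$ and, for every $A\in\mathcal B$, there is an element $\int_A f\,dm_{L^1}\in L^1$ (necessarily unique) with $\langle\int_A f\,dm_{L^1},g\rangle=\int_A f\,d\langle m_{L^1},g\rangle$ for all $g\in L^\infty$. $L^1(m_{L^1})$ is the space of all $m_{L^1}$-integrable functions, with functions equal $\mu$-a.e. identified ($m_{L^1}$ and $\mu$ have the same null sets), equipped with the complete norm $\|f\|_{L^1(m_{L^1})}:=\sup\{\int_{-1}^1|f|\,d|\langle m_{L^1},g\rangle|: g\in L^\infty,\ \|g\|_\infty\le1\}$. The integration operator is $I_{m_{L^1}}(f):=\int_{(-1,1)}f\,dm_{L^1}$. A bounded linear operator between Banach spaces is weakly compact if it maps the closed unit ball to a relatively weakly compact set. *)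

theory Defs
  imports "HOL-Analysis.Analysis" "HOL-Probability.Essential_Supremum"
begin

section \<open>The space \<open>L\<^sup>0\<close> on \<open>(-1,1)\<close>\<close>

definition mu :: "real measure"
  where "mu = restrict_space lborel {-1<..<1}"

lemma space_mu [simp]: "space mu = {-1<..<1}"
  by (simp add: mu_def space_restrict_space)

lemma finite_measure_mu: "finite_measure mu"
  by standard (simp add: mu_def emeasure_restrict_space space_restrict_space)

definition ae_eq :: "(real \<Rightarrow> complex) \<Rightarrow> (real \<Rightarrow> complex) \<Rightarrow> bool"
  where "ae_eq f g \<longleftrightarrow>
    f \<in> borel_measurable mu \<and> g \<in> borel_measurable mu \<and> (AE x in mu. f x = g x)"

text \<open>All Banach spaces below are linear subspaces of \<open>L0\<close> (given as sets), each with its own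
  norm. \<open>rep_L0\<close> chooses an arbitrary measurable representative; \<open>abs_L0\<close> is the class of a
  measurable function, and its value at a non-measurable function is meaningless.\<close>

quotient_type L0 = "real \<Rightarrow> complex" / partial: ae_eq
  morphisms rep_L0 abs_L0
proof (rule part_equivpI)
  show "\<exists>f. ae_eq f f"
    by (rule exI[of _ "\<lambda>_. 0"]) (simp add: ae_eq_def)
  show "symp ae_eq"
    by (auto simp: symp_def ae_eq_def)
  show "transp ae_eq"
    by (auto simp: transp_def ae_eq_def)
qed

lemma rep_L0_measurable [measurable]: "rep_L0 f \<in> borel_measurable mu"
  using Quotient3_rep_reflp[OF Quotient3_L0, of f] by (simp add: ae_eq_def)

lemma rep_abs_L0_AE:
  assumes "f \<in> borel_measurable mu"
  shows "AE x in mu. rep_L0 (abs_L0 f) x = f x"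
  using rep_abs_rsp_left[OF Quotient3_L0, of f f] assms by (simp add: ae_eq_def)

lemma abs_rep_L0: "abs_L0 (rep_L0 f) = f"
  by (rule Quotient3_abs_rep[OF Quotient3_L0])

instantiation L0 :: ab_group_add
begin

lift_definition zero_L0 :: L0 is "\<lambda>_. 0"
  by (simp add: ae_eq_def)

lift_definition plus_L0 :: "L0 \<Rightarrow> L0 \<Rightarrow> L0" is "\<lambda>f g x. f x + g x"
  by (auto simp: ae_eq_def elim: eventually_elim2)

lift_definition minus_L0 :: "L0 \<Rightarrow> L0 \<Rightarrow> L0" is "\<lambda>f g x. f x - g x"
  by (auto simp: ae_eq_def elim: eventually_elim2)

lift_definition uminus_L0 :: "L0 \<Rightarrow> L0" is "\<lambda>f x. - f x"
  by (auto simp: ae_eq_def)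

instance
  by standard (transfer; auto simp: ae_eq_def)+

end

lift_definition scale_L0 :: "complex \<Rightarrow> L0 \<Rightarrow> L0" is "\<lambda>c f x. c * f x"
  by (auto simp: ae_eq_def)

global_interpretation L0: vector_space scale_L0
  by standard (transfer; auto simp: ae_eq_def algebra_simps)+

section \<open>\<open>L\<^sup>1\<close>, \<open>L\<^sup>\<infinity>\<close> and their pairing\<close>

lift_definition integrable_L0 :: "L0 \<Rightarrow> bool" is "integrable mu"
  by (auto simp: ae_eq_def cong: integrable_cong_AE intro: integrable_cong_AE_imp)

definition L1 :: "L0 set"
  where "L1 = {f. integrable_L0 f}"

lift_definition norm_L1 :: "L0 \<Rightarrow> real" is "\<lambda>f. LINT x|mu. cmod (f x)"
  by (auto simp: ae_eq_def intro!: integral_cong_AE)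

lift_definition esssup_L0 :: "L0 \<Rightarrow> ennreal" is "\<lambda>f. esssup mu (\<lambda>x. ennreal (cmod (f x)))"
  by (auto simp: ae_eq_def intro!: esssup_AE_cong)

definition Linf :: "L0 set"
  where "Linf = {g. esssup_L0 g < \<infinity>}"

definition norm_Linf :: "L0 \<Rightarrow> real"
  where "norm_Linf g = enn2real (esssup_L0 g)"

lift_definition pairing :: "L0 \<Rightarrow> L0 \<Rightarrow> complex" is "\<lambda>f g. LINT x|mu. f x * g x"
  by (auto simp: ae_eq_def intro!: integral_cong_AE elim: eventually_elim2)

section \<open>\<open>L log L\<close>\<close>

lift_definition decreasing_rearrangement :: "L0 \<Rightarrow> real \<Rightarrow> real"
  is "\<lambda>f t. Inf {s. 0 \<le> s \<and> measure mu {x \<in> space mu. s < cmod (f x)} \<le> t}"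
proof -
  fix f g assume fg: "ae_eq f g"
  then have [measurable]: "f \<in> borel_measurable mu" "g \<in> borel_measurable mu"
    and eq: "AE x in mu. f x = g x"
    by (auto simp: ae_eq_def)
  have "measure mu {x \<in> space mu. s < cmod (f x)} = measure mu {x \<in> space mu. s < cmod (g x)}" for s
    proof (rule measure_eq_AE)
    show "AE x in mu. x \<in> {x \<in> space mu. s < cmod (f x)} \<longleftrightarrow> x \<in> {x \<in> space mu. s < cmod (g x)}"
      using eq by eventually_elim simp
    show "{x \<in> space mu. s < cmod (f x)} \<in> sets mu" "{x \<in> space mu. s < cmod (g x)} \<in> sets mu"
      by measurable
  qed
  then show "(\<lambda>t. Inf {s. 0 \<le> s \<and> measure mu {x \<in> space mu. s < cmod (f x)} \<le> t}) =
      (\<lambda>t. Inf {s. 0 \<le> s \<and> measure mu {x \<in> space mu. s < cmod (g x)} \<le> t})"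
    by simp
qed

definition LlogL_integral :: "L0 \<Rightarrow> ennreal"
  where "LlogL_integral f =
    (\<integral>\<^sup>+ t\<in>{0<..<2}. ennreal (decreasing_rearrangement f t * ln (2 * exp 1 / t)) \<partial>lborel)"

definition LlogL :: "L0 set"
  where "LlogL = {f. LlogL_integral f < \<infinity>}"

definition norm_LlogL :: "L0 \<Rightarrow> real"
  where "norm_LlogL f = enn2real (LlogL_integral f)"

section \<open>The finite Hilbert transform\<close>

definition finite_hilbert :: "(real \<Rightarrow> complex) \<Rightarrow> real \<Rightarrow> complex"
  where "finite_hilbert f t = Lim (at_right 0) (\<lambda>\<epsilon>. complex_of_real (1 / pi) *
    ((LBINT x:{-1<..<t - \<epsilon>}. f x / complex_of_real (x - t)) +
     (LBINT x:{t + \<epsilon><..<1}. f x / complex_of_real (x - t))))"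

text \<open>Only used on subspaces of \<open>L1\<close>, where the principal value exists almost everywhere and
  is measurable. The truncated integrals do not depend on the chosen representative.\<close>

definition T_L0 :: "L0 \<Rightarrow> L0"
  where "T_L0 f = abs_L0 (finite_hilbert (rep_L0 f))"

section \<open>Complex measures\<close>

text \<open>A complex measure on the measurable space of \<open>M\<close> is given by its values on \<open>sets M\<close>.\<close>

definition variation :: "'a measure \<Rightarrow> ('a set \<Rightarrow> complex) \<Rightarrow> 'a measure"
  where "variation M \<nu> = measure_of (space M) (sets M)
    (\<lambda>A. SUP P\<in>{P. finite P \<and> partition_on A P \<and> P \<subseteq> sets M}. \<Sum>B\<in>P. ennreal (cmod (\<nu> B)))"

text \<open>The positive part in the Jordan decomposition of a finite signed measure \<open>\<rho>\<close>; the negative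
  part is the positive part of \<open>- \<rho>\<close>. (\<open>ennreal\<close> maps negative reals to \<open>0\<close>, which is harmless
  since \<open>B = {}\<close> contributes \<open>0\<close> anyway.)\<close>

definition positive_part :: "'a measure \<Rightarrow> ('a set \<Rightarrow> real) \<Rightarrow> 'a measure"
  where "positive_part M \<rho> = measure_of (space M) (sets M)
    (\<lambda>A. SUP B\<in>{B \<in> sets M. B \<subseteq> A}. ennreal (\<rho> B))"

definition complex_measure_integrable :: "'a measure \<Rightarrow> ('a set \<Rightarrow> complex) \<Rightarrow> ('a \<Rightarrow> complex) \<Rightarrow> bool"
  where "complex_measure_integrable M \<nu> f \<longleftrightarrow> integrable (variation M \<nu>) f"

definition complex_measure_integral ::
    "'a measure \<Rightarrow> ('a set \<Rightarrow> complex) \<Rightarrow> 'a set \<Rightarrow> ('a \<Rightarrow> complex) \<Rightarrow> complex"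
  where "complex_measure_integral M \<nu> A f =
    ((LINT x:A|positive_part M (\<lambda>B. Re (\<nu> B)). f x) - (LINT x:A|positive_part M (\<lambda>B. - Re (\<nu> B)). f x))
    + \<i> * ((LINT x:A|positive_part M (\<lambda>B. Im (\<nu> B)). f x) - (LINT x:A|positive_part M (\<lambda>B. - Im (\<nu> B)). f x))"

section \<open>The vector measure of the finite Hilbert transform\<close>

definition m_L1 :: "real set \<Rightarrow> L0"
  where "m_L1 A = T_L0 (abs_L0 (indicator A))"

definition scalar_measure :: "L0 \<Rightarrow> real set \<Rightarrow> complex"
  where "scalar_measure g A = pairing (m_L1 A) g"

definition is_m_integral :: "real set \<Rightarrow> (real \<Rightarrow> complex) \<Rightarrow> L0 \<Rightarrow> bool"
  where "is_m_integral A f h \<longleftrightarrow>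
    h \<in> L1 \<and> (\<forall>g\<in>Linf. pairing h g = complex_measure_integral mu (scalar_measure g) A f)"

definition m_integrable :: "(real \<Rightarrow> complex) \<Rightarrow> bool"
  where "m_integrable f \<longleftrightarrow> f \<in> borel_measurable mu \<and>
    (\<forall>g\<in>Linf. complex_measure_integrable mu (scalar_measure g) f) \<and>
    (\<forall>A\<in>sets mu. \<exists>h. is_m_integral A f h)"

definition m_integral :: "real set \<Rightarrow> (real \<Rightarrow> complex) \<Rightarrow> L0"
  where "m_integral A f = (THE h. is_m_integral A f h)"

text \<open>\<open>m_L1\<close> and \<open>mu\<close> have the same null sets, so the following three notions do not depend on the
  chosen representative. The supremum in the norm is finite for every element of \<open>L1_m\<close>.\<close>

definition L1_m :: "L0 set"
  where "L1_m = {f. m_integrable (rep_L0 f)}"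

definition norm_L1_m :: "L0 \<Rightarrow> real"
  where "norm_L1_m f =
    (SUP g\<in>{g \<in> Linf. norm_Linf g \<le> 1}. LINT x|variation mu (scalar_measure g). cmod (rep_L0 f x))"

definition integration_operator :: "L0 \<Rightarrow> L0"
  where "integration_operator f = m_integral {-1<..<1} (rep_L0 f)"

section \<open>Weak topology and weak compactness\<close>

definition dual_space :: "L0 set \<Rightarrow> (L0 \<Rightarrow> real) \<Rightarrow> (L0 \<Rightarrow> complex) set"
  where "dual_space X N = {\<phi>.
    (\<forall>f\<in>X. \<forall>g\<in>X. \<phi> (f + g) = \<phi> f + \<phi> g) \<and>
    (\<forall>c. \<forall>f\<in>X. \<phi> (scale_L0 c f) = c * \<phi> f) \<and>
    (\<exists>K. \<forall>f\<in>X. cmod (\<phi> f) \<le> K * N f)}"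

definition weak_topology :: "L0 set \<Rightarrow> (L0 \<Rightarrow> real) \<Rightarrow> L0 topology"
  where "weak_topology X N =
    topology_generated_by {{f \<in> X. \<phi> f \<in> U} | \<phi> U. \<phi> \<in> dual_space X N \<and> open U}"

lemma topspace_weak_topology: "topspace (weak_topology X N) = X"
proof -
  have "(\<lambda>_. 0) \<in> dual_space X N"
    by (auto simp: dual_space_def intro: exI[of _ 0])
  then have "X \<in> {{f \<in> X. \<phi> f \<in> U} | \<phi> U. \<phi> \<in> dual_space X N \<and> open U}"
    by (intro CollectI exI[of _ "\<lambda>_. 0"] exI[of _ UNIV]) auto
  then show ?thesis
    by (auto simp: weak_topology_def topology_generated_by_topspace)
qed

definition relatively_weakly_compact :: "L0 set \<Rightarrow> (L0 \<Rightarrow> real) \<Rightarrow> L0 set \<Rightarrow> bool"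
  where "relatively_weakly_compact X N S \<longleftrightarrow>
    compactin (weak_topology X N) (weak_topology X N closure_of S)"

text \<open>Weak compactness of an operator \<open>S\<close> from \<open>(X, N)\<close> to \<open>(Y, N')\<close>. That \<open>S\<close> is linear, bounded
  and maps into \<open>Y\<close> is deliberately not part of the predicate, so that its negation cannot hold
  for lack of one of these properties: values of \<open>S\<close> outside \<open>Y\<close> do not affect the closure.\<close>

definition weakly_compact_operator ::
    "L0 set \<Rightarrow> (L0 \<Rightarrow> real) \<Rightarrow> L0 set \<Rightarrow> (L0 \<Rightarrow> real) \<Rightarrow> (L0 \<Rightarrow> L0) \<Rightarrow> bool"
  where "weakly_compact_operator X N Y N' S \<longleftrightarrow>
    relatively_weakly_compact Y N' (S ` {f \<in> X. N f \<le> 1})"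

end

theory Submission
  imports Defs "HOL-Probability.Sinc_Integral" "HOL-Real_Asymp.Real_Asymp"
begin

text \<open>Both operators send the functions \<open>spike \<kappa> n\<close>, multiples of the indicator of
  \<open>{0..a}\<close> with \<open>a = exp (- n)\<close>, to the same elements of \<open>L1\<close>, and for a suitable constant \<open>\<kappa>\<close> these functions lie in the
  unit balls: the height of the spike is about \<open>1 / (a n)\<close>, which is the normalization in
  \<open>L log L\<close> as well as (up to a constant factor) in the space of functions integrable for the
  vector measure. The Hilbert transform of the indicator is
  \<open>(ln \<bar>a - t\<bar> - ln \<bar>t\<bar>) / \<pi>\<close>, so the transforms of the spikes tend to zero
  uniformly off every neighbourhood of the origin, whereas their integrals over \<open>(0, 1)\<close> stay below
  a negative constant, because the integral of \<open>ln \<bar>a - t\<bar> - ln \<bar>t\<bar>\<close> over \<open>(0, 1)\<close> is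
  \<open>a ln a + (1 - a) ln (1 - a)\<close>. A weak cluster point in \<open>L1\<close> would vanish almost everywhere and
  have a nonzero integral. This is \<open>not_relatively_weakly_compact_spikes\<close>.

  The larger part of the work is to show that the objects in the statement are what they should be:
  for every bounded \<open>f\<close> the principal value exists almost everywhere, is Borel measurable, and is
  antisymmetric for the pairing (\<open>pv_hilbert_parseval\<close>). Let \<open>reg_hilbert s f\<close> be the correlation of
  \<open>f\<close> with the conjugate Poisson kernel \<open>u / (u\<^sup>2 + s\<^sup>2)\<close>. The correlation of two
  conjugate Poisson kernels is a multiple of a Poisson kernel (\<open>conj_poisson_convolution\<close>); hence the
  squared \<open>L\<^sup>2\<close> distance of two regularized transforms is a combination of Poisson integrals paired with
  \<open>f\<close>, and the transforms converge to some \<open>h\<close> as \<open>s\<close> tends to \<open>0\<close>. The same kernel identities show that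
  the Poisson integral of \<open>h\<close> at level \<open>s\<close> is \<open>\<pi>\<close> times \<open>reg_hilbert s f\<close>, so convergence holds at every Lebesgue point
  of \<open>h\<close> (\<open>ex_hilbert_limit\<close>). Finally the truncated kernel of the principal value differs from the conjugate
  Poisson kernel by an odd function that is bounded by the Poisson kernel, which gives the principal
  value at every Lebesgue point of \<open>f\<close> where the former limit exists.

  By antisymmetry, the complex measure that a bounded \<open>g\<close> induces from the vector measure has the density
  \<open>- pv_hilbert g\<close>. Therefore bounded functions are integrable with the Hilbert transform as integral
  (\<open>bounded_in_L1_m\<close>), and their norm is estimated through the \<open>L\<^sup>2\<close> bound for the part of \<open>g\<close> near
  the spike and a direct estimate for the rest (\<open>norm_L1_m_spike_le\<close>).\<close>

section \<open>The Poisson kernel and its conjugate\<close>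

text \<open>The Poisson kernel of the upper half plane at height \<open>s\<close>, without the factor \<open>1 / \<pi>\<close>.\<close>

definition poisson :: "real \<Rightarrow> real \<Rightarrow> real"
  where "poisson s u = s / (u\<^sup>2 + s\<^sup>2)"

text \<open>The conjugate Poisson kernel, a smooth approximation of \<open>1 / u\<close>.\<close>

definition conj_poisson :: "real \<Rightarrow> real \<Rightarrow> real"
  where "conj_poisson s u = u / (u\<^sup>2 + s\<^sup>2)"

lemma poisson_measurable [measurable]: "(\<lambda>u. poisson s u) \<in> borel_measurable borel"
  unfolding poisson_def by measurable

lemma conj_poisson_measurable [measurable]: "(\<lambda>u. conj_poisson s u) \<in> borel_measurable borel"
  unfolding conj_poisson_def by measurable

text \<open>An integrable weight that dominates every translate of every Poisson kernel up to a constant. Limits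
  in \<open>L\<^sup>1\<close> of the whole line are taken with respect to it.\<close>

definition cauchy_weight :: "real \<Rightarrow> real"
  where "cauchy_weight x = 1 / (1 + x\<^sup>2)"

lemma cauchy_weight_measurable [measurable]: "cauchy_weight \<in> borel_measurable borel"
  unfolding cauchy_weight_def[abs_def] by measurable

lemma cauchy_weight_pos [simp]: "0 < cauchy_weight x"
  by (simp add: cauchy_weight_def add_pos_nonneg)

lemma cauchy_weight_nonneg [simp]: "0 \<le> cauchy_weight x"
  by (rule less_imp_le) simp

lemma integrable_cauchy_weight: "integrable lborel cauchy_weight"
  using integrable_inverse_1_plus_square
  by (simp add: set_integrable_def inverse_eq_divide cauchy_weight_def[abs_def])

lemma tendsto_Ln_at_top:
  fixes a :: complex
  assumes "Im a \<noteq> 0"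
  shows "((\<lambda>t. Ln (of_real t - a) - of_real (ln t)) \<longlongrightarrow> 0) at_top"
proof -
  have "((\<lambda>t. Ln (1 - a * of_real (1 / t))) \<longlongrightarrow> Ln (1 - a * of_real 0)) at_top"
    by (intro tendsto_intros) (auto intro!: filterlim_mono[OF tendsto_divide_0[OF tendsto_const filterlim_at_top_imp_at_infinity[OF filterlim_ident]]])
  moreover have "\<forall>\<^sub>F t in at_top. Ln (1 - a * of_real (1 / t)) = Ln (of_real t - a) - of_real (ln t)"
    using eventually_gt_at_top[of 0]
  proof eventually_elim
    case (elim t)
    have nz: "1 - a * of_real (1 / t) \<noteq> 0"
      using elim assms by (auto simp: complex_eq_iff)
    have "of_real t - a = of_real t * (1 - a * of_real (1 / t))"
      using elim by (simp add: field_simps)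
    then have "Ln (of_real t - a) = Ln (of_real t * (1 - a * of_real (1 / t)))" by simp
    also have "\<dots> = Ln (1 - a * of_real (1 / t)) + of_real (ln t)"
      using elim nz by (simp add: Ln_times_of_real Ln_of_real)
    finally show ?case by simp
  qed
  ultimately show ?thesis
    by (simp add: tendsto_cong)
qed

lemma tendsto_Ln_at_bot:
  fixes a :: complex
  assumes "Im a \<noteq> 0"
  shows "((\<lambda>t. Ln (of_real t - a) - of_real (ln (- t))) \<longlongrightarrow> - sgn (Im a) * \<i> * pi) at_bot"
proof -
  have "((\<lambda>t. Ln (of_real t - (- a)) - of_real (ln t) - sgn (Im a) * \<i> * pi) \<longlongrightarrow> 0 - sgn (Im a) * \<i> * pi) at_top"
    using assms by (intro tendsto_diff tendsto_Ln_at_top tendsto_const) auto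
  also have "(\<lambda>t. Ln (of_real t - (- a)) - of_real (ln t) - sgn (Im a) * \<i> * pi)
     = (\<lambda>t. Ln (of_real (- t) - a) - of_real (ln (- (- t))))"
  proof
    fix t
    have "Ln (- (of_real t + a)) = Ln (of_real t + a) - sgn (Im a) * \<i> * pi"
      using assms by (subst Ln_minus) (auto simp: complex_eq_iff sgn_if)
    then show "Ln (of_real t - (- a)) - of_real (ln t) - sgn (Im a) * \<i> * pi
       = Ln (of_real (- t) - a) - of_real (ln (- (- t)))" by simp
  qed
  finally show ?thesis
    unfolding at_bot_mirror filterlim_filtermap by simp
qed

lemma integrable_cauchy_product:
  fixes a b :: complex
  assumes "Im a \<noteq> 0" "Im b \<noteq> 0"
  shows "integrable lborel (\<lambda>t. 1 / ((of_real t - a) * (of_real t - b)))"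
proof -
  have bd: "\<exists>K>0. \<forall>t::real. sqrt (1 + t\<^sup>2) \<le> K * cmod (of_real t - a)" if "Im a \<noteq> 0" for a
  proof (intro exI[of _ "1 + (1 + cmod a) / \<bar>Im a\<bar>"] conjI allI)
    fix t :: real
    have 1: "\<bar>Im a\<bar> \<le> cmod (of_real t - a)" using abs_Im_le_cmod[of "of_real t - a"] by simp
    have "sqrt (1 + t\<^sup>2) \<le> 1 + \<bar>t\<bar>"
      by (rule real_le_lsqrt) (auto simp: power2_eq_square algebra_simps)
    also have "\<bar>t\<bar> \<le> cmod (of_real t - a) + cmod a"
      using norm_triangle_ineq[of "of_real t - a" a] by simp
    also have "1 + (cmod (of_real t - a) + cmod a) = cmod (of_real t - a) + (1 + cmod a) / \<bar>Im a\<bar> * \<bar>Im a\<bar>"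
      using that by simp
    also have "(1 + cmod a) / \<bar>Im a\<bar> * \<bar>Im a\<bar> \<le> (1 + cmod a) / \<bar>Im a\<bar> * cmod (of_real t - a)"
      using 1 by (intro mult_left_mono) auto
    finally show "sqrt (1 + t\<^sup>2) \<le> (1 + (1 + cmod a) / \<bar>Im a\<bar>) * cmod (of_real t - a)"
      by (simp add: algebra_simps)
  qed (auto intro!: add_pos_nonneg)
  obtain K L where K: "K > 0" "\<And>t::real. sqrt (1 + t\<^sup>2) \<le> K * cmod (of_real t - a)"
     and L: "L > 0" "\<And>t::real. sqrt (1 + t\<^sup>2) \<le> L * cmod (of_real t - b)"
    using bd assms by meson
  show ?thesis
  proof (rule Bochner_Integration.integrable_bound[OF integrable_mult_right[OF integrable_cauchy_weight, of "K * L"]])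
    show "AE t in lborel. norm (1 / ((of_real t - a) * (of_real t - b))) \<le> norm (K * L * cauchy_weight t)"
    proof (rule AE_I2)
      fix t :: real
      have nz: "of_real t \<noteq> a" "of_real t \<noteq> b" using assms by (auto simp: complex_eq_iff)
      have "1 + t\<^sup>2 = sqrt (1 + t\<^sup>2) * sqrt (1 + t\<^sup>2)" by simp
      also have "\<dots> \<le> (K * cmod (of_real t - a)) * (L * cmod (of_real t - b))"
        using K L by (intro mult_mono) auto
      finally have "1 / (cmod (of_real t - a) * cmod (of_real t - b)) \<le> K * L / (1 + t\<^sup>2)"
        using nz by (simp add: divide_simps add_pos_nonneg) (simp add: algebra_simps)
      then show "norm (1 / ((of_real t - a) * (of_real t - b))) \<le> norm (K * L * cauchy_weight t)"
        using K L by (simp add: norm_divide norm_mult cauchy_weight_def)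
    qed
  qed measurable
qed

lemma integral_FTC_real_line:
  fixes g G :: "real \<Rightarrow> complex"
  assumes "\<And>x. (G has_vector_derivative g x) (at x)" "\<And>x. isCont g x"
    and "integrable lborel g" "(G \<longlongrightarrow> B) at_top" "(G \<longlongrightarrow> A) at_bot"
  shows "(LINT x|lborel. g x) = B - A"
proof -
  have "(LBINT x=-\<infinity>..\<infinity>. g x) = B - A"
    using assms
    by (intro interval_integral_FTC_integrable)
       (auto simp: set_integrable_def ereal_tendsto_simps)
  then show ?thesis
    by (simp add: interval_lebesgue_integral_def set_lebesgue_integral_def)
qed

text \<open>The values that the residue theorem predicts, from an antiderivative in terms of the principal
  branch of the logarithm. No branch cut is met, since \<open>of_real t - a\<close> is never real.\<close>

lemma integral_cauchy_product:
  fixes a b :: complex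
  assumes "Im a \<noteq> 0" "Im b \<noteq> 0" "a \<noteq> b"
  shows "(LINT t|lborel. 1 / ((of_real t - a) * (of_real t - b)))
    = (sgn (Im a) - sgn (Im b)) * \<i> * pi / (a - b)"
proof -
  define G where "G t = (Ln (of_real t - a) - Ln (of_real t - b)) / (a - b)" for t :: real
  have nz: "of_real t \<noteq> a" "of_real t \<noteq> b" for t :: real using assms by (auto simp: complex_eq_iff)
  have "(LINT t|lborel. 1 / ((of_real t - a) * (of_real t - b)))
     = (0 - 0) / (a - b) - ((- sgn (Im a) * \<i> * pi) - (- sgn (Im b) * \<i> * pi)) / (a - b)"
  proof (rule integral_FTC_real_line)
    fix t :: real
    have "((\<lambda>z. (Ln (z - a) - Ln (z - b)) / (a - b)) has_field_derivative
        (1 / (of_real t - a) - 1 / (of_real t - b)) / (a - b)) (at (of_real t))"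
      using assms by (auto intro!: derivative_eq_intros simp: complex_nonpos_Reals_iff inverse_eq_divide)
    also have "(1 / (of_real t - a) - 1 / (of_real t - b)) / (a - b) = 1 / ((of_real t - a) * (of_real t - b))"
      using nz assms by (simp add: divide_simps)
    finally show "(G has_vector_derivative 1 / ((of_real t - a) * (of_real t - b))) (at t)"
      unfolding G_def using has_vector_derivative_real_field by fastforce
    show "isCont (\<lambda>t::real. 1 / ((of_real t - a) * (of_real t - b))) t"
      using nz by (intro continuous_intros) auto
  next
    show "integrable lborel (\<lambda>t. 1 / ((of_real t - a) * (of_real t - b)))"
      using assms by (intro integrable_cauchy_product)
    show "(G \<longlongrightarrow> (0 - 0) / (a - b)) at_top"
      using tendsto_divide[OF tendsto_diff[OF tendsto_Ln_at_top tendsto_Ln_at_top] tendsto_const, OF assms(1,2), of "a - b"] assms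
      by (simp add: G_def[abs_def])
    show "(G \<longlongrightarrow> ((- sgn (Im a) * \<i> * pi) - (- sgn (Im b) * \<i> * pi)) / (a - b)) at_bot"
      using tendsto_divide[OF tendsto_diff[OF tendsto_Ln_at_bot tendsto_Ln_at_bot] tendsto_const, OF assms(1,2), of "a - b"] assms
      by (simp add: G_def[abs_def])
  qed
  then show ?thesis by (simp add: diff_divide_distrib algebra_simps)
qed

lemma integral_cauchy_square:
  fixes a :: complex
  assumes "Im a \<noteq> 0"
  shows "(LINT t|lborel. 1 / ((of_real t - a) * (of_real t - a))) = 0"
proof -
  have nz: "of_real t \<noteq> a" for t :: real using assms by (auto simp: complex_eq_iff)
  have "(LINT t|lborel. 1 / ((of_real t - a) * (of_real t - a))) = 0 - 0"
  proof (rule integral_FTC_real_line[where G = "\<lambda>t. - 1 / (of_real t - a)"])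
    fix t :: real
    have "((\<lambda>z. - 1 / (z - a)) has_field_derivative 1 / ((of_real t - a) * (of_real t - a))) (at (of_real t))"
      using nz by (auto intro!: derivative_eq_intros)
    then show "((\<lambda>t. - 1 / (of_real t - a)) has_vector_derivative 1 / ((of_real t - a) * (of_real t - a))) (at t)"
      using has_vector_derivative_real_field by fastforce
    show "isCont (\<lambda>t::real. 1 / ((of_real t - a) * (of_real t - a))) t"
      using nz by (intro continuous_intros) auto
  next
    show "integrable lborel (\<lambda>t. 1 / ((of_real t - a) * (of_real t - a)))"
      using assms by (intro integrable_cauchy_product)
    have inf: "filterlim (\<lambda>t. of_real t - a) at_infinity F" if "filterlim (\<lambda>t::real. t) at_infinity F" for F
    proof -
      have "filterlim (\<lambda>t. norm (of_real t :: complex)) at_top F"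
        using filterlim_at_infinity_imp_norm_at_top[OF that] by simp
      then have "filterlim (\<lambda>t. of_real t :: complex) at_infinity F"
        by (rule filterlim_norm_at_top_imp_at_infinity)
      from tendsto_add_filterlim_at_infinity[OF tendsto_const this, of "- a"] show ?thesis by simp
    qed
    show "((\<lambda>t. - 1 / (of_real t - a)) \<longlongrightarrow> 0) at_top"
      by (intro tendsto_divide_0[OF tendsto_const] inf filterlim_at_top_imp_at_infinity filterlim_ident)
    show "((\<lambda>t. - 1 / (of_real t - a)) \<longlongrightarrow> 0) at_bot"
      by (intro tendsto_divide_0[OF tendsto_const] inf filterlim_at_bot_imp_at_infinity filterlim_ident)
  qed
  then show ?thesis by simp
qed

text \<open>The Cauchy kernels with poles in the upper and in the lower half plane are combinations of the two
  real kernels.\<close>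

lemma cauchy_kernel_eq:
  assumes "s > 0"
  shows "1 / (of_real t - Complex x s) = - of_real (conj_poisson s (x - t)) + \<i> * of_real (poisson s (x - t))" (is ?A)
    and "1 / (of_real t - Complex x (- s)) = - of_real (conj_poisson s (x - t)) - \<i> * of_real (poisson s (x - t))" (is ?B)
proof -
  have e: "of_real t - Complex x r = Complex (t - x) (- r)" for r
    by (simp add: complex_eq_iff)
  have c: "(t - x) * (t - x) = (x - t) * (x - t)"
    by (simp add: algebra_simps)
  have d: "(x - t)\<^sup>2 + s\<^sup>2 \<noteq> 0"
    using assms by (simp add: add_nonneg_pos less_imp_neq[symmetric])
  show ?A ?B
    unfolding poisson_def conj_poisson_def e
    using d by (simp_all add: complex_eq_iff Re_divide Im_divide c power2_eq_square divide_simps)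
qed

text \<open>The sum of the integrals of \<open>1 / ((t - a) (t - b))\<close> with \<open>a\<close> and \<open>b\<close> in the same and in opposite half
  planes has the first integral as real part and the second as imaginary part, up to constants.\<close>

lemma conj_poisson_convolution:
  assumes "s > 0" "r > 0"
  shows "integrable lborel (\<lambda>t. conj_poisson s (x - t) * conj_poisson r (y - t))" (is ?A)
    and "(LINT t|lborel. conj_poisson s (x - t) * conj_poisson r (y - t)) = pi * poisson (s + r) (x - y)" (is ?B)
    and "integrable lborel (\<lambda>t. poisson s (x - t) * conj_poisson r (y - t))" (is ?C)
    and "(LINT t|lborel. poisson s (x - t) * conj_poisson r (y - t)) = pi * conj_poisson (s + r) (y - x)" (is ?D)
proof -
  let ?u = "\<lambda>t. 1 / ((of_real t - Complex x s) * (of_real t - Complex y r))"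
  let ?l = "\<lambda>t. 1 / ((of_real t - Complex x s) * (of_real t - Complex y (- r)))"
  let ?f = "\<lambda>t. conj_poisson s (x - t) * conj_poisson r (y - t)"
  let ?g = "\<lambda>t. poisson s (x - t) * conj_poisson r (y - t)"
  have i: "integrable lborel ?u" "integrable lborel ?l"
    using assms by (auto intro!: integrable_cauchy_product)
  have u: "?u t + ?l t = complex_of_real (2 * ?f t) - \<i> * of_real (2 * ?g t)" for t
  proof -
    have "?u t + ?l t = 1 / (of_real t - Complex x s) * (1 / (of_real t - Complex y r) + 1 / (of_real t - Complex y (- r)))"
      by (simp add: distrib_left)
    also have "\<dots> = complex_of_real (2 * ?f t) - \<i> * of_real (2 * ?g t)"
      using assms by (simp add: cauchy_kernel_eq algebra_simps)
    finally show ?thesis .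
  qed
  have I: "integrable lborel (\<lambda>t. complex_of_real (2 * ?f t) - \<i> * of_real (2 * ?g t))"
    using Bochner_Integration.integrable_add[OF i] unfolding u .
  have "integrable lborel (\<lambda>t. Re (complex_of_real (2 * ?f t) - \<i> * of_real (2 * ?g t)))"
    using I by (rule integrable_Re)
  then have f: ?A by simp
  have "integrable lborel (\<lambda>t. Im (complex_of_real (2 * ?f t) - \<i> * of_real (2 * ?g t)))"
    using I by (rule integrable_Im)
  then have g: ?C by simp
  show ?A ?C by fact+
  have "(LINT t|lborel. ?u t) = 0"
    using assms integral_cauchy_product[of "Complex x s" "Complex y r"] integral_cauchy_square[of "Complex x s"]
    by (cases "Complex x s = Complex y r") auto
  moreover have "(LINT t|lborel. ?l t) = 2 * \<i> * pi / (Complex (x - y) (s + r))"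
    using assms integral_cauchy_product[of "Complex x s" "Complex y (- r)"]
    by (simp add: complex_eq_iff minus_complex.ctr)
  ultimately have "(LINT t|lborel. complex_of_real (2 * ?f t) - \<i> * of_real (2 * ?g t)) = 2 * \<i> * pi / (Complex (x - y) (s + r))"
    using Bochner_Integration.integral_add[OF i] unfolding u by simp
  also have "(LINT t|lborel. complex_of_real (2 * ?f t) - \<i> * of_real (2 * ?g t)) =
     complex_of_real (2 * (LINT t|lborel. ?f t)) - \<i> * of_real (2 * (LINT t|lborel. ?g t))"
    using f g by (simp del: of_real_mult)
  finally have *: "complex_of_real (2 * (LINT t|lborel. ?f t)) - \<i> * of_real (2 * (LINT t|lborel. ?g t))
     = 2 * \<i> * pi / (Complex (x - y) (s + r))" .
  have "Re (2 * \<i> * pi / (Complex (x - y) (s + r))) = 2 * (pi * poisson (s + r) (x - y))"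
    and "Im (2 * \<i> * pi / (Complex (x - y) (s + r))) = - 2 * (pi * conj_poisson (s + r) (y - x))"
    by (simp_all add: Re_divide Im_divide poisson_def conj_poisson_def power2_commute[of x y] flip: minus_divide_left)
      (simp add: algebra_simps diff_divide_distrib)
  with arg_cong[OF *, of Re] arg_cong[OF *, of Im] show ?B ?D
    by (simp_all del: of_real_mult)
qed

lemma poisson_nonneg: "s > 0 \<Longrightarrow> 0 \<le> poisson s u"
  by (simp add: poisson_def)

lemma has_bochner_integral_poisson:
  assumes "s > 0"
  shows "has_bochner_integral lborel (\<lambda>x. poisson s (x - t)) pi"
proof -
  have "(LINT x|lborel. inverse (1 + x\<^sup>2)) = pi"
    using LBINT_inverse_1_plus_square
    by (simp add: interval_lebesgue_integral_def set_lebesgue_integral_def)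
  then have "has_bochner_integral lborel cauchy_weight pi"
    using integrable_cauchy_weight by (simp add: has_bochner_integral_iff inverse_eq_divide cauchy_weight_def[abs_def])
  then have "has_bochner_integral lborel (\<lambda>x. cauchy_weight (- t / s + 1 / s * x)) (pi /\<^sub>R \<bar>1 / s\<bar>)"
    using assms by (subst (asm) lborel_has_bochner_integral_real_affine_iff[of "1 / s" _ _ "- t / s"]) auto
  then have "has_bochner_integral lborel (\<lambda>x. (1 / s) *\<^sub>R cauchy_weight (- t / s + 1 / s * x)) ((1 / s) *\<^sub>R (pi /\<^sub>R \<bar>1 / s\<bar>))"
    by (rule has_bochner_integral_scaleR_right)
  moreover have "(1 / s) *\<^sub>R cauchy_weight (- t / s + 1 / s * x) = poisson s (x - t)" for x
  proof -
    have "- t / s + 1 / s * x = (x - t) / s" using assms by (simp add: field_simps)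
    moreover have "s\<^sup>2 + (x - t)\<^sup>2 > 0" using assms by (simp add: add_pos_nonneg)
    ultimately show ?thesis
      using assms by (simp add: poisson_def cauchy_weight_def power_divide divide_simps add_eq_0_iff) (simp add: power2_eq_square algebra_simps)
  qed
  ultimately show ?thesis using assms by simp
qed

lemma nn_integral_poisson: "s > 0 \<Longrightarrow> (\<integral>\<^sup>+x. ennreal (poisson s (x - t)) \<partial>lborel) = ennreal pi"
  using has_bochner_integral_poisson[of s t]
  by (subst nn_integral_eq_integral) (auto simp: has_bochner_integral_iff poisson_nonneg)

section \<open>Lebesgue points and Poisson integrals\<close>

lemma AE_lborel_negligible:
  assumes "negligible N"
  shows "AE x in lborel. x \<notin> N"
proof -
  have "AE x in lebesgue. x \<notin> N"
    using assms by (intro AE_not_in) (simp add: negligible_iff_null_sets)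
  then show ?thesis by (simp add: AE_completion_iff)
qed

text \<open>A one-sided form of Lebesgue differentiation, stated for a bound \<open>c\<close> greater than \<open>\<phi> x\<close> only.\<close>

lemma AE_right_average_le:
  fixes \<phi> :: "real \<Rightarrow> real"
  assumes "\<And>x. 0 \<le> \<phi> x" "\<And>a b. \<phi> integrable_on {a..b}"
  shows "AE x in lborel. \<forall>c>\<phi> x. \<exists>d>0. \<forall>r. 0 < r \<and> r < d \<longrightarrow>
           (\<integral>\<^sup>+y. ennreal (\<phi> y) * indicator {x..x + r} y \<partial>lborel) \<le> ennreal (c * r)"
proof -
  obtain N where N: "negligible N"
    and lim: "\<And>x e. x \<notin> N \<Longrightarrow> 0 < e \<Longrightarrow>
          \<exists>d>0. \<forall>h. 0 < h \<and> h < d \<longrightarrow> norm (integral (cbox x (x + h *\<^sub>R One)) \<phi> /\<^sub>R h ^ DIM(real) - \<phi> x) < e"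
    using assms(2) integrable_ccontinuous_explicit[of \<phi>] by (auto simp: cbox_interval)
  from AE_lborel_negligible[OF N] show ?thesis
  proof (eventually_elim, intro allI impI)
    fix x c assume "x \<notin> N" "\<phi> x < c"
    then obtain d where d: "d > 0" "\<And>h. 0 < h \<Longrightarrow> h < d \<Longrightarrow> \<bar>integral {x..x + h} \<phi> / h - \<phi> x\<bar> < c - \<phi> x"
      using lim[of x "c - \<phi> x"] by (auto simp: cbox_interval divide_inverse mult.commute)
    show "\<exists>d>0. \<forall>r. 0 < r \<and> r < d \<longrightarrow>
           (\<integral>\<^sup>+y. ennreal (\<phi> y) * indicator {x..x + r} y \<partial>lborel) \<le> ennreal (c * r)"
    proof (intro exI[of _ d] conjI allI impI d(1))
      fix r assume r: "0 < r \<and> r < d"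
      then have "integral {x..x + r} \<phi> / r < c" using d(2)[of r] by auto
      then have "integral {x..x + r} \<phi> \<le> c * r" using r by (simp add: divide_simps)
      moreover have "(\<integral>\<^sup>+y. ennreal (\<phi> y) * indicator {x..x + r} y \<partial>lborel) = ennreal (integral {x..x + r} \<phi>)"
        using assms by (intro nn_integral_has_integral_lebesgue') auto
      ultimately show "(\<integral>\<^sup>+y. ennreal (\<phi> y) * indicator {x..x + r} y \<partial>lborel) \<le> ennreal (c * r)"
        by (simp add: ennreal_leI)
    qed
  qed
qed

lemma AE_left_average_le:
  fixes \<phi> :: "real \<Rightarrow> real"
  assumes "\<And>x. 0 \<le> \<phi> x" "\<And>a b. \<phi> integrable_on {a..b}" and [measurable]: "\<phi> \<in> borel_measurable borel"
  shows "AE x in lborel. \<forall>c>\<phi> x. \<exists>d>0. \<forall>r. 0 < r \<and> r < d \<longrightarrow>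
           (\<integral>\<^sup>+y. ennreal (\<phi> y) * indicator {x - r..x} y \<partial>lborel) \<le> ennreal (c * r)"
proof -
  have refl: "(\<integral>\<^sup>+y. ennreal (\<phi> (- y)) * indicator {- x..- x + r} y \<partial>lborel)
      = (\<integral>\<^sup>+y. ennreal (\<phi> y) * indicator {x - r..x} y \<partial>lborel)" for x r
    by (subst (2) nn_integral_real_affine[where c = "-1" and t = 0])
       (auto intro!: nn_integral_cong split: split_indicator)
  have int: "(\<lambda>x. \<phi> (- x)) integrable_on {a..b}" for a b
    using Henstock_Kurzweil_Integration.integrable_reflect_real[where f = \<phi> and a = "- b" and b = "- a"] assms(2)[of "- b" "- a"] by auto
  have "AE x in lborel. \<forall>c>\<phi> (- x). \<exists>d>0. \<forall>r. 0 < r \<and> r < d \<longrightarrow>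
           (\<integral>\<^sup>+y. ennreal (\<phi> (- y)) * indicator {x..x + r} y \<partial>lborel) \<le> ennreal (c * r)"
    by (rule AE_right_average_le) (auto simp: assms(1) int)
  then have "AE x in distr lborel borel uminus. \<forall>c>\<phi> (- x). \<exists>d>0. \<forall>r. 0 < r \<and> r < d \<longrightarrow>
           (\<integral>\<^sup>+y. ennreal (\<phi> (- y)) * indicator {x..x + r} y \<partial>lborel) \<le> ennreal (c * r)"
    by (simp only: lborel_distr_uminus)
  then have "AE x in lborel. \<forall>c>\<phi> (- (- x)). \<exists>d>0. \<forall>r. 0 < r \<and> r < d \<longrightarrow>
           (\<integral>\<^sup>+y. ennreal (\<phi> (- y)) * indicator {- x..- x + r} y \<partial>lborel) \<le> ennreal (c * r)"
    by (rule AE_distrD[rotated]) simp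
  then show ?thesis by (simp only: refl minus_minus)
qed

text \<open>Lebesgue points in the strong sense. The means are not normalized by the length \<open>2 * r\<close>, which
  makes no difference as \<open>e\<close> is arbitrary.\<close>

definition lebesgue_point :: "(real \<Rightarrow> complex) \<Rightarrow> real \<Rightarrow> bool"
  where "lebesgue_point h t \<longleftrightarrow> (\<forall>e>0. \<exists>d>0. \<forall>r. 0 < r \<and> r < d \<longrightarrow>
    (\<integral>\<^sup>+x. ennreal (cmod (h x - h t)) * indicator {t - r..t + r} x \<partial>lborel) \<le> ennreal (e * r))"

text \<open>Differentiation is applied to \<open>cmod (h x - q)\<close> for all \<open>q\<close> in a countable dense set at once.\<close>

lemma AE_lebesgue_point:
  fixes h :: "real \<Rightarrow> complex"
  assumes [measurable]: "h \<in> borel_measurable borel" and h: "\<And>a b. set_integrable lborel {a..b} h"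
  shows "AE t in lborel. lebesgue_point h t"
proof -
  obtain D :: "complex set" where D: "countable D" "\<And>X. open X \<Longrightarrow> X \<noteq> {} \<Longrightarrow> \<exists>d\<in>D. d \<in> X"
    using countable_dense_setE by metis
  have i: "(\<lambda>x. cmod (h x - q)) integrable_on {a..b}" for q a b
  proof -
    have "set_integrable lborel {a..b} (\<lambda>x. h x - q)"
      by (intro set_integral_diff h)
        (auto simp: set_integrable_def emeasure_lborel_Icc_eq intro!: integrable_scaleR_left integrable_real_indicator)
    from set_integrable_norm[OF this] show ?thesis by (rule set_borel_integral_eq_integral)
  qed
  have "AE t in lborel. \<forall>q\<in>D. (\<forall>c>cmod (h t - q). \<exists>d>0. \<forall>r. 0 < r \<and> r < d \<longrightarrow>
           (\<integral>\<^sup>+y. ennreal (cmod (h y - q)) * indicator {t..t + r} y \<partial>lborel) \<le> ennreal (c * r))"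
    by (intro AE_ball_countable' D AE_right_average_le i) auto
  moreover have "AE t in lborel. \<forall>q\<in>D. (\<forall>c>cmod (h t - q). \<exists>d>0. \<forall>r. 0 < r \<and> r < d \<longrightarrow>
           (\<integral>\<^sup>+y. ennreal (cmod (h y - q)) * indicator {t - r..t} y \<partial>lborel) \<le> ennreal (c * r))"
    by (intro AE_ball_countable' D AE_left_average_le i) auto
  ultimately show ?thesis
  proof eventually_elim
    case (elim t)
    show ?case unfolding lebesgue_point_def
    proof (intro allI impI)
      fix e :: real assume e: "e > 0"
      \<comment> \<open>Two one-sided means are at most \<open>c * r\<close> each, and \<open>cmod (h t - q)\<close> contributes \<open>2 * c * r\<close>.\<close>
      define c where "c = e / 4"
      obtain q where q: "q \<in> D" "cmod (h t - q) < c"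
        using D(2)[of "ball (h t) c"] e by (auto simp: c_def dist_norm)
      obtain d1 where d1: "d1 > 0" "\<And>r. 0 < r \<and> r < d1 \<Longrightarrow>
           (\<integral>\<^sup>+y. ennreal (cmod (h y - q)) * indicator {t..t + r} y \<partial>lborel) \<le> ennreal (c * r)"
        using elim(1) q by meson
      obtain d2 where d2: "d2 > 0" "\<And>r. 0 < r \<and> r < d2 \<Longrightarrow>
           (\<integral>\<^sup>+y. ennreal (cmod (h y - q)) * indicator {t - r..t} y \<partial>lborel) \<le> ennreal (c * r)"
        using elim(2) q by meson
      show "\<exists>d>0. \<forall>r. 0 < r \<and> r < d \<longrightarrow>
        (\<integral>\<^sup>+x. ennreal (cmod (h x - h t)) * indicator {t - r..t + r} x \<partial>lborel) \<le> ennreal (e * r)"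
      proof (intro exI[of _ "min d1 d2"] conjI allI impI)
        fix r assume r: "0 < r \<and> r < min d1 d2"
        have "(\<integral>\<^sup>+x. ennreal (cmod (h x - h t)) * indicator {t - r..t + r} x \<partial>lborel)
          \<le> (\<integral>\<^sup>+x. (ennreal (cmod (h x - q)) * indicator {t..t + r} x
             + ennreal (cmod (h x - q)) * indicator {t - r..t} x)
             + ennreal c * indicator {t - r..t + r} x \<partial>lborel)"
        proof (rule nn_integral_mono)
          fix x
          have "cmod (h x - h t) \<le> cmod (h x - q) + c"
            using norm_triangle_ineq[of "h x - q" "q - h t"] q by (simp add: norm_minus_commute)
          then have "ennreal (cmod (h x - h t)) \<le> ennreal (cmod (h x - q)) + ennreal c"
            using e by (simp add: c_def ennreal_leI flip: ennreal_plus)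
          then show "ennreal (cmod (h x - h t)) * indicator {t - r..t + r} x
            \<le> (ennreal (cmod (h x - q)) * indicator {t..t + r} x
             + ennreal (cmod (h x - q)) * indicator {t - r..t} x)
             + ennreal c * indicator {t - r..t + r} x"
            by (auto split: split_indicator intro: order_trans[OF _ add_right_mono] simp: add_increasing)
        qed
        also have "\<dots> = (\<integral>\<^sup>+x. ennreal (cmod (h x - q)) * indicator {t..t + r} x \<partial>lborel)
          + (\<integral>\<^sup>+x. ennreal (cmod (h x - q)) * indicator {t - r..t} x \<partial>lborel)
          + (\<integral>\<^sup>+x. ennreal c * indicator {t - r..t + r} x \<partial>lborel)"
          by (simp add: nn_integral_add)
        also have "(\<integral>\<^sup>+x. ennreal c * indicator {t - r..t + r} x \<partial>lborel) = ennreal (c * (2 * r))"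
          using e r by (simp add: nn_integral_cmult_indicator c_def flip: ennreal_mult')
        also have "(\<integral>\<^sup>+x. ennreal (cmod (h x - q)) * indicator {t..t + r} x \<partial>lborel)
          + (\<integral>\<^sup>+x. ennreal (cmod (h x - q)) * indicator {t - r..t} x \<partial>lborel) + ennreal (c * (2 * r))
          \<le> ennreal (c * r) + ennreal (c * r) + ennreal (c * (2 * r))"
          using r by (intro add_mono d1 d2) auto
        also have "\<dots> = ennreal (e * r)"
          using e r by (simp add: c_def flip: ennreal_plus) 
        finally show "(\<integral>\<^sup>+x. ennreal (cmod (h x - h t)) * indicator {t - r..t + r} x \<partial>lborel) \<le> ennreal (e * r)" .
      qed (use d1 d2 in auto)
    qed
  qed
qed


lemma poisson_le:
  assumes "s > 0" "u \<noteq> 0"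
  shows "poisson s u \<le> s / u\<^sup>2"
  using assms by (auto simp: poisson_def zero_less_mult_iff add_nonneg_pos intro!: divide_left_mono)

lemma borel_measurable_indicator_symmetric_interval [measurable]:
  fixes f g :: "'a \<Rightarrow> real"
  assumes [measurable]: "f \<in> borel_measurable M" "g \<in> borel_measurable M"
  shows "(\<lambda>x. indicator {- f x..f x} (g x) :: ennreal) \<in> borel_measurable M"
proof -
  have "(\<lambda>x. indicator {- f x..f x} (g x) :: ennreal) = (\<lambda>x. if - f x \<le> g x \<and> g x \<le> f x then 1 else 0)"
    by (auto simp: indicator_def)
  also have "\<dots> \<in> borel_measurable M" by measurable
  finally show ?thesis .
qed

text \<open>The Poisson kernel is a superposition of the indicators of the intervals \<open>{-r..r}\<close>, so an
  estimate for the means over such intervals carries over to Poisson integrals.\<close>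

lemma nn_integral_poisson_near:
  fixes \<omega> :: "real \<Rightarrow> ennreal"
  assumes [measurable]: "\<omega> \<in> borel_measurable borel" and s: "s > 0" and e: "e > 0" and d: "d > 0"
    and mean: "\<And>r. 0 < r \<Longrightarrow> r \<le> d \<Longrightarrow> (\<integral>\<^sup>+u. \<omega> u * indicator {- r..r} u \<partial>lborel) \<le> ennreal (e * r)"
  shows "(\<integral>\<^sup>+u. ennreal (poisson s u) * \<omega> u * indicator {- d..d} u \<partial>lborel) \<le> ennreal (8 * e)"
proof -
  define K where "K r = 2 * s * r / (r\<^sup>2 + s\<^sup>2)\<^sup>2" for r
  have [measurable]: "K \<in> borel_measurable borel" unfolding K_def by measurable
  have pos: "r\<^sup>2 + s\<^sup>2 > 0" for r using s by (simp add: add_nonneg_pos)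
  have layer: "ennreal (poisson s u) = ennreal (poisson s d) + (\<integral>\<^sup>+r. ennreal (K r) * indicator {\<bar>u\<bar>..d} r \<partial>lborel)"
    if "\<bar>u\<bar> \<le> d" for u
  proof -
    have K0: "0 \<le> K r" if "0 \<le> r" for r using that s by (simp add: K_def)
    have "(\<integral>\<^sup>+r. ennreal (K r) * indicator {\<bar>u\<bar>..d} r \<partial>lborel) = ennreal (- poisson s d - - poisson s \<bar>u\<bar>)"
    proof (rule nn_integral_FTC_Icc)
      fix r
      show "((\<lambda>r. - poisson s r) has_real_derivative K r) (at r)"
        unfolding poisson_def K_def using pos[of r]
        by (auto intro!: derivative_eq_intros simp: power2_eq_square)
    next
      fix r assume "r \<in> {\<bar>u\<bar>..d}"
      then have "0 \<le> r" using abs_ge_zero[of u] by (elim atLeastAtMost_iff[THEN iffD1, elim_format] conjE) linarith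
      then show "0 \<le> K r" by (rule K0)
    qed (measurable, fact that)
    moreover have "poisson s \<bar>u\<bar> = poisson s u" by (simp add: poisson_def)
    moreover have "poisson s d \<le> poisson s u"
      using that d s pos abs_le_square_iff[of u d] unfolding poisson_def
      by (intro divide_left_mono add_right_mono) auto
    ultimately show ?thesis
      using poisson_nonneg[OF s, of d] by (simp flip: ennreal_plus)
  qed
  have "(\<integral>\<^sup>+u. ennreal (poisson s u) * \<omega> u * indicator {- d..d} u \<partial>lborel)
      = (\<integral>\<^sup>+u. ennreal (poisson s d) * (\<omega> u * indicator {- d..d} u)
          + (\<integral>\<^sup>+r. (\<omega> u * indicator {- r..r} u) * (ennreal (K r) * indicator {0..d} r) \<partial>lborel) \<partial>lborel)"
  proof (rule nn_integral_cong)
    fix u :: real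
    have "(\<integral>\<^sup>+r. (\<omega> u * indicator {- r..r} u) * (ennreal (K r) * indicator {0..d} r) \<partial>lborel)
       = (\<integral>\<^sup>+r. \<omega> u * indicator {- d..d} u * (ennreal (K r) * indicator {\<bar>u\<bar>..d} r) \<partial>lborel)"
      by (intro nn_integral_cong) (auto split: split_indicator)
    also have "\<dots> = \<omega> u * indicator {- d..d} u * (\<integral>\<^sup>+r. ennreal (K r) * indicator {\<bar>u\<bar>..d} r \<partial>lborel)"
      by (intro nn_integral_cmult) measurable
    finally have layers: "(\<integral>\<^sup>+r. (\<omega> u * indicator {- r..r} u) * (ennreal (K r) * indicator {0..d} r) \<partial>lborel)
       = \<omega> u * indicator {- d..d} u * (\<integral>\<^sup>+r. ennreal (K r) * indicator {\<bar>u\<bar>..d} r \<partial>lborel)" .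
    show "ennreal (poisson s u) * \<omega> u * indicator {- d..d} u
       = ennreal (poisson s d) * (\<omega> u * indicator {- d..d} u)
          + (\<integral>\<^sup>+r. (\<omega> u * indicator {- r..r} u) * (ennreal (K r) * indicator {0..d} r) \<partial>lborel)"
    proof (cases "\<bar>u\<bar> \<le> d")
      case True
      then have "u \<in> {- d..d}" by auto
      then show ?thesis
        unfolding layers layer[OF True] by (simp add: distrib_right mult.commute[of "\<omega> u"])
    next
      case False
      then have "u \<notin> {- d..d}" by auto
      then show ?thesis by (simp add: layers)
    qed
  qed
  also have "\<dots> = ennreal (poisson s d) * (\<integral>\<^sup>+u. \<omega> u * indicator {- d..d} u \<partial>lborel)
       + (\<integral>\<^sup>+u. (\<integral>\<^sup>+r. (\<omega> u * indicator {- r..r} u) * (ennreal (K r) * indicator {0..d} r) \<partial>lborel) \<partial>lborel)"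
    by (simp add: nn_integral_add nn_integral_cmult)
  also have "(\<integral>\<^sup>+u. (\<integral>\<^sup>+r. (\<omega> u * indicator {- r..r} u) * (ennreal (K r) * indicator {0..d} r) \<partial>lborel) \<partial>lborel)
     = (\<integral>\<^sup>+r. (\<integral>\<^sup>+u. (\<omega> u * indicator {- r..r} u) * (ennreal (K r) * indicator {0..d} r) \<partial>lborel) \<partial>lborel)"
    by (rule lborel_pair.Fubini') (simp add: case_prod_beta)
  also have "\<dots> = (\<integral>\<^sup>+r. (\<integral>\<^sup>+u. \<omega> u * indicator {- r..r} u \<partial>lborel) * (ennreal (K r) * indicator {0..d} r) \<partial>lborel)"
    by (intro nn_integral_cong nn_integral_multc) measurable
  also have "\<dots> \<le> (\<integral>\<^sup>+r. ennreal (2 * e) * ennreal (poisson s (r - 0)) \<partial>lborel)"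
  proof (rule nn_integral_mono)
    fix r :: real
    show "(\<integral>\<^sup>+u. \<omega> u * indicator {- r..r} u \<partial>lborel) * (ennreal (K r) * indicator {0..d} r)
       \<le> ennreal (2 * e) * ennreal (poisson s (r - 0))"
    proof (cases "0 < r \<and> r \<le> d")
      case True
      have "e * r * K r = 2 * e * poisson s r * (r\<^sup>2 / (r\<^sup>2 + s\<^sup>2))"
        by (simp add: K_def poisson_def power2_eq_square)
      also have "\<dots> \<le> 2 * e * poisson s r * 1"
        using e s pos[of r] by (intro mult_left_mono) (auto simp: poisson_nonneg)
      finally have "e * r * K r \<le> 2 * e * poisson s r" by simp
      have "(\<integral>\<^sup>+u. \<omega> u * indicator {- r..r} u \<partial>lborel) * (ennreal (K r) * indicator {0..d} r)
        \<le> ennreal (e * r) * ennreal (K r)"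
        using True mean[of r] by (auto intro!: mult_right_mono)
      also have "\<dots> \<le> ennreal (2 * e) * ennreal (poisson s (r - 0))"
        using \<open>e * r * K r \<le> _\<close> True e s
        by (auto simp: K_def poisson_nonneg intro!: ennreal_leI simp flip: ennreal_mult')
      finally show ?thesis .
    qed (auto split: split_indicator simp: K_def)
  qed
  also have "\<dots> = ennreal (2 * e * pi)"
    by (subst nn_integral_cmult) (use nn_integral_poisson[OF s, of 0] e in \<open>simp_all flip: ennreal_mult'\<close>)
  also have "ennreal (poisson s d) * (\<integral>\<^sup>+u. \<omega> u * indicator {- d..d} u \<partial>lborel)
     \<le> ennreal (poisson s d) * ennreal (e * d)"
    using mean[of d] d by (intro mult_left_mono) auto
  also have "\<dots> \<le> ennreal e"
  proof -
    have "s * d \<le> d\<^sup>2 + s\<^sup>2" using mult_pos_pos[OF s d] sum_squares_bound[of s d] by linarith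
    then have "poisson s d * d \<le> 1" using pos[of d] by (simp add: poisson_def)
    then have "e * (poisson s d * d) \<le> e * 1" using e by (intro mult_left_mono) auto
    then show ?thesis using poisson_nonneg[OF s, of d] d e
      by (simp add: algebra_simps ennreal_leI flip: ennreal_mult')
  qed
  finally have "(\<integral>\<^sup>+u. ennreal (poisson s u) * \<omega> u * indicator {- d..d} u \<partial>lborel) \<le> ennreal e + ennreal (2 * e * pi)"
    by (simp add: add_mono)
  also have "\<dots> \<le> ennreal (8 * e)"
  proof -
    have "e * pi \<le> e * 3.5" using e pi_less_4 pi_approx by (intro mult_left_mono) auto
    then show ?thesis using e by (auto simp flip: ennreal_plus intro!: ennreal_leI)
  qed
  finally show ?thesis .
qed

lemma cauchy_weight_shift: "cauchy_weight u \<le> 2 * (1 + t\<^sup>2) * cauchy_weight (t + u)"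
proof -
  have "1 + (t + u)\<^sup>2 \<le> 2 * (1 + t\<^sup>2) * (1 + u\<^sup>2)"
  proof -
    have "0 \<le> 1 + (t - u)\<^sup>2 + 2 * t\<^sup>2 * u\<^sup>2" by (simp add: add_nonneg_nonneg)
    then show ?thesis by (simp add: power2_eq_square algebra_simps)
  qed
  moreover have "0 < 1 + (t + u)\<^sup>2" "0 < 1 + u\<^sup>2" by (auto intro: add_pos_nonneg)
  ultimately show ?thesis by (simp add: divide_simps cauchy_weight_def)
qed

lemma poisson_le_cauchy_weight:
  assumes "s > 0"
  shows "\<exists>C. \<forall>x. poisson s (x - t) \<le> C * cauchy_weight x"
proof -
  have "poisson s (x - t) \<le> (s + 1 / s) * (2 * (1 + t\<^sup>2)) * cauchy_weight x" for x
  proof -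
    have "poisson s u \<le> (s + 1 / s) * cauchy_weight u" for u
      using assms by (simp add: poisson_def cauchy_weight_def divide_simps add_nonneg_pos add_pos_nonneg)
        (simp add: algebra_simps power2_eq_square)
    then have "poisson s (x - t) \<le> (s + 1 / s) * cauchy_weight (x - t)" .
    also have "\<dots> \<le> (s + 1 / s) * (2 * (1 + t\<^sup>2) * cauchy_weight (t + (x - t)))"
      using assms by (intro mult_left_mono cauchy_weight_shift) auto
    finally show ?thesis by (simp add: mult_ac)
  qed
  then show ?thesis by blast
qed

lemma integrable_poisson_mult:
  fixes h :: "real \<Rightarrow> complex"
  assumes [measurable]: "h \<in> borel_measurable borel" and h: "integrable lborel (\<lambda>x. cmod (h x) * cauchy_weight x)"
    and s: "s > 0"
  shows "integrable lborel (\<lambda>x. poisson s (x - t) *\<^sub>R h x)"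
proof -
  obtain C where C: "\<And>x. poisson s (x - t) \<le> C * cauchy_weight x"
    using poisson_le_cauchy_weight[OF s] by blast
  show ?thesis
  proof (rule Bochner_Integration.integrable_bound[OF integrable_mult_right[OF h, of C]])
    show "AE x in lborel. norm (poisson s (x - t) *\<^sub>R h x) \<le> norm (C * (cmod (h x) * cauchy_weight x))"
    proof (rule AE_I2)
      fix x
      have "norm (poisson s (x - t) *\<^sub>R h x) \<le> (C * cauchy_weight x) * cmod (h x)"
        using poisson_nonneg[OF s] C by (auto intro!: mult_right_mono)
      also have "\<dots> \<le> norm (C * (cmod (h x) * cauchy_weight x))"
        by (simp add: mult_ac)
      finally show "norm (poisson s (x - t) *\<^sub>R h x) \<le> norm (C * (cmod (h x) * cauchy_weight x))" .
    qed
  qed measurable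
qed

text \<open>Convergence of Poisson integrals at Lebesgue points. Outside a small interval around \<open>t\<close> the kernel
  is at most \<open>s\<close> times a multiple of the weight.\<close>

lemma poisson_integral_tendsto:
  fixes h :: "real \<Rightarrow> complex"
  assumes [measurable]: "h \<in> borel_measurable borel" and h: "integrable lborel (\<lambda>x. cmod (h x) * cauchy_weight x)"
    and t: "lebesgue_point h t"
  shows "((\<lambda>s. LINT x|lborel. poisson s (x - t) * cmod (h x - h t)) \<longlongrightarrow> 0) (at_right 0)"
proof -
  define \<omega> where "\<omega> u = cmod (h (t + u) - h t)" for u
  have [measurable]: "\<omega> \<in> borel_measurable borel" unfolding \<omega>_def by measurable
  define W where "W = (LINT u|lborel. \<omega> u * cauchy_weight u)"
  have W: "integrable lborel (\<lambda>u. \<omega> u * cauchy_weight u)"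
  proof (rule Bochner_Integration.integrable_bound)
    show "integrable lborel (\<lambda>u. 2 * (1 + t\<^sup>2) * (cmod (h (t + 1 * u)) * cauchy_weight (t + 1 * u)) + cmod (h t) * cauchy_weight u)"
      using lborel_integrable_real_affine[OF h, of 1 t] integrable_cauchy_weight
      by (intro Bochner_Integration.integrable_add integrable_mult_right) auto
    show "AE u in lborel. norm (\<omega> u * cauchy_weight u) \<le> norm (2 * (1 + t\<^sup>2) * (cmod (h (t + 1 * u)) * cauchy_weight (t + 1 * u)) + cmod (h t) * cauchy_weight u)"
    proof (rule AE_I2)
      fix u
      have "\<omega> u * cauchy_weight u \<le> (cmod (h (t + u)) + cmod (h t)) * cauchy_weight u"
        unfolding \<omega>_def by (intro mult_right_mono norm_triangle_ineq4) auto
      also have "\<dots> \<le> cmod (h (t + u)) * (2 * (1 + t\<^sup>2) * cauchy_weight (t + u)) + cmod (h t) * cauchy_weight u"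
        unfolding distrib_right by (intro add_right_mono mult_left_mono cauchy_weight_shift) auto
      finally show "norm (\<omega> u * cauchy_weight u) \<le> norm (2 * (1 + t\<^sup>2) * (cmod (h (t + 1 * u)) * cauchy_weight (t + 1 * u)) + cmod (h t) * cauchy_weight u)"
        by (simp add: \<omega>_def mult_ac)
    qed
  qed measurable
  have "W \<ge> 0" unfolding W_def by (intro Bochner_Integration.integral_nonneg) (auto simp: \<omega>_def)
  have bound: "\<exists>C\<ge>0. \<forall>s>0. (LINT x|lborel. poisson s (x - t) * cmod (h x - h t)) \<le> 8 * e + s * C" if e: "e > 0" for e
  proof -
    obtain d' where d': "d' > 0" "\<And>r. 0 < r \<Longrightarrow> r < d' \<Longrightarrow>
        (\<integral>\<^sup>+x. ennreal (cmod (h x - h t)) * indicator {t - r..t + r} x \<partial>lborel) \<le> ennreal (e * r)"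
      using t e unfolding lebesgue_point_def by meson
    define d where "d = d' / 2"
    have d: "d > 0" "d < d'" using d' by (auto simp: d_def)
    have shift: "(\<integral>\<^sup>+x. f (x - t) x \<partial>lborel) = (\<integral>\<^sup>+u. f u (t + u) \<partial>lborel)"
      if [measurable]: "(\<lambda>x. f (x - t) x) \<in> borel_measurable borel" for f :: "real \<Rightarrow> real \<Rightarrow> ennreal"
      by (subst nn_integral_real_affine[where c = 1 and t = t]) auto
    have mean: "(\<integral>\<^sup>+u. ennreal (\<omega> u) * indicator {- r..r} u \<partial>lborel) \<le> ennreal (e * r)" if "0 < r" "r \<le> d" for r
    proof -
      have "(\<integral>\<^sup>+u. ennreal (\<omega> u) * indicator {- r..r} u \<partial>lborel)
        = (\<integral>\<^sup>+x. ennreal (cmod (h x - h t)) * indicator {- r..r} (x - t) \<partial>lborel)"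
        by (subst shift[where f = "\<lambda>u x. ennreal (cmod (h x - h t)) * indicator {- r..r} u"]) (auto simp: \<omega>_def)
      also have "\<dots> = (\<integral>\<^sup>+x. ennreal (cmod (h x - h t)) * indicator {t - r..t + r} x \<partial>lborel)"
        by (intro nn_integral_cong) (auto split: split_indicator)
      finally show ?thesis using d'(2)[of r] that d by simp
    qed
    have "(LINT x|lborel. poisson s (x - t) * cmod (h x - h t)) \<le> 8 * e + s * ((1 + 1 / d\<^sup>2) * W)" if s: "s > 0" for s
    proof -
      have far: "poisson s u \<le> s * (1 + 1 / d\<^sup>2) * cauchy_weight u" if "\<not> \<bar>u\<bar> \<le> d" for u
      proof -
        have u: "d\<^sup>2 \<le> u\<^sup>2" "u\<^sup>2 > 0" using that d by (auto simp: abs_le_square_iff[symmetric])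
        then have "1 \<le> u\<^sup>2 / d\<^sup>2" using d by simp
        then have "1 + u\<^sup>2 \<le> (1 + 1 / d\<^sup>2) * u\<^sup>2" by (simp add: algebra_simps)
        then have "s * (1 + u\<^sup>2) / ((1 + u\<^sup>2) * u\<^sup>2) \<le> s * ((1 + 1 / d\<^sup>2) * u\<^sup>2) / ((1 + u\<^sup>2) * u\<^sup>2)"
          using s u(2) by (intro divide_right_mono mult_left_mono) (auto intro!: mult_nonneg_nonneg add_nonneg_nonneg)
        moreover have "s * (1 + u\<^sup>2) / ((1 + u\<^sup>2) * u\<^sup>2) = s / u\<^sup>2"
          using add_pos_nonneg[of 1 "u\<^sup>2"] by simp
        moreover have "s * ((1 + 1 / d\<^sup>2) * u\<^sup>2) / ((1 + u\<^sup>2) * u\<^sup>2) = s * (1 + 1 / d\<^sup>2) * cauchy_weight u"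
          using u(2) by (simp add: cauchy_weight_def)
        ultimately have "s / u\<^sup>2 \<le> s * (1 + 1 / d\<^sup>2) * cauchy_weight u" by linarith
        moreover have "poisson s u \<le> s / u\<^sup>2" using u by (intro poisson_le s) auto
        ultimately show ?thesis by linarith
      qed
      have "ennreal (LINT x|lborel. poisson s (x - t) * cmod (h x - h t))
        \<le> (\<integral>\<^sup>+x. ennreal (poisson s (x - t) * cmod (h x - h t)) \<partial>lborel)"
      proof (cases "integrable lborel (\<lambda>x. poisson s (x - t) * cmod (h x - h t))")
        case True
        then show ?thesis using s by (subst nn_integral_eq_integral) (auto simp: poisson_nonneg)
      qed (simp add: not_integrable_integral_eq)
      also have "\<dots> = (\<integral>\<^sup>+u. ennreal (poisson s u) * ennreal (\<omega> u) \<partial>lborel)"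
        using s by (subst shift[where f = "\<lambda>u x. ennreal (poisson s u * cmod (h x - h t))"])
          (auto simp: \<omega>_def ennreal_mult' poisson_nonneg)
      also have "\<dots> \<le> (\<integral>\<^sup>+u. ennreal (poisson s u) * ennreal (\<omega> u) * indicator {- d..d} u
            + ennreal (s * (1 + 1 / d\<^sup>2)) * ennreal (\<omega> u * cauchy_weight u) \<partial>lborel)"
      proof (rule nn_integral_mono)
        fix u
        show "ennreal (poisson s u) * ennreal (\<omega> u) \<le> ennreal (poisson s u) * ennreal (\<omega> u) * indicator {- d..d} u
            + ennreal (s * (1 + 1 / d\<^sup>2)) * ennreal (\<omega> u * cauchy_weight u)"
        proof (cases "u \<in> {-d..d}")
          case False
          then have "poisson s u * \<omega> u \<le> s * (1 + 1 / d\<^sup>2) * cauchy_weight u * \<omega> u"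
            by (intro mult_right_mono far) (auto simp: \<omega>_def)
          then show ?thesis using False s poisson_nonneg[OF s, of u]
            by (auto simp: \<omega>_def mult_ac ennreal_leI simp flip: ennreal_mult')
        qed auto
      qed
      also have "\<dots> = (\<integral>\<^sup>+u. ennreal (poisson s u) * ennreal (\<omega> u) * indicator {- d..d} u \<partial>lborel)
            + ennreal (s * (1 + 1 / d\<^sup>2)) * (\<integral>\<^sup>+u. ennreal (\<omega> u * cauchy_weight u) \<partial>lborel)"
        by (simp add: nn_integral_add nn_integral_cmult)
      also have "(\<integral>\<^sup>+u. ennreal (\<omega> u * cauchy_weight u) \<partial>lborel) = ennreal W"
        unfolding W_def using W by (intro nn_integral_eq_integral) (auto simp: \<omega>_def)
      also have "(\<integral>\<^sup>+u. ennreal (poisson s u) * ennreal (\<omega> u) * indicator {- d..d} u \<partial>lborel)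
            + ennreal (s * (1 + 1 / d\<^sup>2)) * ennreal W \<le> ennreal (8 * e) + ennreal (s * (1 + 1 / d\<^sup>2)) * ennreal W"
        by (intro add_right_mono nn_integral_poisson_near s e d mean) auto
      also have "\<dots> = ennreal (8 * e + s * ((1 + 1 / d\<^sup>2) * W))"
        using s e \<open>W \<ge> 0\<close> by (simp add: mult.assoc flip: ennreal_mult' ennreal_plus)
      finally show ?thesis
        using s e \<open>W \<ge> 0\<close> by (subst (asm) ennreal_le_iff) auto
    qed
    then show ?thesis using \<open>W \<ge> 0\<close> by (intro exI[of _ "(1 + 1 / d\<^sup>2) * W"]) auto
  qed
  show ?thesis
  proof (rule tendstoI)
    fix e :: real assume e: "e > 0"
    then obtain C where C: "C \<ge> 0" "\<And>s. s > 0 \<Longrightarrow> (LINT x|lborel. poisson s (x - t) * cmod (h x - h t)) \<le> 8 * (e / 16) + s * C"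
      using bound[of "e / 16"] by auto
    have "((\<lambda>s. 8 * (e / 16) + s * C) \<longlongrightarrow> 8 * (e / 16) + 0 * C) (at_right 0)"
      by (intro tendsto_intros)
    then have "\<forall>\<^sub>F s in at_right 0. 8 * (e / 16) + s * C < e"
      by (rule order_tendstoD) (use e in auto)
    moreover have "\<forall>\<^sub>F s in at_right (0::real). s > 0" by (simp add: eventually_at_right_less)
    ultimately show "\<forall>\<^sub>F s in at_right 0. dist (LINT x|lborel. poisson s (x - t) * cmod (h x - h t)) 0 < e"
    proof eventually_elim
      case (elim s)
      have "0 \<le> (LINT x|lborel. poisson s (x - t) * cmod (h x - h t))"
        using elim by (intro Bochner_Integration.integral_nonneg) (auto simp: poisson_nonneg)
      then show ?case using C(2)[of s] elim by simp
    qed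
  qed
qed

section \<open>The regularized Hilbert transform of bounded functions\<close>

text \<open>Bounded Borel functions on \<open>(-1, 1)\<close>, extended by zero to the real line.\<close>

definition bounded_supported :: "(real \<Rightarrow> complex) \<Rightarrow> bool"
  where "bounded_supported f \<longleftrightarrow> f \<in> borel_measurable borel \<and> (\<exists>M. \<forall>x. cmod (f x) \<le> M)
    \<and> (\<forall>x. x \<notin> {-1<..<1} \<longrightarrow> f x = 0)"

lemma bounded_supported_measurable:
  "bounded_supported f \<Longrightarrow> f \<in> borel_measurable borel"
  by (simp add: bounded_supported_def)

lemma bounded_supported_eq_0: "bounded_supported f \<Longrightarrow> \<not> \<bar>x\<bar> < 1 \<Longrightarrow> f x = 0"
  unfolding bounded_supported_def by (metis abs_less_iff greaterThanLessThan_iff minus_less_iff)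

lemma bounded_supportedE:
  assumes "bounded_supported f"
  obtains M where "M > 0" "\<And>x. cmod (f x) \<le> M * indicator {-1<..<1} x"
proof -
  obtain M where M: "\<And>x. cmod (f x) \<le> M" "\<And>x. x \<notin> {-1<..<1} \<Longrightarrow> f x = 0"
    using assms by (auto simp: bounded_supported_def)
  have "cmod (f x) \<le> (\<bar>M\<bar> + 1) * indicator {-1<..<1} x" for x
    using M(1)[of x] M(2)[of x] by (auto split: split_indicator)
  then show ?thesis by (intro that[of "\<bar>M\<bar> + 1"]) auto
qed

lemma borel_measurable_cnj [measurable (raw)]:
  "f \<in> borel_measurable M \<Longrightarrow> (\<lambda>x. cnj (f x)) \<in> borel_measurable M"
  by (rule borel_measurable_continuous_on[OF continuous_on_cnj[OF continuous_on_id]])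

lemma bounded_supported_cnj: "bounded_supported f \<Longrightarrow> bounded_supported (\<lambda>x. cnj (f x))"
  unfolding bounded_supported_def complex_cnj_zero_iff complex_mod_cnj by auto

lemma integrable_bounded_supported_mult:
  assumes f: "bounded_supported f" and [measurable]: "k \<in> borel_measurable borel"
    and k: "\<And>x. \<bar>x\<bar> < 1 \<Longrightarrow> cmod (k x) \<le> B"
  shows "integrable lborel (\<lambda>x. k x * f x)"
proof -
  have [measurable]: "f \<in> borel_measurable borel"
    using f by (rule bounded_supported_measurable)
  obtain M where M: "M > 0" "\<And>x. cmod (f x) \<le> M * indicator {-1<..<1} x"
    using bounded_supportedE[OF f] by blast
  show ?thesis
  proof (rule Bochner_Integration.integrable_bound)
    show "integrable lborel (\<lambda>x. B * (M * indicator {-1<..<1::real} x))"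
      by (intro integrable_mult_right integrable_real_indicator) auto
    show "AE x in lborel. norm (k x * f x) \<le> norm (B * (M * indicator {-1<..<1} x))"
    proof (rule AE_I2)
      fix x :: real
      have "cmod (k x) * cmod (f x) \<le> B * (M * indicator {-1<..<1} x)"
      proof (cases "\<bar>x\<bar> < 1")
        case True then show ?thesis using k M by (intro mult_mono) (auto intro: order_trans[OF norm_ge_zero k])
      next
        case False then show ?thesis using M(2)[of x] by (auto simp: indicator_def split: if_splits)
      qed
      then show "norm (k x * f x) \<le> norm (B * (M * indicator {-1<..<1} x))"
        by (simp add: norm_mult del: norm_scaleR) 
    qed
  qed measurable
qed

lemma integrable_bounded_supported: "bounded_supported f \<Longrightarrow> integrable lborel f"
  using integrable_bounded_supported_mult[of f "\<lambda>_. 1" 1] by simp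

lemma bounded_supported_Fubini:
  assumes f: "bounded_supported f" and k[measurable]: "case_prod k \<in> borel_measurable (borel \<Otimes>\<^sub>M borel)"
    and bound: "\<And>x t. \<bar>x\<bar> < 1 \<Longrightarrow> cmod (k x t) \<le> C * cauchy_weight t"
  shows "integrable lborel (\<lambda>t. LINT x|lborel. k x t * f x)"
    and "(LINT t|lborel. LINT x|lborel. k x t * f x) = (LINT x|lborel. (LINT t|lborel. k x t) * f x)"
proof -
  have [measurable]: "f \<in> borel_measurable borel"
    using f by (rule bounded_supported_measurable)
  obtain M where M: "M > 0" "\<And>x. cmod (f x) \<le> M * indicator {-1<..<1} x"
    using bounded_supportedE[OF f] by blast
  have "integrable (lborel \<Otimes>\<^sub>M lborel) (\<lambda>(x, t). M * indicator {-1<..<1::real} x * (C * cauchy_weight t))"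
  proof (rule lborel_pair.Fubini_integrable)
    show "integrable lborel (\<lambda>x. LINT y|lborel. norm (case (x, y) of (x, t) \<Rightarrow> M * indicator {-1<..<1::real} x * (C * cauchy_weight t)))"
      by (simp add: abs_mult)
    show "AE x in lborel. integrable lborel (\<lambda>y. case (x, y) of (x, t) \<Rightarrow> M * indicator {-1<..<1::real} x * (C * cauchy_weight t))"
      using integrable_cauchy_weight by simp
  qed measurable
  then have int: "integrable (lborel \<Otimes>\<^sub>M lborel) (\<lambda>(x, t). k x t * f x)"
  proof (rule Bochner_Integration.integrable_bound)
    show "AE p in lborel \<Otimes>\<^sub>M lborel. norm (case p of (x, t) \<Rightarrow> k x t * f x)
      \<le> norm (case p of (x, t) \<Rightarrow> M * indicator {-1<..<1} x * (C * cauchy_weight t))"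
    proof (rule AE_I2, clarify)
      fix x t :: real
      have "cmod (f x) * cmod (k x t) \<le> M * indicator {-1<..<1} x * (C * cauchy_weight t)"
      proof (cases "\<bar>x\<bar> < 1")
        case True then show ?thesis using bound M by (intro mult_mono) auto
      next
        case False then show ?thesis using M(2)[of x] by (auto simp: indicator_def split: if_splits)
      qed
      then show "norm (k x t * f x) \<le> norm (M * indicator {-1<..<1} x * (C * cauchy_weight t))"
        by (simp add: norm_mult mult.commute[of "cmod (f x)"] del: norm_scaleR) 
    qed
  qed measurable
  show "integrable lborel (\<lambda>t. LINT x|lborel. k x t * f x)"
    using lborel_pair.integrable_snd[OF int] by simp
  show "(LINT t|lborel. LINT x|lborel. k x t * f x) = (LINT x|lborel. (LINT t|lborel. k x t) * f x)"
    using lborel_pair.Fubini_integral[OF int] by simp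
qed

text \<open>The regularized Hilbert transform, without the factor \<open>1 / \<pi>\<close>.\<close>

definition reg_hilbert :: "real \<Rightarrow> (real \<Rightarrow> complex) \<Rightarrow> real \<Rightarrow> complex"
  where "reg_hilbert s f t = (LINT x|lborel. of_real (conj_poisson s (x - t)) * f x)"

text \<open>The Poisson integral, without the factor \<open>1 / \<pi>\<close>.\<close>

definition poisson_integral :: "real \<Rightarrow> (real \<Rightarrow> complex) \<Rightarrow> real \<Rightarrow> complex"
  where "poisson_integral s f t = (LINT x|lborel. of_real (poisson s (x - t)) * f x)"

lemma reg_hilbert_measurable:
  assumes "bounded_supported f"
  shows "reg_hilbert s f \<in> borel_measurable borel"
proof -
  have [measurable]: "f \<in> borel_measurable borel"
    using assms by (rule bounded_supported_measurable)
  show ?thesis unfolding reg_hilbert_def[abs_def] conj_poisson_def by measurable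
qed

lemma poisson_integral_measurable [measurable]:
  assumes [measurable]: "f \<in> borel_measurable borel"
  shows "poisson_integral s f \<in> borel_measurable borel"
  unfolding poisson_integral_def[abs_def] poisson_def by measurable

lemma abs_conj_poisson_le:
  assumes "s > 0"
  shows "\<bar>conj_poisson s u\<bar> \<le> 1 / s"
proof -
  have pos: "u\<^sup>2 + s\<^sup>2 > 0" using assms by (simp add: add_nonneg_pos)
  have "2 * \<bar>u\<bar> * s \<le> \<bar>u\<bar>\<^sup>2 + s\<^sup>2" by (rule sum_squares_bound)
  then have "\<bar>u\<bar> * s \<le> u\<^sup>2 + s\<^sup>2" using mult_nonneg_nonneg[of "\<bar>u\<bar>" s] assms unfolding power2_abs by linarith
  then show ?thesis using pos assms by (simp add: conj_poisson_def abs_divide divide_simps)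
qed

lemma conj_poisson_decay:
  assumes "s > 0" "\<bar>x\<bar> < 1"
  shows "\<bar>conj_poisson s (x - t)\<bar> \<le> (1 + 2 / s) / (1 + \<bar>t\<bar>)"
proof -
  let ?u = "x - t"
  have "\<bar>?u\<bar> * \<bar>?u\<bar> \<le> 1 * (?u\<^sup>2 + s\<^sup>2)" by (simp add: power2_eq_square)
  then have 1: "\<bar>?u\<bar> * \<bar>conj_poisson s ?u\<bar> \<le> 1"
    using assms by (simp add: conj_poisson_def abs_mult[symmetric] abs_divide divide_simps add_nonneg_pos add_nonneg_eq_0_iff)
  have "1 + \<bar>t\<bar> \<le> \<bar>?u\<bar> + 2" using assms by linarith
  then have "(1 + \<bar>t\<bar>) * \<bar>conj_poisson s ?u\<bar> \<le> (\<bar>?u\<bar> + 2) * \<bar>conj_poisson s ?u\<bar>"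
    by (intro mult_right_mono) auto
  also have "\<dots> \<le> 1 + 2 * (1 / s)"
    unfolding distrib_right using 1 abs_conj_poisson_le[OF assms(1), of ?u] by (intro add_mono mult_left_mono) auto
  finally show ?thesis by (simp add: pos_le_divide_eq mult.commute)
qed

lemma inverse_square_le_cauchy_weight: "1 / (1 + \<bar>t\<bar>) * (1 / (1 + \<bar>t\<bar>)) \<le> cauchy_weight t"
proof -
  have "1 + t\<^sup>2 \<le> (1 + \<bar>t\<bar>) * (1 + \<bar>t\<bar>)" by (simp add: algebra_simps power2_eq_square)
  then show ?thesis by (simp add: cauchy_weight_def frac_le add_pos_nonneg)
qed

lemma norm_integral_le:
  fixes f :: "'a \<Rightarrow> complex"
  assumes g: "integrable M g" and "f \<in> borel_measurable M" and le: "\<And>x. cmod (f x) \<le> g x"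
  shows "cmod (integral\<^sup>L M f) \<le> integral\<^sup>L M g"
proof -
  have "integrable M f"
    using assms by (intro Bochner_Integration.integrable_bound[OF g]) (auto intro!: AE_I2 order_trans[OF le])
  then show ?thesis
    using g le by (intro order_trans[OF integral_norm_bound] integral_mono) auto
qed

lemma norm_integral_bounded_supported_le:
  assumes f: "bounded_supported f" and [measurable]: "k \<in> borel_measurable borel"
    and k: "\<And>x. \<bar>x\<bar> < 1 \<Longrightarrow> cmod (k x) \<le> B"
  shows "cmod (LINT x|lborel. k x * f x) \<le> B * (LINT x|lborel. cmod (f x))"
proof -
  have "cmod (LINT x|lborel. k x * f x) \<le> (LINT x|lborel. B * cmod (f x))"
  proof (rule norm_integral_le)
    show "(\<lambda>x. k x * f x) \<in> borel_measurable lborel"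
      using f[THEN bounded_supported_measurable] by simp
    show "integrable lborel (\<lambda>x. B * cmod (f x))"
      using integrable_bounded_supported[OF f] by (intro integrable_mult_right integrable_norm)
    show "norm (k x * f x) \<le> B * cmod (f x)" for x
    proof (cases "\<bar>x\<bar> < 1")
      case True then show ?thesis using k[of x] by (auto simp: norm_mult intro!: mult_right_mono)
    next
      case False then have "f x = 0" using f by (intro bounded_supported_eq_0)
      then show ?thesis by simp
    qed
  qed
  then show ?thesis by simp
qed

lemma reg_hilbert_decay:
  assumes "bounded_supported f" "s > 0"
  shows "\<exists>C\<ge>0. \<forall>t. cmod (reg_hilbert s f t) \<le> C * (1 / (1 + \<bar>t\<bar>))"
proof (intro exI conjI allI)
  show "0 \<le> (1 + 2 / s) * (LINT x|lborel. cmod (f x))"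
    using assms by simp
  fix t
  have "cmod (reg_hilbert s f t) \<le> (1 + 2 / s) / (1 + \<bar>t\<bar>) * (LINT x|lborel. cmod (f x))"
    unfolding reg_hilbert_def using assms conj_poisson_decay[OF assms(2)]
    by (intro norm_integral_bounded_supported_le) auto
  then show "cmod (reg_hilbert s f t) \<le> (1 + 2 / s) * (LINT x|lborel. cmod (f x)) * (1 / (1 + \<bar>t\<bar>))"
    by simp
qed

lemma integrable_reg_hilbert_mult:
  assumes f: "bounded_supported f" and g: "bounded_supported g" and "s > 0" "r > 0"
  shows "integrable lborel (\<lambda>t. reg_hilbert s f t * reg_hilbert r g t)"
proof -
  have [measurable]: "f \<in> borel_measurable borel" "g \<in> borel_measurable borel"
      "reg_hilbert s f \<in> borel_measurable borel" "reg_hilbert r g \<in> borel_measurable borel"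
    using f g by (auto intro: bounded_supported_measurable reg_hilbert_measurable)
  obtain C D where C: "C \<ge> 0" "\<And>t. cmod (reg_hilbert s f t) \<le> C * (1 / (1 + \<bar>t\<bar>))"
    and D: "D \<ge> 0" "\<And>t. cmod (reg_hilbert r g t) \<le> D * (1 / (1 + \<bar>t\<bar>))"
    using reg_hilbert_decay assms by meson
  show ?thesis
  proof (rule Bochner_Integration.integrable_bound)
    show "integrable lborel (\<lambda>t. C * D * cauchy_weight t)"
      using integrable_cauchy_weight by simp
    show "AE t in lborel. norm (reg_hilbert s f t * reg_hilbert r g t) \<le> norm (C * D * cauchy_weight t)"
    proof (rule AE_I2)
      fix t
      have "norm (reg_hilbert s f t * reg_hilbert r g t) \<le> (C * (1 / (1 + \<bar>t\<bar>))) * (D * (1 / (1 + \<bar>t\<bar>)))"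
        unfolding norm_mult using C D by (intro mult_mono) auto
      also have "\<dots> = (C * D) * (1 / (1 + \<bar>t\<bar>) * (1 / (1 + \<bar>t\<bar>)))" by simp
      also have "\<dots> \<le> (C * D) * cauchy_weight t"
        using C D by (intro mult_left_mono inverse_square_le_cauchy_weight) auto
      finally show "norm (reg_hilbert s f t * reg_hilbert r g t) \<le> norm (C * D * cauchy_weight t)"
        using C D by (simp add: abs_mult)
    qed
  qed measurable
qed

text \<open>The bilinear identity that replaces Plancherel's theorem.\<close>

lemma integral_reg_hilbert_mult:
  assumes f: "bounded_supported f" and g: "bounded_supported g" and s: "s > 0" and r: "r > 0"
  shows "(LINT t|lborel. reg_hilbert s f t * reg_hilbert r g t)
    = pi * (LINT x|lborel. poisson_integral (s + r) g x * f x)"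
proof -
  have [measurable]: "f \<in> borel_measurable borel" "g \<in> borel_measurable borel"
      "reg_hilbert s f \<in> borel_measurable borel" "reg_hilbert r g \<in> borel_measurable borel"
    using f g by (auto intro: bounded_supported_measurable reg_hilbert_measurable)
  obtain D where D: "D \<ge> 0" "\<And>t. cmod (reg_hilbert r g t) \<le> D * (1 / (1 + \<bar>t\<bar>))"
    using reg_hilbert_decay g r by meson
  have cc: "\<bar>conj_poisson s (x - t)\<bar> * (1 / (1 + \<bar>t\<bar>)) \<le> (1 + 2 / s) * cauchy_weight t" if "\<bar>x\<bar> < 1" "s > 0" for x t s :: real
  proof -
    have "\<bar>conj_poisson s (x - t)\<bar> * (1 / (1 + \<bar>t\<bar>)) \<le> (1 + 2 / s) / (1 + \<bar>t\<bar>) * (1 / (1 + \<bar>t\<bar>))"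
      using that by (intro mult_right_mono conj_poisson_decay) auto
    also have "\<dots> = (1 + 2 / s) * (1 / (1 + \<bar>t\<bar>) * (1 / (1 + \<bar>t\<bar>)))" by simp
    also have "\<dots> \<le> (1 + 2 / s) * cauchy_weight t"
      using that by (intro mult_left_mono inverse_square_le_cauchy_weight) auto
    finally show ?thesis .
  qed
  have inner: "(LINT t|lborel. of_real (conj_poisson s (x - t)) * reg_hilbert r g t) = pi * poisson_integral (s + r) g x"
    if x: "\<bar>x\<bar> < 1" for x
  proof -
    have "(LINT t|lborel. of_real (conj_poisson s (x - t)) * reg_hilbert r g t)
      = (LINT t|lborel. LINT y|lborel. of_real (conj_poisson s (x - t) * conj_poisson r (y - t)) * g y)"
      by (simp add: reg_hilbert_def mult.assoc flip: integral_mult_right_zero)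
    also have "\<dots> = (LINT y|lborel. (LINT t|lborel. of_real (conj_poisson s (x - t) * conj_poisson r (y - t))) * g y)"
    proof (rule bounded_supported_Fubini[OF g])
      show "(\<lambda>(y, t). complex_of_real (conj_poisson s (x - t) * conj_poisson r (y - t))) \<in> borel_measurable (borel \<Otimes>\<^sub>M borel)"
        unfolding conj_poisson_def by measurable
      fix y t :: real assume y: "\<bar>y\<bar> < 1"
      have "\<bar>conj_poisson s (x - t)\<bar> * \<bar>conj_poisson r (y - t)\<bar>
          \<le> \<bar>conj_poisson s (x - t)\<bar> * ((1 + 2 / r) / (1 + \<bar>t\<bar>))"
        using r y by (intro mult_left_mono conj_poisson_decay) auto
      also have "\<dots> = (1 + 2 / r) * (\<bar>conj_poisson s (x - t)\<bar> * (1 / (1 + \<bar>t\<bar>)))" by simp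
      also have "\<dots> \<le> (1 + 2 / r) * ((1 + 2 / s) * cauchy_weight t)"
        using r s x by (intro mult_left_mono cc) auto
      finally show "cmod (complex_of_real (conj_poisson s (x - t) * conj_poisson r (y - t)))
         \<le> (1 + 2 / r) * (1 + 2 / s) * cauchy_weight t"
        by (simp add: norm_mult mult.assoc)
    qed
    also have "\<dots> = (LINT y|lborel. pi * (of_real (poisson (s + r) (y - x)) * g y))"
      using conj_poisson_convolution(2)[OF s r, of x]
      by (intro Bochner_Integration.integral_cong)
         (simp_all add: integral_complex_of_real poisson_def power2_commute[of x] del: of_real_mult, simp)
    finally show ?thesis by (simp add: poisson_integral_def)
  qed
  have "(LINT t|lborel. reg_hilbert s f t * reg_hilbert r g t)
    = (LINT t|lborel. LINT x|lborel. of_real (conj_poisson s (x - t)) * reg_hilbert r g t * f x)"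
    unfolding reg_hilbert_def[of s] by (simp add: mult_ac flip: integral_mult_right_zero)
  also have "\<dots> = (LINT x|lborel. (LINT t|lborel. of_real (conj_poisson s (x - t)) * reg_hilbert r g t) * f x)"
  proof (rule bounded_supported_Fubini[OF f])
    show "(\<lambda>(x, t). complex_of_real (conj_poisson s (x - t)) * reg_hilbert r g t) \<in> borel_measurable (borel \<Otimes>\<^sub>M borel)"
      unfolding conj_poisson_def by measurable
    fix x t :: real assume x: "\<bar>x\<bar> < 1"
    have "cmod (complex_of_real (conj_poisson s (x - t)) * reg_hilbert r g t) \<le> \<bar>conj_poisson s (x - t)\<bar> * (D * (1 / (1 + \<bar>t\<bar>)))"
      unfolding norm_mult norm_of_real by (intro mult_left_mono D) auto
    also have "\<dots> = D * (\<bar>conj_poisson s (x - t)\<bar> * (1 / (1 + \<bar>t\<bar>)))" by simp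
    also have "\<dots> \<le> D * ((1 + 2 / s) * cauchy_weight t)"
      using x s D by (intro mult_left_mono cc) auto
    finally show "cmod (complex_of_real (conj_poisson s (x - t)) * reg_hilbert r g t) \<le> D * (1 + 2 / s) * cauchy_weight t"
      by (simp add: mult.assoc)
  qed
  also have "\<dots> = (LINT x|lborel. pi * (poisson_integral (s + r) g x * f x))"
  proof (rule Bochner_Integration.integral_cong[OF refl])
    fix x
    show "(LINT t|lborel. of_real (conj_poisson s (x - t)) * reg_hilbert r g t) * f x = pi * (poisson_integral (s + r) g x * f x)"
      using inner[of x] bounded_supported_eq_0[OF f, of x] by (cases "\<bar>x\<bar> < 1") auto
  qed
  finally show ?thesis by simp
qed

lemma norm_poisson_integral_le:
  assumes [measurable]: "f \<in> borel_measurable borel" and M: "\<And>x. cmod (f x) \<le> M" and s: "s > 0"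
  shows "cmod (poisson_integral s f t) \<le> pi * M"
proof -
  have p: "integrable lborel (\<lambda>x. poisson s (x - t))" "(LINT x|lborel. poisson s (x - t)) = pi"
    using has_bochner_integral_poisson[OF s, of t] by (auto simp: has_bochner_integral_iff)
  have "cmod (poisson_integral s f t) \<le> (LINT x|lborel. poisson s (x - t) * M)"
    unfolding poisson_integral_def
  proof (rule norm_integral_le)
    show "integrable lborel (\<lambda>x. poisson s (x - t) * M)" using p by simp
    show "cmod (of_real (poisson s (x - t)) * f x) \<le> poisson s (x - t) * M" for x
      using M[of x] poisson_nonneg[OF s] by (auto simp: norm_mult intro!: mult_left_mono)
  qed measurable
  then show ?thesis using p by (simp add: mult.commute)
qed

lemma reg_hilbert_cnj: "reg_hilbert s (\<lambda>x. cnj (f x)) t = cnj (reg_hilbert s f t)"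
  unfolding reg_hilbert_def by (simp flip: Bochner_Integration.integral_cnj)

text \<open>The \<open>L\<^sup>2\<close> bound, uniform in \<open>s\<close>; the supremum norm of \<open>f\<close> enters only once.\<close>

lemma integral_reg_hilbert_square:
  assumes f: "bounded_supported f" and s: "s > 0" and M: "\<And>x. cmod (f x) \<le> M"
  shows "integrable lborel (\<lambda>t. (cmod (reg_hilbert s f t))\<^sup>2)"
    and "(LINT t|lborel. (cmod (reg_hilbert s f t))\<^sup>2) \<le> pi\<^sup>2 * M * (LINT x|lborel. cmod (f x))"
proof -
  have [measurable]: "f \<in> borel_measurable borel"
    using f by (rule bounded_supported_measurable)
  have sq: "of_real ((cmod (reg_hilbert s f t))\<^sup>2) = reg_hilbert s f t * reg_hilbert s (\<lambda>x. cnj (f x)) t" for t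
    unfolding reg_hilbert_cnj by (rule complex_norm_square)
  have i: "integrable lborel (\<lambda>t. complex_of_real ((cmod (reg_hilbert s f t))\<^sup>2))"
    unfolding sq using f s by (intro integrable_reg_hilbert_mult bounded_supported_cnj)
  from integrable_Re[OF i] show "integrable lborel (\<lambda>t. (cmod (reg_hilbert s f t))\<^sup>2)" by simp
  have "(LINT t|lborel. (cmod (reg_hilbert s f t))\<^sup>2) = cmod (of_real (LINT t|lborel. (cmod (reg_hilbert s f t))\<^sup>2))"
    by simp
  also have "complex_of_real (LINT t|lborel. (cmod (reg_hilbert s f t))\<^sup>2) = (LINT t|lborel. of_real ((cmod (reg_hilbert s f t))\<^sup>2))"
    by (rule integral_complex_of_real[symmetric])
  also have "\<dots> = pi * (LINT x|lborel. poisson_integral (s + s) (\<lambda>x. cnj (f x)) x * f x)"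
    unfolding sq using f s by (intro integral_reg_hilbert_mult bounded_supported_cnj)
  also have "cmod \<dots> \<le> pi * ((pi * M) * (LINT x|lborel. cmod (f x)))"
    unfolding norm_mult norm_of_real abs_of_nonneg[OF pi_ge_zero] using s M
    by (intro mult_left_mono norm_integral_bounded_supported_le f norm_poisson_integral_le) auto
  finally show "(LINT t|lborel. (cmod (reg_hilbert s f t))\<^sup>2) \<le> pi\<^sup>2 * M * (LINT x|lborel. cmod (f x))"
    by (simp add: power2_eq_square mult_ac)
qed

section \<open>Convergence of the regularized transforms\<close>

lemma integral_dominated_convergence_at_right_0:
  fixes f :: "'a \<Rightarrow> complex"
  assumes "f \<in> borel_measurable M" "\<And>s. F s \<in> borel_measurable M" "integrable M w"
    and "AE x in M. ((\<lambda>s. F s x) \<longlongrightarrow> f x) (at_right 0)"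
    and "\<And>s::real. s > 0 \<Longrightarrow> AE x in M. cmod (F s x) \<le> w x"
  shows "((\<lambda>s. LINT x|M. F s x) \<longlongrightarrow> (LINT x|M. f x)) (at_right 0)"
  unfolding filterlim_at_right_to_top
proof (rule integral_dominated_convergence_at_top)
  show "AE x in M. ((\<lambda>s. F (inverse s) x) \<longlongrightarrow> f x) at_top"
    using assms(4) by (simp add: filterlim_at_right_to_top)
  show "\<forall>\<^sub>F s in at_top. AE x in M. cmod (F (inverse s) x) \<le> w x"
    using eventually_gt_at_top[of 0] by eventually_elim (auto intro: assms(5))
qed (use assms in auto)

lemma poisson_integral_tendsto_lebesgue_point:
  fixes h :: "real \<Rightarrow> complex"
  assumes [measurable]: "h \<in> borel_measurable borel" and h: "integrable lborel (\<lambda>x. cmod (h x) * cauchy_weight x)"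
    and t: "lebesgue_point h t"
  shows "((\<lambda>s. poisson_integral s h t) \<longlongrightarrow> pi * h t) (at_right 0)"
proof -
  have "((\<lambda>s. poisson_integral s h t - pi * h t) \<longlongrightarrow> 0) (at_right 0)"
  proof (rule Lim_null_comparison[OF _ poisson_integral_tendsto[OF assms]])
    have "\<forall>\<^sub>F s in at_right (0::real). 0 < s" by (rule eventually_at_right_less)
    then show "\<forall>\<^sub>F s in at_right 0. norm (poisson_integral s h t - pi * h t) \<le> (LINT x|lborel. poisson s (x - t) * cmod (h x - h t))"
    proof eventually_elim
      case (elim s)
      have p: "integrable lborel (\<lambda>x. poisson s (x - t))" "(LINT x|lborel. poisson s (x - t)) = pi"
        using has_bochner_integral_poisson[OF elim, of t] by (auto simp: has_bochner_integral_iff)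
      have i1: "integrable lborel (\<lambda>x. of_real (poisson s (x - t)) * h x)"
        using integrable_poisson_mult[OF assms(1,2) elim, of t] by (simp add: scaleR_conv_of_real)
      have i2: "integrable lborel (\<lambda>x. of_real (poisson s (x - t)) * h t)"
        using p by (intro integrable_mult_left integrable_of_real)
      have "poisson_integral s h t - pi * h t
        = (LINT x|lborel. of_real (poisson s (x - t)) * h x) - (LINT x|lborel. of_real (poisson s (x - t)) * h t)"
        using p by (simp add: poisson_integral_def)
      also have "\<dots> = (LINT x|lborel. of_real (poisson s (x - t)) * (h x - h t))"
        using i1 i2 by (simp add: Bochner_Integration.integral_diff algebra_simps)
      also have "norm \<dots> \<le> (LINT x|lborel. norm (of_real (poisson s (x - t)) * (h x - h t)))"
        by (rule integral_norm_bound)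
      also have "\<dots> = (LINT x|lborel. poisson s (x - t) * cmod (h x - h t))"
        using elim by (simp add: norm_mult poisson_nonneg)
      finally show ?case .
    qed
  qed
  then show ?thesis by (rule Lim_null[THEN iffD2])
qed

lemma integrable_cauchy_weight_imp_set_integrable:
  fixes h :: "real \<Rightarrow> complex"
  assumes [measurable]: "h \<in> borel_measurable borel" and h: "integrable lborel (\<lambda>x. cmod (h x) * cauchy_weight x)"
  shows "set_integrable lborel {a..b} h"
proof -
  define B where "B = 1 + (\<bar>a\<bar> + \<bar>b\<bar>)\<^sup>2"
  have "integrable lborel (\<lambda>x. B * (cmod (h x) * cauchy_weight x))"
    using h by (rule integrable_mult_right)
  then show ?thesis unfolding set_integrable_def
  proof (rule Bochner_Integration.integrable_bound)
    show "AE x in lborel. norm (indicator {a..b} x *\<^sub>R h x) \<le> norm (B * (cmod (h x) * cauchy_weight x))"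
    proof (rule AE_I2)
      fix x
      show "norm (indicator {a..b} x *\<^sub>R h x) \<le> norm (B * (cmod (h x) * cauchy_weight x))"
      proof (cases "x \<in> {a..b}")
        case True
        then have "\<bar>x\<bar> \<le> \<bar>a\<bar> + \<bar>b\<bar>" by auto
        then have "1 + x\<^sup>2 \<le> B" unfolding B_def by (intro add_left_mono) (simp add: abs_le_square_iff[symmetric])
        then have "1 \<le> B * cauchy_weight x" by (simp add: cauchy_weight_def add_pos_nonneg)
        then have "1 * cmod (h x) \<le> B * cauchy_weight x * cmod (h x)" by (rule mult_right_mono) simp
        also have "\<dots> \<le> norm (B * (cmod (h x) * cauchy_weight x))" by (simp add: mult_ac)
        finally show ?thesis using True by simp
      qed simp
    qed
  qed measurable
qed

lemma AE_lebesgue_point_weighted: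
  fixes h :: "real \<Rightarrow> complex"
  assumes [measurable]: "h \<in> borel_measurable borel" and h: "integrable lborel (\<lambda>x. cmod (h x) * cauchy_weight x)"
  shows "AE t in lborel. lebesgue_point h t"
  using assms by (intro AE_lebesgue_point integrable_cauchy_weight_imp_set_integrable)

lemma bounded_supported_weighted:
  assumes f: "bounded_supported f"
  shows "integrable lborel (\<lambda>x. cmod (f x) * cauchy_weight x)"
proof -
  have [measurable]: "f \<in> borel_measurable borel" using f by (rule bounded_supported_measurable)
  have "cauchy_weight x \<le> 1" for x by (simp add: cauchy_weight_def add_pos_nonneg)
  then have "cmod (f x) * cauchy_weight x \<le> cmod (f x) * 1" for x by (intro mult_left_mono) auto
  then show ?thesis
    by (intro Bochner_Integration.integrable_bound[OF integrable_norm[OF integrable_bounded_supported[OF f]]])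
       (auto simp: abs_mult)
qed

text \<open>With \<open>A s\<close> the pairing of \<open>f\<close> with the Poisson integral of its conjugate, the squared distance is
  \<open>pi * (A (2 * s) - 2 * A (s + r) + A (2 * r))\<close>, and \<open>A\<close> has a limit at \<open>0\<close>.\<close>

lemma reg_hilbert_Cauchy_L2:
  assumes f: "bounded_supported f" and e: "e > 0"
  shows "\<exists>d>0. \<forall>s r. 0 < s \<and> s < d \<and> 0 < r \<and> r < d \<longrightarrow>
    integrable lborel (\<lambda>t. (cmod (reg_hilbert s f t - reg_hilbert r f t))\<^sup>2) \<and>
    (LINT t|lborel. (cmod (reg_hilbert s f t - reg_hilbert r f t))\<^sup>2) \<le> e"
proof -
  have [measurable]: "f \<in> borel_measurable borel" using f by (rule bounded_supported_measurable)
  define g where "g x = cnj (f x)" for x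
  have g: "bounded_supported g" unfolding g_def[abs_def] by (rule bounded_supported_cnj[OF f])
  have [measurable]: "g \<in> borel_measurable borel" using g by (rule bounded_supported_measurable)
  obtain M where M: "M > 0" "\<And>x. cmod (f x) \<le> M * indicator {-1<..<1} x"
    using bounded_supportedE[OF f] by blast
  have M': "cmod (g x) \<le> M" for x
    unfolding g_def complex_mod_cnj by (rule order_trans[OF M(2)]) (use M(1) in \<open>simp add: indicator_def\<close>)
  define A where "A s = (LINT x|lborel. poisson_integral s g x * f x)" for s
  have "(A \<longlongrightarrow> (LINT x|lborel. (pi * g x) * f x)) (at_right 0)"
    unfolding A_def
  proof (rule integral_dominated_convergence_at_right_0)
    show "integrable lborel (\<lambda>x. pi * M * cmod (f x))"
      using integrable_bounded_supported[OF f] by auto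
    show "AE x in lborel. ((\<lambda>s. poisson_integral s g x * f x) \<longlongrightarrow> (pi * g x) * f x) (at_right 0)"
      using AE_lebesgue_point_weighted[OF _ bounded_supported_weighted[OF g]]
      by (auto elim!: eventually_mono intro!: tendsto_mult_right poisson_integral_tendsto_lebesgue_point bounded_supported_weighted g)
    show "AE x in lborel. cmod (poisson_integral s g x * f x) \<le> pi * M * cmod (f x)" if "s > 0" for s
      unfolding norm_mult using that by (intro AE_I2 mult_right_mono norm_poisson_integral_le M') auto
  qed measurable
  then obtain L where "(A \<longlongrightarrow> L) (at_right 0)" by blast
  then have "\<forall>\<^sub>F s in at_right 0. dist (A s) L < e / (4 * pi)"
    using e by (intro tendstoD) auto
  then obtain d0 where d0: "d0 > 0" "\<And>s. 0 < s \<Longrightarrow> s < d0 \<Longrightarrow> dist (A s) L < e / (4 * pi)"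
    unfolding eventually_at_right_field by auto
  show ?thesis
  proof (intro exI[of _ "d0 / 2"] conjI allI impI)
    fix s r assume sr: "0 < s \<and> s < d0 / 2 \<and> 0 < r \<and> r < d0 / 2"
    let ?Q = "reg_hilbert"
    have sq: "complex_of_real ((cmod (?Q s f t - ?Q r f t))\<^sup>2)
      = ?Q s f t * ?Q s g t - ?Q s f t * ?Q r g t - ?Q r f t * ?Q s g t + ?Q r f t * ?Q r g t" for t
      unfolding complex_norm_square g_def reg_hilbert_cnj by (simp add: algebra_simps)
    have i: "integrable lborel (\<lambda>t. ?Q a f t * ?Q b g t)" if "a > 0" "b > 0" for a b
      using that f g by (intro integrable_reg_hilbert_mult)
    have I: "integrable lborel (\<lambda>t. complex_of_real ((cmod (?Q s f t - ?Q r f t))\<^sup>2))"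
      unfolding sq using sr by (intro Bochner_Integration.integrable_add Bochner_Integration.integrable_diff i) auto
    from integrable_Re[OF I] show "integrable lborel (\<lambda>t. (cmod (?Q s f t - ?Q r f t))\<^sup>2)" by simp
    have "complex_of_real (LINT t|lborel. (cmod (?Q s f t - ?Q r f t))\<^sup>2) = (LINT t|lborel. complex_of_real ((cmod (?Q s f t - ?Q r f t))\<^sup>2))"
      by (rule integral_complex_of_real[symmetric])
    also have "\<dots> = (LINT t|lborel. ?Q s f t * ?Q s g t) - (LINT t|lborel. ?Q s f t * ?Q r g t)
        - (LINT t|lborel. ?Q r f t * ?Q s g t) + (LINT t|lborel. ?Q r f t * ?Q r g t)"
      unfolding sq using sr
      by (subst Bochner_Integration.integral_add Bochner_Integration.integral_diff,
          (intro Bochner_Integration.integrable_add Bochner_Integration.integrable_diff i; simp)+)+ simp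
    also have "\<dots> = pi * A (s + s) - pi * A (s + r) - pi * A (r + s) + pi * A (r + r)"
      unfolding A_def using sr f g by (simp only: integral_reg_hilbert_mult)
    also have "\<dots> = pi * ((A (s + s) - L) - (A (s + r) - L) - (A (r + s) - L) + (A (r + r) - L))"
      by (simp add: algebra_simps)
    finally have "(LINT t|lborel. (cmod (?Q s f t - ?Q r f t))\<^sup>2)
      \<le> cmod (pi * ((A (s + s) - L) - (A (s + r) - L) - (A (r + s) - L) + (A (r + r) - L)))"
      by (metis norm_of_real abs_ge_self)
    also have "\<dots> \<le> pi * (e / (4 * pi) + e / (4 * pi) + e / (4 * pi) + e / (4 * pi))"
      unfolding norm_mult norm_of_real abs_of_nonneg[OF pi_ge_zero]
    proof (rule mult_left_mono)
      have "cmod (A (a + b) - L) \<le> e / (4 * pi)" if "a > 0" "b > 0" "a < d0 / 2" "b < d0 / 2" for a b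
        using that d0(2)[of "a + b"] by (simp add: dist_norm)
      then show "cmod ((A (s + s) - L) - (A (s + r) - L) - (A (r + s) - L) + (A (r + r) - L))
        \<le> e / (4 * pi) + e / (4 * pi) + e / (4 * pi) + e / (4 * pi)"
        using sr norm_triangle_ineq[of "A (s + s) - L - (A (s + r) - L) - (A (r + s) - L)" "A (r + r) - L"]
          norm_triangle_ineq4[of "A (s + s) - L - (A (s + r) - L)" "A (r + s) - L"]
          norm_triangle_ineq4[of "A (s + s) - L" "A (s + r) - L"]
        by (smt (verit))
    qed simp
    also have "\<dots> = e" by simp
    finally show "(LINT t|lborel. (cmod (?Q s f t - ?Q r f t))\<^sup>2) \<le> e" .
  qed (use d0 in auto)
qed

lemma integrable_reg_hilbert_weighted:
  assumes f: "bounded_supported f" and s: "s > 0"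
  shows "integrable lborel (\<lambda>t. cauchy_weight t *\<^sub>R reg_hilbert s f t)"
proof -
  have [measurable]: "reg_hilbert s f \<in> borel_measurable borel" using f by (rule reg_hilbert_measurable)
  obtain C where C: "C \<ge> 0" "\<And>t. cmod (reg_hilbert s f t) \<le> C * (1 / (1 + \<bar>t\<bar>))"
    using reg_hilbert_decay[OF f s] by blast
  show ?thesis
  proof (rule Bochner_Integration.integrable_bound)
    show "integrable lborel (\<lambda>t. C * cauchy_weight t)"
      using integrable_cauchy_weight by simp
    have "cmod (reg_hilbert s f t) \<le> C" for t
    proof -
      have "C * (1 / (1 + \<bar>t\<bar>)) \<le> C * 1" using C(1) by (intro mult_left_mono) auto
      then show ?thesis using C(2)[of t] by simp
    qed
    then show "AE t in lborel. norm (cauchy_weight t *\<^sub>R reg_hilbert s f t) \<le> norm (C * cauchy_weight t)"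
      using C(1) by (auto simp: abs_mult mult.commute intro!: AE_I2 mult_right_mono)
  qed measurable
qed

lemma reg_hilbert_Cauchy_L1:
  assumes f: "bounded_supported f" and e: "e > 0"
  shows "\<exists>d>0. \<forall>s r. 0 < s \<and> s < d \<and> 0 < r \<and> r < d \<longrightarrow>
    (LINT t|lborel. cmod (cauchy_weight t *\<^sub>R reg_hilbert s f t - cauchy_weight t *\<^sub>R reg_hilbert r f t)) < e"
proof -
  \<comment> \<open>The Cauchy-Schwarz inequality in the form \<open>2 * u * w \<le> u\<^sup>2 / l + l * w\<^sup>2\<close>.\<close>
  define l where "l = e / (2 * pi)"
  have l: "l > 0" using e by (simp add: l_def)
  define W where "W = (LINT t|lborel. cauchy_weight t)"
  have W: "W = pi"
    using has_bochner_integral_poisson[of 1 0]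
    by (simp add: W_def has_bochner_integral_iff poisson_def cauchy_weight_def add.commute)
  obtain d where d: "d > 0" "\<And>s r. 0 < s \<and> s < d \<and> 0 < r \<and> r < d \<Longrightarrow>
    integrable lborel (\<lambda>t. (cmod (reg_hilbert s f t - reg_hilbert r f t))\<^sup>2) \<and>
    (LINT t|lborel. (cmod (reg_hilbert s f t - reg_hilbert r f t))\<^sup>2) \<le> e * l"
    using reg_hilbert_Cauchy_L2[OF f, of "e * l"] e l by auto
  show ?thesis
  proof (intro exI[of _ d] conjI allI impI d(1))
    fix s r assume sr: "0 < s \<and> s < d \<and> 0 < r \<and> r < d"
    let ?u = "\<lambda>t. cmod (reg_hilbert s f t - reg_hilbert r f t)"
    have i: "integrable lborel (\<lambda>t. (?u t)\<^sup>2)" "(LINT t|lborel. (?u t)\<^sup>2) \<le> e * l" using d(2)[OF sr] by auto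
    have "(LINT t|lborel. cmod (cauchy_weight t *\<^sub>R reg_hilbert s f t - cauchy_weight t *\<^sub>R reg_hilbert r f t))
      \<le> (LINT t|lborel. (1 / (2 * l)) * (?u t)\<^sup>2 + (l / 2) * cauchy_weight t)"
    proof (rule integral_mono)
      show "integrable lborel (\<lambda>t. cmod (cauchy_weight t *\<^sub>R reg_hilbert s f t - cauchy_weight t *\<^sub>R reg_hilbert r f t))"
        using f sr by (intro integrable_norm Bochner_Integration.integrable_diff integrable_reg_hilbert_weighted) auto
      show "integrable lborel (\<lambda>t. (1 / (2 * l)) * (?u t)\<^sup>2 + (l / 2) * cauchy_weight t)"
        using i integrable_cauchy_weight by simp
      fix t
      have "cmod (cauchy_weight t *\<^sub>R reg_hilbert s f t - cauchy_weight t *\<^sub>R reg_hilbert r f t) = cauchy_weight t * ?u t"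
        by (simp flip: scaleR_diff_right)
      also have "\<dots> \<le> (1 / (2 * l)) * (?u t)\<^sup>2 + (l / 2) * (cauchy_weight t)\<^sup>2"
        using sum_squares_bound[of "?u t" "l * cauchy_weight t"] l
        by (simp add: field_simps power2_eq_square)
      also have "\<dots> \<le> (1 / (2 * l)) * (?u t)\<^sup>2 + (l / 2) * cauchy_weight t"
      proof -
        have "cauchy_weight t \<le> 1" by (simp add: cauchy_weight_def add_pos_nonneg)
        then have "(cauchy_weight t)\<^sup>2 \<le> cauchy_weight t"
          using mult_right_le_one_le[of "cauchy_weight t" "cauchy_weight t"] by (simp add: power2_eq_square)
        then show ?thesis using l by (intro add_left_mono mult_left_mono) auto
      qed
      finally show "cmod (cauchy_weight t *\<^sub>R reg_hilbert s f t - cauchy_weight t *\<^sub>R reg_hilbert r f t)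
        \<le> (1 / (2 * l)) * (?u t)\<^sup>2 + (l / 2) * cauchy_weight t" .
    qed
    also have "\<dots> = (1 / (2 * l)) * (LINT t|lborel. (?u t)\<^sup>2) + (l / 2) * W"
      using i integrable_cauchy_weight by (simp add: W_def)
    also have "\<dots> \<le> (1 / (2 * l)) * (e * l) + (l / 2) * W"
      using i l by (intro add_right_mono mult_left_mono) auto
    also have "\<dots> < e"
      using e l by (simp add: W l_def)
    finally show "(LINT t|lborel. cmod (cauchy_weight t *\<^sub>R reg_hilbert s f t - cauchy_weight t *\<^sub>R reg_hilbert r f t)) < e" .
  qed
qed

lemma poisson_integral_reg_hilbert:
  assumes f: "bounded_supported f" and e: "e > 0" and s: "s > 0"
  shows "poisson_integral e (reg_hilbert s f) t = pi * reg_hilbert (e + s) f t"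
proof -
  obtain C where C: "\<And>x. poisson e (x - t) \<le> C * cauchy_weight x"
    using poisson_le_cauchy_weight[OF e] by blast
  have "poisson_integral e (reg_hilbert s f) t
    = (LINT x|lborel. LINT y|lborel. of_real (poisson e (x - t) * conj_poisson s (y - x)) * f y)"
    by (simp add: poisson_integral_def reg_hilbert_def mult.assoc flip: integral_mult_right_zero)
  also have "\<dots> = (LINT y|lborel. (LINT x|lborel. of_real (poisson e (x - t) * conj_poisson s (y - x))) * f y)"
  proof (rule bounded_supported_Fubini[OF f])
    show "(\<lambda>(y, x). complex_of_real (poisson e (x - t) * conj_poisson s (y - x))) \<in> borel_measurable (borel \<Otimes>\<^sub>M borel)"
      unfolding conj_poisson_def poisson_def by measurable
    fix y x :: real
    have "poisson e (x - t) * \<bar>conj_poisson s (y - x)\<bar> \<le> (C * cauchy_weight x) * (1 / s)"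
      using C[of x] poisson_nonneg[OF e] by (intro mult_mono abs_conj_poisson_le s order_trans[OF poisson_nonneg[OF e] C]) auto
    then show "cmod (complex_of_real (poisson e (x - t) * conj_poisson s (y - x))) \<le> C * (1 / s) * cauchy_weight x"
      using poisson_nonneg[OF e, of "x - t"] by (simp add: norm_mult mult_ac)
  qed
  also have "\<dots> = (LINT y|lborel. pi * (of_real (conj_poisson (e + s) (y - t)) * f y))"
  proof (rule Bochner_Integration.integral_cong[OF refl])
    fix y
    have "poisson e (x - t) = poisson e (t - x)" for x
      by (simp add: poisson_def power2_commute)
    then have "(LINT x|lborel. of_real (poisson e (x - t) * conj_poisson s (y - x)))
      = complex_of_real (pi * conj_poisson (e + s) (y - t))"
      using conj_poisson_convolution(4)[OF e s, of t y] by (simp add: integral_complex_of_real del: of_real_mult)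
    then show "(LINT x|lborel. of_real (poisson e (x - t) * conj_poisson s (y - x))) * f y
      = pi * (of_real (conj_poisson (e + s) (y - t)) * f y)"
      by simp
  qed
  finally show ?thesis by (simp add: reg_hilbert_def)
qed

lemma reg_hilbert_tendsto_positive:
  assumes f: "bounded_supported f" and s: "s > 0"
    and u: "u \<longlonglongrightarrow> 0" "\<And>n::nat. u n > 0"
  shows "(\<lambda>n. reg_hilbert (s + u n) f t) \<longlonglongrightarrow> reg_hilbert s f t"
  unfolding reg_hilbert_def
proof (rule integral_dominated_convergence)
  have [measurable]: "f \<in> borel_measurable borel" using f by (rule bounded_supported_measurable)
  show "(\<lambda>x. of_real (conj_poisson s (x - t)) * f x) \<in> borel_measurable lborel" by measurable
  show "(\<lambda>x. of_real (conj_poisson (s + u n) (x - t)) * f x) \<in> borel_measurable lborel" for n by measurable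
  show "integrable lborel (\<lambda>x. 1 / s * cmod (f x))"
    using integrable_bounded_supported[OF f] by auto
  show "AE x in lborel. (\<lambda>n. of_real (conj_poisson (s + u n) (x - t)) * f x) \<longlonglongrightarrow> of_real (conj_poisson s (x - t)) * f x"
  proof (rule AE_I2)
    fix x
    have "(x - t)\<^sup>2 + (s + 0)\<^sup>2 \<noteq> 0" using s by (simp add: add_nonneg_eq_0_iff)
    then have "(\<lambda>n. conj_poisson (s + u n) (x - t)) \<longlonglongrightarrow> conj_poisson (s + 0) (x - t)"
      unfolding conj_poisson_def by (intro tendsto_intros u) auto
    then show "(\<lambda>n. of_real (conj_poisson (s + u n) (x - t)) * f x) \<longlonglongrightarrow> of_real (conj_poisson s (x - t)) * f x"
      by (intro tendsto_intros) simp
  qed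
  show "AE x in lborel. norm (of_real (conj_poisson (s + u n) (x - t)) * f x) \<le> 1 / s * cmod (f x)" for n
  proof (rule AE_I2)
    fix x
    have "\<bar>conj_poisson (s + u n) (x - t)\<bar> \<le> 1 / (s + u n)"
      using s u(2)[of n] by (intro abs_conj_poisson_le) auto
    also have "\<dots> \<le> 1 / s" using s u(2)[of n] by (intro divide_left_mono) auto
    finally show "norm (of_real (conj_poisson (s + u n) (x - t)) * f x) \<le> 1 / s * cmod (f x)"
      unfolding norm_mult norm_of_real by (intro mult_right_mono) auto
  qed
qed

text \<open>A limit \<open>h\<close> in the weighted \<open>L\<^sup>1\<close> space is first obtained along a sequence. It is the limit
  almost everywhere because \<open>reg_hilbert s f\<close> is a multiple of the Poisson integral of \<open>h\<close>.\<close>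

lemma ex_hilbert_limit:
  assumes f: "bounded_supported f"
  obtains h where "h \<in> borel_measurable borel" "integrable lborel (\<lambda>t. cmod (h t) * cauchy_weight t)"
    "\<And>e. e > 0 \<Longrightarrow> \<exists>d>0. \<forall>s. 0 < s \<and> s < d \<longrightarrow>
        integrable lborel (\<lambda>t. cauchy_weight t * cmod (reg_hilbert s f t - h t)) \<and>
        (LINT t|lborel. cauchy_weight t * cmod (reg_hilbert s f t - h t)) \<le> e"
    "AE t in lborel. ((\<lambda>s. reg_hilbert s f t) \<longlongrightarrow> h t) (at_right 0)"
proof -
  let ?Q = "\<lambda>s. reg_hilbert s f" and ?w = "cauchy_weight"
  have [measurable]: "?Q s \<in> borel_measurable borel" for s using f by (rule reg_hilbert_measurable)
  define u where "u n = inverse (real (Suc n))" for n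
  have u0: "u n > 0" for n by (simp add: u_def)
  have ulim: "u \<longlonglongrightarrow> 0" unfolding u_def by (rule LIMSEQ_inverse_real_of_nat)
  have small: "\<exists>N. \<forall>n\<ge>N. u n < d" if "d > 0" for d
    using order_tendstoD(2)[OF ulim that] by (simp add: eventually_sequentially)
  obtain r where r: "strict_mono r" "AE x in lborel. Cauchy (\<lambda>i. ?w x *\<^sub>R ?Q (u (r i)) x)"
  proof (rule cauchy_L1_AE_cauchy_subseq)
    show "integrable lborel (\<lambda>x. ?w x *\<^sub>R ?Q (u n) x)" for n
      using f u0 by (rule integrable_reg_hilbert_weighted)
    fix e :: real assume "e > 0"
    from reg_hilbert_Cauchy_L1[OF f this] obtain d where "d > 0"
      and d: "\<And>s r. 0 < s \<and> s < d \<and> 0 < r \<and> r < d \<Longrightarrow> (LINT t|lborel. cmod (?w t *\<^sub>R ?Q s t - ?w t *\<^sub>R ?Q r t)) < e"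
      by blast
    obtain N where N: "\<And>n. n \<ge> N \<Longrightarrow> u n < d" using small[OF \<open>d > 0\<close>] by blast
    show "\<exists>N. \<forall>i\<ge>N. \<forall>j\<ge>N. (LINT x|lborel. norm (?w x *\<^sub>R ?Q (u i) x - ?w x *\<^sub>R ?Q (u j) x)) < e"
      by (intro exI[of _ N] allI impI d conjI u0 N)
  qed (rule that)
  define v where "v i = u (r i)" for i
  have v0: "v i > 0" for i by (simp add: v_def u0)
  have vlim: "v \<longlonglongrightarrow> 0" unfolding v_def[abs_def] using LIMSEQ_subseq_LIMSEQ[OF ulim r(1)] by (simp add: comp_def)
  define h where "h x = lim (\<lambda>i. ?Q (v i) x)" for x
  have [measurable]: "h \<in> borel_measurable borel"
    unfolding h_def by (intro borel_measurable_lim_metric) measurable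
  have hlim: "AE x in lborel. (\<lambda>i. ?Q (v i) x) \<longlonglongrightarrow> h x"
    using r(2)
  proof eventually_elim
    case (elim x)
    then have "convergent (\<lambda>i. ?w x *\<^sub>R ?Q (v i) x)"
      by (simp add: v_def Cauchy_convergent)
    then obtain l where "(\<lambda>i. ?w x *\<^sub>R ?Q (v i) x) \<longlonglongrightarrow> l"
      by (auto simp: convergent_def)
    then have "(\<lambda>i. inverse (?w x) *\<^sub>R (?w x *\<^sub>R ?Q (v i) x)) \<longlonglongrightarrow> inverse (?w x) *\<^sub>R l"
      by (intro tendsto_intros)
    then have "convergent (\<lambda>i. ?Q (v i) x)"
      using cauchy_weight_pos[of x] by (auto simp: convergent_def less_imp_neq[symmetric])
    then show ?case unfolding h_def by (simp add: convergent_LIMSEQ_iff)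
  qed
  have L1: "\<exists>d>0. \<forall>s. 0 < s \<and> s < d \<longrightarrow> integrable lborel (\<lambda>t. ?w t * cmod (?Q s t - h t)) \<and>
        (LINT t|lborel. ?w t * cmod (?Q s t - h t)) \<le> e" if e: "e > 0" for e
  proof -
    from reg_hilbert_Cauchy_L1[OF f e] obtain d where d: "d > 0"
      "\<And>s r. 0 < s \<and> s < d \<and> 0 < r \<and> r < d \<Longrightarrow> (LINT t|lborel. cmod (?w t *\<^sub>R ?Q s t - ?w t *\<^sub>R ?Q r t)) < e"
      by blast
    have "integrable lborel (\<lambda>t. ?w t * cmod (?Q s t - h t)) \<and> (LINT t|lborel. ?w t * cmod (?Q s t - h t)) \<le> e"
      if s: "0 < s" "s < d" for s
    proof -
      \<comment> \<open>Fatou's lemma along the sequence \<open>v\<close>, with \<open>s\<close> fixed.\<close>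
      have "(\<integral>\<^sup>+t. ennreal (?w t * cmod (?Q s t - h t)) \<partial>lborel)
        = (\<integral>\<^sup>+t. liminf (\<lambda>i. ennreal (cmod (?w t *\<^sub>R ?Q s t - ?w t *\<^sub>R ?Q (v i) t))) \<partial>lborel)"
      proof (rule nn_integral_cong_AE)
        show "AE t in lborel. ennreal (?w t * cmod (?Q s t - h t)) = liminf (\<lambda>i. ennreal (cmod (?w t *\<^sub>R ?Q s t - ?w t *\<^sub>R ?Q (v i) t)))"
          using hlim
        proof eventually_elim
          case (elim t)
          then have "(\<lambda>i. ennreal (cmod (?w t *\<^sub>R ?Q s t - ?w t *\<^sub>R ?Q (v i) t))) \<longlonglongrightarrow> ennreal (cmod (?w t *\<^sub>R ?Q s t - ?w t *\<^sub>R h t))"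
            by (intro tendsto_intros)
          from lim_imp_Liminf[OF _ this] show ?case
            by (simp flip: scaleR_diff_right)
        qed
      qed
      also have "\<dots> \<le> liminf (\<lambda>i. \<integral>\<^sup>+t. ennreal (cmod (?w t *\<^sub>R ?Q s t - ?w t *\<^sub>R ?Q (v i) t)) \<partial>lborel)"
        by (intro nn_integral_liminf) measurable
      also have "\<dots> \<le> ennreal e"
      proof (rule Liminf_le)
        have "\<forall>\<^sub>F i in sequentially. v i < d" using order_tendstoD(2)[OF vlim d(1)] .
        then show "\<forall>\<^sub>F i in sequentially. (\<integral>\<^sup>+t. ennreal (cmod (?w t *\<^sub>R ?Q s t - ?w t *\<^sub>R ?Q (v i) t)) \<partial>lborel) \<le> ennreal e"
        proof eventually_elim
          case (elim i)
          have "(\<integral>\<^sup>+t. ennreal (cmod (?w t *\<^sub>R ?Q s t - ?w t *\<^sub>R ?Q (v i) t)) \<partial>lborel)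
            = ennreal (LINT t|lborel. cmod (?w t *\<^sub>R ?Q s t - ?w t *\<^sub>R ?Q (v i) t))"
            using f s v0 by (intro nn_integral_eq_integral integrable_norm Bochner_Integration.integrable_diff
              integrable_reg_hilbert_weighted) auto
          also have "\<dots> \<le> ennreal e"
            using d(2)[of s "v i"] s v0[of i] elim by (intro ennreal_leI) auto
          finally show ?case .
        qed
      qed simp
      finally have *: "(\<integral>\<^sup>+t. ennreal (?w t * cmod (?Q s t - h t)) \<partial>lborel) \<le> ennreal e" .
      have i: "integrable lborel (\<lambda>t. ?w t * cmod (?Q s t - h t))"
        using * by (intro integrableI_bounded) (auto simp: top_unique less_top[symmetric] abs_mult)
      have "ennreal (LINT t|lborel. ?w t * cmod (?Q s t - h t)) \<le> ennreal e"
        using * i by (subst (asm) nn_integral_eq_integral) auto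
      with i e show ?thesis by simp
    qed
    with d(1) show ?thesis by blast
  qed
  have hw: "integrable lborel (\<lambda>t. cmod (h t) * ?w t)"
  proof -
    obtain d where d: "d > 0" "\<And>s. 0 < s \<and> s < d \<Longrightarrow> integrable lborel (\<lambda>t. ?w t * cmod (?Q s t - h t))"
      using L1[of 1] by auto
    have "integrable lborel (\<lambda>t. ?w t * cmod (?Q (d / 2) t - h t) + norm (?w t *\<^sub>R ?Q (d / 2) t))"
      using d f by (intro Bochner_Integration.integrable_add integrable_norm integrable_reg_hilbert_weighted) auto
    then show ?thesis
    proof (rule Bochner_Integration.integrable_bound)
      show "AE t in lborel. norm (cmod (h t) * ?w t) \<le> norm (?w t * cmod (?Q (d / 2) t - h t) + norm (?w t *\<^sub>R ?Q (d / 2) t))"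
      proof (rule AE_I2)
        fix t
        have "cmod (h t) \<le> cmod (?Q (d / 2) t - h t) + cmod (?Q (d / 2) t)"
          using norm_triangle_ineq4[of "?Q (d / 2) t" "?Q (d / 2) t - h t"] by simp
        then have "?w t * cmod (h t) \<le> ?w t * (cmod (?Q (d / 2) t - h t) + cmod (?Q (d / 2) t))"
          by (rule mult_left_mono) simp
        then show "norm (cmod (h t) * ?w t) \<le> norm (?w t * cmod (?Q (d / 2) t - h t) + norm (?w t *\<^sub>R ?Q (d / 2) t))"
          by (simp add: algebra_simps abs_mult)
      qed
    qed measurable
  qed
  have semigroup: "poisson_integral e h t = pi * ?Q e t" if e: "e > 0" for e t
  proof -
    obtain C where C: "\<And>x. poisson e (x - t) \<le> C * ?w x"
      using poisson_le_cauchy_weight[OF e] by blast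
    have C0: "C \<ge> 0"
    proof -
      have "0 \<le> C * ?w 0" using C[of 0] poisson_nonneg[OF e, of "0 - t"] by linarith
      then show ?thesis by (simp add: cauchy_weight_def)
    qed
    have int_h: "integrable lborel (\<lambda>x. of_real (poisson e (x - t)) * h x)"
      using integrable_poisson_mult[OF _ hw e, of t] by (simp add: scaleR_conv_of_real)
    have "(\<lambda>i. poisson_integral e (?Q (v i)) t) \<longlonglongrightarrow> poisson_integral e h t"
    proof (rule LIM_zero_cancel, rule tendstoI)
      fix \<epsilon> :: real assume \<epsilon>: "\<epsilon> > 0"
      define \<epsilon>' where "\<epsilon>' = \<epsilon> / (2 * (C + 1))"
      have \<epsilon>': "\<epsilon>' > 0" "C * \<epsilon>' < \<epsilon>" using \<epsilon> C0 by (auto simp: \<epsilon>'_def divide_simps)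
      obtain d where d: "d > 0" "\<And>s. 0 < s \<and> s < d \<Longrightarrow> integrable lborel (\<lambda>t. ?w t * cmod (?Q s t - h t)) \<and>
        (LINT t|lborel. ?w t * cmod (?Q s t - h t)) \<le> \<epsilon>'"
        using L1[OF \<epsilon>'(1)] by auto
      have "\<forall>\<^sub>F i in sequentially. v i < d" using order_tendstoD(2)[OF vlim d(1)] .
      then show "\<forall>\<^sub>F i in sequentially. dist (poisson_integral e (?Q (v i)) t - poisson_integral e h t) 0 < \<epsilon>"
      proof eventually_elim
        case (elim i)
        note di = d(2)[of "v i"]
        have iQ: "integrable lborel (\<lambda>x. of_real (poisson e (x - t)) * ?Q (v i) x)"
          using integrable_poisson_mult[OF _ _ e, of "?Q (v i)" t] integrable_norm[OF integrable_reg_hilbert_weighted[OF f v0[of i]]]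
          by (simp add: scaleR_conv_of_real norm_mult mult.commute)
        have "poisson_integral e (?Q (v i)) t - poisson_integral e h t
          = (LINT x|lborel. of_real (poisson e (x - t)) * (?Q (v i) x - h x))"
          unfolding poisson_integral_def using iQ int_h by (simp add: right_diff_distrib)
        also have "cmod \<dots> \<le> (LINT x|lborel. C * (?w x * cmod (?Q (v i) x - h x)))"
        proof (rule norm_integral_le)
          show "integrable lborel (\<lambda>x. C * (?w x * cmod (?Q (v i) x - h x)))"
            using di elim v0[of i] by simp
          fix x
          have "cmod (of_real (poisson e (x - t)) * (?Q (v i) x - h x)) = poisson e (x - t) * cmod (?Q (v i) x - h x)"
            using poisson_nonneg[OF e] by (simp add: norm_mult)
          also have "\<dots> \<le> (C * ?w x) * cmod (?Q (v i) x - h x)"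
            by (intro mult_right_mono C) simp
          finally show "cmod (of_real (poisson e (x - t)) * (?Q (v i) x - h x)) \<le> C * (?w x * cmod (?Q (v i) x - h x))"
            by (simp only: mult.assoc)
        qed measurable
        also have "\<dots> = C * (LINT x|lborel. ?w x * cmod (?Q (v i) x - h x))" by simp
        also have "\<dots> \<le> C * \<epsilon>'"
          using di elim v0[of i] C0 by (intro mult_left_mono) auto
        also have "\<dots> < \<epsilon>" by (rule \<epsilon>')
        finally show ?case by simp
      qed
    qed
    moreover have "(\<lambda>i. poisson_integral e (?Q (v i)) t) \<longlonglongrightarrow> pi * ?Q e t"
      unfolding poisson_integral_reg_hilbert[OF f e v0]
      by (intro tendsto_intros reg_hilbert_tendsto_positive f e vlim v0)
    ultimately show ?thesis by (rule LIMSEQ_unique)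
  qed
  have "AE t in lborel. ((\<lambda>s. ?Q s t) \<longlongrightarrow> h t) (at_right 0)"
    using AE_lebesgue_point_weighted[OF \<open>h \<in> _\<close> hw]
  proof eventually_elim
    case (elim t)
    have "((\<lambda>s. poisson_integral s h t / pi) \<longlongrightarrow> pi * h t / pi) (at_right 0)"
      by (intro tendsto_divide poisson_integral_tendsto_lebesgue_point hw elim tendsto_const) auto
    then have "((\<lambda>s. poisson_integral s h t / pi) \<longlongrightarrow> h t) (at_right 0)" by simp
    moreover have "\<forall>\<^sub>F s in at_right (0::real). poisson_integral s h t / pi = ?Q s t"
      using eventually_at_right_less[of "0::real"] by eventually_elim (simp add: semigroup)
    ultimately show ?case by (simp cong: tendsto_cong)
  qed
  then show ?thesis using that \<open>h \<in> _\<close> hw L1 by blast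
qed

section \<open>Principal values\<close>

text \<open>The truncated integrals of the principal value, without the factor \<open>1 / \<pi>\<close>.\<close>

definition truncated_hilbert :: "real \<Rightarrow> (real \<Rightarrow> complex) \<Rightarrow> real \<Rightarrow> complex"
  where "truncated_hilbert e f t = (LINT x|lborel. of_real (if e < \<bar>x - t\<bar> then 1 / (x - t) else 0) * f x)"

text \<open>The Hilbert transform as a principal value, on the whole line. It is defined for all \<open>t\<close>, with an
  irrelevant value where the limit does not exist.\<close>

definition pv_hilbert :: "(real \<Rightarrow> complex) \<Rightarrow> real \<Rightarrow> complex"
  where "pv_hilbert f t = Lim (at_right 0) (\<lambda>e. of_real (1 / pi) * truncated_hilbert e f t)"

lemma truncated_kernel_le:
  fixes e u :: real
  assumes "e > 0"
  shows "\<bar>if e < \<bar>u\<bar> then 1 / u else 0\<bar> \<le> 1 / e"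
  using assms by (auto simp: divide_simps abs_if split: if_splits)

lemma integrable_truncated:
  assumes f: "bounded_supported f" and e: "e > 0"
  shows "integrable lborel (\<lambda>x. of_real (if e < \<bar>x - t\<bar> then 1 / (x - t) else 0) * f x)"
proof (rule integrable_bounded_supported_mult[OF f])
  fix x show "cmod (of_real (if e < \<bar>x - t\<bar> then 1 / (x - t) else 0)) \<le> 1 / e"
    unfolding norm_of_real using e by (rule truncated_kernel_le)
qed measurable

lemma poisson_odd_kernel_integral:
  assumes e: "e > 0" and [measurable]: "k \<in> borel_measurable borel" and odd: "\<And>u. k (- u) = - k u"
    and k: "\<And>u. \<bar>k u\<bar> \<le> poisson e u"
  shows "integrable lborel (\<lambda>x. k (x - t))" "(LINT x|lborel. k (x - t)) = (0::real)"
proof -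
  have p: "integrable lborel (\<lambda>x. poisson e (x - t))"
    using has_bochner_integral_poisson[OF e, of t] by (auto simp: has_bochner_integral_iff)
  show i: "integrable lborel (\<lambda>x. k (x - t))"
    using k by (intro Bochner_Integration.integrable_bound[OF p]) (auto intro!: AE_I2 order_trans[OF k])
  have "(LINT x|lborel. k (x - t)) = (LINT x|lborel. k ((2 * t + (- 1) * x) - t))"
    using lborel_integral_real_affine[of "-1" "\<lambda>x. k (x - t)" "2 * t"] by simp
  also have "(\<lambda>x. k ((2 * t + (- 1) * x) - t)) = (\<lambda>x. - k (x - t))"
    unfolding odd[symmetric] by (simp add: algebra_simps)
  finally show "(LINT x|lborel. k (x - t)) = 0" by simp
qed

text \<open>For \<open>\<bar>u\<bar> > e\<close> the difference is \<open>e\<^sup>2 / (u (u\<^sup>2 + e\<^sup>2))\<close>.\<close>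

lemma truncated_minus_conj_poisson:
  fixes e u :: real
  assumes e: "e > 0"
  defines "k \<equiv> (if e < \<bar>u\<bar> then 1 / u else 0) - conj_poisson e u"
  shows "\<bar>k\<bar> \<le> poisson e u"
proof -
  have pos: "u\<^sup>2 + e\<^sup>2 > 0" using e by (simp add: add_nonneg_pos)
  show ?thesis
  proof (cases "e < \<bar>u\<bar>")
    case True
    then have u: "u \<noteq> 0" using e by auto
    have "k = (e / \<bar>u\<bar>) * (e / (u\<^sup>2 + e\<^sup>2)) * sgn u"
      using True u pos by (simp add: k_def conj_poisson_def divide_simps power2_eq_square sgn_if)
    then have "\<bar>k\<bar> = (e / \<bar>u\<bar>) * poisson e u"
      using u e pos by (simp add: abs_mult abs_divide poisson_def)
    also have "\<dots> \<le> 1 * poisson e u"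
      using True e u by (intro mult_right_mono poisson_nonneg) auto
    finally show ?thesis by simp
  next
    case False
    then show ?thesis using e pos
      by (simp add: k_def conj_poisson_def poisson_def abs_divide divide_right_mono)
  qed
qed

text \<open>The difference of the kernels is odd, so \<open>f t\<close> may be subtracted from \<open>f x\<close> under the integral.\<close>

lemma truncated_minus_reg_hilbert:
  assumes f: "bounded_supported f" and t: "lebesgue_point f t"
  shows "((\<lambda>e. truncated_hilbert e f t - reg_hilbert e f t) \<longlongrightarrow> 0) (at_right 0)"
proof (rule Lim_null_comparison)
  have [measurable]: "f \<in> borel_measurable borel" using f by (rule bounded_supported_measurable)
  show "((\<lambda>s. LINT x|lborel. poisson s (x - t) * cmod (f x - f t)) \<longlongrightarrow> 0) (at_right 0)"
    using t by (intro poisson_integral_tendsto bounded_supported_weighted f) auto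
  have "\<forall>\<^sub>F s in at_right (0::real). 0 < s" by (rule eventually_at_right_less)
  then show "\<forall>\<^sub>F e in at_right 0. norm (truncated_hilbert e f t - reg_hilbert e f t)
      \<le> (LINT x|lborel. poisson e (x - t) * cmod (f x - f t))"
  proof eventually_elim
    case (elim e)
    define k where "k u = (if e < \<bar>u\<bar> then 1 / u else 0) - conj_poisson e u" for u
    have [measurable]: "k \<in> borel_measurable borel" unfolding k_def by measurable
    have k: "\<bar>k u\<bar> \<le> poisson e u" for u unfolding k_def using elim by (rule truncated_minus_conj_poisson)
    have odd: "k (- u) = - k u" for u by (auto simp: k_def conj_poisson_def)
    note k0 = poisson_odd_kernel_integral[OF elim \<open>k \<in> _\<close> odd k, of t]
    have i1: "integrable lborel (\<lambda>x. of_real (conj_poisson e (x - t)) * f x)"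
    proof (rule integrable_bounded_supported_mult[OF f])
      show "cmod (of_real (conj_poisson e (x - t))) \<le> 1 / e" for x
        using elim by (simp add: abs_conj_poisson_le)
    qed measurable
    have "truncated_hilbert e f t - reg_hilbert e f t = (LINT x|lborel. of_real (k (x - t)) * f x)"
      using i1 integrable_truncated[OF f elim, of t]
      by (simp add: truncated_hilbert_def reg_hilbert_def k_def left_diff_distrib of_real_diff del: of_real_divide
          flip: Bochner_Integration.integral_diff)
    also have "\<dots> = (LINT x|lborel. of_real (k (x - t)) * f x) - (LINT x|lborel. of_real (k (x - t)) * f t)"
      using k0 by (simp add: integral_complex_of_real)
    also have "\<dots> = (LINT x|lborel. of_real (k (x - t)) * (f x - f t))"
    proof -
      have "integrable lborel (\<lambda>x. of_real (k (x - t)) * f x)"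
        using i1 integrable_truncated[OF f elim, of t]
        by (simp add: k_def left_diff_distrib of_real_diff del: of_real_divide)
      moreover have "integrable lborel (\<lambda>x. of_real (k (x - t)) * f t)"
        using k0 by (intro integrable_mult_left integrable_of_real)
      ultimately show ?thesis by (simp add: right_diff_distrib)
    qed
    also have "norm \<dots> \<le> (LINT x|lborel. poisson e (x - t) * cmod (f x - f t))"
    proof (rule norm_integral_le)
      have "integrable lborel (\<lambda>x. norm (poisson e (x - t) *\<^sub>R (f x - f t)))"
      proof (intro integrable_norm)
        have "integrable lborel (\<lambda>x. poisson e (x - t) *\<^sub>R f x)"
          using bounded_supported_weighted[OF f] elim by (intro integrable_poisson_mult) auto
        moreover have "integrable lborel (\<lambda>x. poisson e (x - t) *\<^sub>R f t)"
          using has_bochner_integral_poisson[OF elim, of t] by (intro integrable_scaleR_left) (auto simp: has_bochner_integral_iff)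
        ultimately show "integrable lborel (\<lambda>x. poisson e (x - t) *\<^sub>R (f x - f t))"
          by (simp add: scaleR_diff_right)
      qed
      then show "integrable lborel (\<lambda>x. poisson e (x - t) * cmod (f x - f t))"
        using elim by (simp add: poisson_nonneg)
      show "cmod (of_real (k (x - t)) * (f x - f t)) \<le> poisson e (x - t) * cmod (f x - f t)" for x
        unfolding norm_mult norm_of_real by (intro mult_right_mono k) auto
    qed measurable
    finally show ?case .
  qed
qed

lemma isCont_truncated_hilbert:
  assumes f: "bounded_supported f" and e: "e > 0"
  shows "isCont (truncated_hilbert e f) t"
  unfolding continuous_at_sequentially
proof (intro allI impI)
  have [measurable]: "f \<in> borel_measurable borel" using f by (rule bounded_supported_measurable)
  fix u :: "nat \<Rightarrow> real" assume u: "u \<longlonglongrightarrow> t"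
  let ?k = "\<lambda>t x. if e < \<bar>x - t\<bar> then 1 / (x - t) else 0"
  show "(truncated_hilbert e f \<circ> u) \<longlonglongrightarrow> truncated_hilbert e f t"
    unfolding truncated_hilbert_def comp_def
  proof (rule integral_dominated_convergence)
    show "integrable lborel (\<lambda>x. 1 / e * cmod (f x))"
      using integrable_bounded_supported[OF f] by auto
    show "AE x in lborel. (\<lambda>n. of_real (?k (u n) x) * f x) \<longlonglongrightarrow> of_real (?k t x) * f x"
      using AE_lborel_singleton[of "t + e"] AE_lborel_singleton[of "t - e"]
    proof eventually_elim
      case (elim x)
      have lim: "(\<lambda>n. \<bar>x - u n\<bar>) \<longlonglongrightarrow> \<bar>x - t\<bar>" by (intro tendsto_intros u)
      have "(\<lambda>n. ?k (u n) x) \<longlonglongrightarrow> ?k t x"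
      proof (cases "e < \<bar>x - t\<bar>")
        case True
        have "(\<lambda>n. 1 / (x - u n)) \<longlonglongrightarrow> 1 / (x - t)"
          using True e by (intro tendsto_intros u) auto
        moreover have "\<forall>\<^sub>F n in sequentially. 1 / (x - u n) = ?k (u n) x"
          using order_tendstoD(1)[OF lim True] by eventually_elim simp
        ultimately show ?thesis using True by (simp add: Lim_transform_eventually)
      next
        case False
        then have "\<bar>x - t\<bar> < e" using elim by (auto simp: abs_if split: if_splits)
        from order_tendstoD(2)[OF lim this] have "\<forall>\<^sub>F n in sequentially. ?k (u n) x = 0"
          by eventually_elim simp
        then show ?thesis using False by (simp add: tendsto_eventually)
      qed
      then show ?case by (intro tendsto_intros)
    qed
    show "AE x in lborel. norm (of_real (?k (u n) x) * f x) \<le> 1 / e * cmod (f x)" for n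
      unfolding norm_mult norm_of_real using e by (intro AE_I2 mult_right_mono truncated_kernel_le) auto
  qed measurable
qed

text \<open>The Cauchy criterion with countable quantifiers for the precision.\<close>

lemma convergent_at_right_0_iff:
  fixes g :: "real \<Rightarrow> complex"
  shows "(\<exists>l. (g \<longlongrightarrow> l) (at_right 0)) \<longleftrightarrow>
    (\<forall>n::nat. \<exists>m::nat. \<forall>p q. 0 < p \<and> p < inverse (Suc m) \<and> 0 < q \<and> q < inverse (Suc m) \<longrightarrow>
        dist (g p) (g q) \<le> inverse (Suc n))" (is "_ \<longleftrightarrow> ?R")
proof -
  have "(\<exists>l. (g \<longlongrightarrow> l) (at_right 0)) \<longleftrightarrow> cauchy_filter (filtermap g (at_right 0))"
    unfolding filterlim_def
    using nhds_imp_cauchy_filter cauchy_filter_complete_converges[of "filtermap g (at_right 0)" UNIV]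
    by (auto simp: complete_UNIV filtermap_bot_iff)
  also have "\<dots> \<longleftrightarrow> ?R"
    unfolding cauchy_filter_metric_filtermap
  proof safe
    fix n :: nat
    assume "\<forall>e>0. \<exists>P. eventually P (at_right 0) \<and> (\<forall>x y. P x \<and> P y \<longrightarrow> dist (g x) (g y) < e)"
    then obtain P where P: "eventually P (at_right 0)" "\<And>x y. P x \<and> P y \<Longrightarrow> dist (g x) (g y) < inverse (Suc n)"
      by (metis inverse_positive_iff_positive of_nat_0_less_iff zero_less_Suc)
    from P(1) obtain b where b: "b > 0" "\<And>x. 0 < x \<Longrightarrow> x < b \<Longrightarrow> P x"
      unfolding eventually_at_right_field by auto
    obtain m where m: "inverse (real (Suc m)) < b" using reals_Archimedean[OF b(1)] by blast
    show "\<exists>m::nat. \<forall>p q. 0 < p \<and> p < inverse (Suc m) \<and> 0 < q \<and> q < inverse (Suc m) \<longrightarrow> dist (g p) (g q) \<le> inverse (Suc n)"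
      by (intro exI[of _ m] allI impI less_imp_le P(2) conjI b(2)) (use m in auto)
  next
    fix e :: real assume R: ?R and "e > 0"
    then obtain n where n: "inverse (real (Suc n)) < e" using reals_Archimedean by blast
    from R obtain m :: nat where m: "\<And>p q. 0 < p \<and> p < inverse (Suc m) \<and> 0 < q \<and> q < inverse (Suc m) \<Longrightarrow>
        dist (g p) (g q) \<le> inverse (Suc n)" by meson
    have "\<forall>\<^sub>F p in at_right 0. 0 < p \<and> p < inverse (real (Suc m))"
      unfolding eventually_at_right_field by (intro exI[of _ "inverse (real (Suc m))"]) simp
    then show "\<exists>P. eventually P (at_right 0) \<and> (\<forall>x y. P x \<and> P y \<longrightarrow> dist (g x) (g y) < e)"
      using le_less_trans[OF m n] by blast
  qed
  finally show ?thesis .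
qed

text \<open>Measurability with respect to the Borel sets, not only their completion: the set where the limit
  exists is described by the Cauchy criterion, and the truncated integrals depend continuously on \<open>t\<close>.\<close>

lemma pv_hilbert_measurable:
  assumes f: "bounded_supported f"
  shows "pv_hilbert f \<in> borel_measurable borel"
proof -
  have [measurable]: "f \<in> borel_measurable borel" using f by (rule bounded_supported_measurable)
  define g where "g t e = of_real (1 / pi) * truncated_hilbert e f t" for t e
  have [measurable]: "(\<lambda>t. g t e) \<in> borel_measurable borel" for e
    unfolding g_def truncated_hilbert_def by measurable
  have cont: "continuous_on UNIV (\<lambda>t. g t e)" if "e > 0" for e
    unfolding g_def using that
    by (intro continuous_intros continuous_at_imp_continuous_on ballI isCont_truncated_hilbert f)
  define E where "E = {t. \<exists>l. (g t \<longlongrightarrow> l) (at_right 0)}"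
  have cl: "closed {t. \<forall>p q. 0 < p \<and> p < d \<and> 0 < q \<and> q < d \<longrightarrow> dist (g t p) (g t q) \<le> c}" for c d
  proof (intro closed_Collect_all)
    fix p q
    show "closed {t. 0 < p \<and> p < d \<and> 0 < q \<and> q < d \<longrightarrow> dist (g t p) (g t q) \<le> c}"
    proof (cases "0 < p \<and> 0 < q")
      case True
      then have "closed {t. dist (g t p) (g t q) \<le> c}"
        by (intro closed_Collect_le continuous_on_dist cont continuous_on_const) auto
      then show ?thesis using True by (cases "p < d \<and> q < d") auto
    qed auto
  qed
  have "E = (\<Inter>n::nat. \<Union>m::nat. {t. \<forall>p q. 0 < p \<and> p < inverse (Suc m) \<and> 0 < q \<and> q < inverse (Suc m) \<longrightarrow>
        dist (g t p) (g t q) \<le> inverse (Suc n)})"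
    unfolding E_def convergent_at_right_0_iff by blast
  also have "\<dots> \<in> sets borel"
    by (intro sets.countable_INT'' sets.countable_UN'' borel_closed cl) auto
  finally have [measurable]: "E \<in> sets borel" .
  \<comment> \<open>Off \<open>E\<close> the value of \<open>Lim\<close> is the same constant for all \<open>t\<close>.\<close>
  have "pv_hilbert f = (\<lambda>t. if t \<in> E then lim (\<lambda>n. g t (inverse (real (Suc n)))) else (THE l. False))"
  proof
    fix t
    show "pv_hilbert f t = (if t \<in> E then lim (\<lambda>n. g t (inverse (real (Suc n)))) else (THE l. False))"
    proof (cases "t \<in> E")
      case True
      then obtain l where l: "(g t \<longlongrightarrow> l) (at_right 0)" by (auto simp: E_def)
      have "filterlim (\<lambda>n. inverse (real (Suc n))) (at_right 0) sequentially"
        unfolding filterlim_at using LIMSEQ_inverse_real_of_nat by auto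
      from filterlim_compose[OF l this] have "lim (\<lambda>n. g t (inverse (real (Suc n)))) = l" by (rule limI)
      moreover have "pv_hilbert f t = l"
        unfolding pv_hilbert_def g_def[symmetric] using l by (intro tendsto_Lim) auto
      ultimately show ?thesis using True by simp
    next
      case False
      then have "\<not> (g t \<longlongrightarrow> l) (at_right 0)" for l by (auto simp: E_def)
      then show ?thesis using False unfolding pv_hilbert_def g_def[symmetric] t2_space_class.Lim_def by simp
    qed
  qed
  also have "\<dots> \<in> borel_measurable borel"
    by (intro measurable_If_set borel_measurable_lim_metric borel_measurable_const) measurable
  finally show ?thesis .
qed

lemma pv_hilbert_AE_eq:
  assumes f: "bounded_supported f"
    and h: "AE t in lborel. ((\<lambda>s. reg_hilbert s f t) \<longlongrightarrow> h t) (at_right 0)"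
  shows "AE t in lborel. pv_hilbert f t = of_real (1 / pi) * h t"
proof -
  have "AE t in lborel. lebesgue_point f t"
    using f by (intro AE_lebesgue_point_weighted bounded_supported_weighted bounded_supported_measurable)
  with h show ?thesis
  proof eventually_elim
    case (elim t)
    have "((\<lambda>e. (truncated_hilbert e f t - reg_hilbert e f t) + reg_hilbert e f t) \<longlongrightarrow> 0 + h t) (at_right 0)"
      by (intro tendsto_add truncated_minus_reg_hilbert f elim)
    then have "((\<lambda>e. of_real (1 / pi) * truncated_hilbert e f t) \<longlongrightarrow> of_real (1 / pi) * h t) (at_right 0)"
      by (intro tendsto_mult tendsto_const) simp
    then show ?case unfolding pv_hilbert_def by (intro tendsto_Lim) auto
  qed
qed

text \<open>In the last part the limit in the weighted \<open>L\<^sup>1\<close> space is spelled out.\<close>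

lemma pv_hilbert_properties:
  assumes f: "bounded_supported f"
  shows "AE t in lborel. ((\<lambda>s. reg_hilbert s f t) \<longlongrightarrow> pi * pv_hilbert f t) (at_right 0)"
    and "integrable lborel (\<lambda>t. cmod (pv_hilbert f t) * cauchy_weight t)"
    and "\<And>e. e > 0 \<Longrightarrow> \<exists>d>0. \<forall>s. 0 < s \<and> s < d \<longrightarrow>
        integrable lborel (\<lambda>t. cauchy_weight t * cmod (reg_hilbert s f t - pi * pv_hilbert f t)) \<and>
        (LINT t|lborel. cauchy_weight t * cmod (reg_hilbert s f t - pi * pv_hilbert f t)) \<le> e"
proof -
  have [measurable]: "pv_hilbert f \<in> borel_measurable borel" "reg_hilbert s f \<in> borel_measurable borel" for s
    using f by (rule pv_hilbert_measurable, rule reg_hilbert_measurable)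
  obtain h where [measurable]: "h \<in> borel_measurable borel" and h: "integrable lborel (\<lambda>t. cmod (h t) * cauchy_weight t)"
    and L1: "\<And>e. e > 0 \<Longrightarrow> \<exists>d>0. \<forall>s. 0 < s \<and> s < d \<longrightarrow>
        integrable lborel (\<lambda>t. cauchy_weight t * cmod (reg_hilbert s f t - h t)) \<and>
        (LINT t|lborel. cauchy_weight t * cmod (reg_hilbert s f t - h t)) \<le> e"
    and lim: "AE t in lborel. ((\<lambda>s. reg_hilbert s f t) \<longlongrightarrow> h t) (at_right 0)"
    using ex_hilbert_limit[OF f] by blast
  have eq: "AE t in lborel. h t = pi * pv_hilbert f t"
    using pv_hilbert_AE_eq[OF f lim] by eventually_elim simp
  show "AE t in lborel. ((\<lambda>s. reg_hilbert s f t) \<longlongrightarrow> pi * pv_hilbert f t) (at_right 0)"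
    using lim eq by eventually_elim simp
  have "integrable lborel (\<lambda>t. (1 / pi) * (cmod (h t) * cauchy_weight t))" using h by simp
  also have "?this \<longleftrightarrow> integrable lborel (\<lambda>t. cmod (pv_hilbert f t) * cauchy_weight t)"
    using eq by (intro integrable_cong_AE) (auto elim!: eventually_mono simp: norm_mult)
  finally show "integrable lborel (\<lambda>t. cmod (pv_hilbert f t) * cauchy_weight t)" .
  fix e :: real assume "e > 0"
  have "integrable lborel (\<lambda>t. cauchy_weight t * cmod (reg_hilbert s f t - h t))
     \<longleftrightarrow> integrable lborel (\<lambda>t. cauchy_weight t * cmod (reg_hilbert s f t - pi * pv_hilbert f t))" for s
    using eq by (intro integrable_cong_AE) (measurable, auto elim!: eventually_mono)
  moreover have "(LINT t|lborel. cauchy_weight t * cmod (reg_hilbert s f t - h t))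
     = (LINT t|lborel. cauchy_weight t * cmod (reg_hilbert s f t - pi * pv_hilbert f t))" for s
    using eq by (intro integral_cong_AE) (measurable, auto elim!: eventually_mono)
  ultimately show "\<exists>d>0. \<forall>s. 0 < s \<and> s < d \<longrightarrow>
        integrable lborel (\<lambda>t. cauchy_weight t * cmod (reg_hilbert s f t - pi * pv_hilbert f t)) \<and>
        (LINT t|lborel. cauchy_weight t * cmod (reg_hilbert s f t - pi * pv_hilbert f t)) \<le> e"
    using L1[OF \<open>e > 0\<close>] by simp
qed

lemma AE_mu_iff: "(AE x in mu. P x) \<longleftrightarrow> (AE x in lborel. x \<in> {-1<..<1} \<longrightarrow> P x)"
  unfolding mu_def by (subst AE_restrict_space_iff) auto

lemma borel_measurable_mu: "f \<in> borel_measurable borel \<Longrightarrow> f \<in> borel_measurable mu"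
  unfolding mu_def by (rule measurable_restrict_space1) simp

text \<open>The finite Hilbert transform of a bounded function depends on its class only, and on \<open>(-1, 1)\<close> it agrees with the principal
  value on the line everywhere, not only almost everywhere.\<close>

lemma finite_hilbert_eq_pv_hilbert:
  assumes f: "bounded_supported f" and g: "g \<in> borel_measurable mu" and eq: "AE x in mu. g x = f x"
    and t: "t \<in> {-1<..<1}"
  shows "finite_hilbert g t = pv_hilbert f t"
proof -
  have [measurable]: "f \<in> borel_measurable borel" using f by (rule bounded_supported_measurable)
  have gm: "(\<lambda>x. indicator {-1<..<1} x *\<^sub>R g x) \<in> borel_measurable borel"
    using g by (simp add: mu_def borel_measurable_restrict_space_iff)
  have cut: "(LBINT x:A. g x / complex_of_real (x - t))
      = (LINT x|lborel. of_real (indicator A x / (x - t)) * f x)"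
    if A: "A \<subseteq> {-1<..<1}" and [measurable]: "A \<in> sets borel" for A
  proof -
    have "(LBINT x:A. g x / complex_of_real (x - t)) = (LINT x|lborel. of_real (indicator A x / (x - t)) * (indicator {-1<..<1} x *\<^sub>R g x))"
      unfolding set_lebesgue_integral_def using A
      by (intro Bochner_Integration.integral_cong) (auto split: split_indicator)
    also have "\<dots> = (LINT x|lborel. of_real (indicator A x / (x - t)) * f x)"
    proof (rule integral_cong_AE)
      show "(\<lambda>x. of_real (indicator A x / (x - t)) * (indicator {-1<..<1} x *\<^sub>R g x)) \<in> borel_measurable lborel"
        using gm by measurable
      show "AE x in lborel. of_real (indicator A x / (x - t)) * (indicator {-1<..<1} x *\<^sub>R g x)
          = of_real (indicator A x / (x - t)) * f x"
        using eq unfolding AE_mu_iff by eventually_elim (use A in \<open>auto split: split_indicator\<close>)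
    qed measurable
    finally show ?thesis .
  qed
  have "\<forall>\<^sub>F e in at_right (0::real). 0 < e" by (rule eventually_at_right_less)
  then have "\<forall>\<^sub>F e in at_right 0. complex_of_real (1 / pi) *
    ((LBINT x:{-1<..<t - e}. g x / complex_of_real (x - t)) +
     (LBINT x:{t + e<..<1}. g x / complex_of_real (x - t))) = of_real (1 / pi) * truncated_hilbert e f t"
  proof eventually_elim
    case (elim e)
    have int: "integrable lborel (\<lambda>x. complex_of_real (indicator A x / (x - t)) * f x)"
      if "A \<in> sets borel" "\<And>x. x \<in> A \<Longrightarrow> e < \<bar>x - t\<bar>" for A
    proof (rule integrable_bounded_supported_mult[OF f])
      show "(\<lambda>x. complex_of_real (indicator A x / (x - t))) \<in> borel_measurable borel"
        using that(1) by measurable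
      fix x show "cmod (complex_of_real (indicator A x / (x - t))) \<le> 1 / e"
        unfolding norm_of_real
        using truncated_kernel_le[OF elim, of "x - t"] that(2)[of x] elim by (auto split: split_indicator)
    qed
    have "(LBINT x:{-1<..<t - e}. g x / complex_of_real (x - t)) + (LBINT x:{t + e<..<1}. g x / complex_of_real (x - t))
      = (LINT x|lborel. of_real (indicator {-1<..<t - e} x / (x - t)) * f x) + (LINT x|lborel. of_real (indicator {t + e<..<1} x / (x - t)) * f x)"
      using t elim by (intro arg_cong2[where f = "(+)"] cut) auto
    also have "\<dots> = (LINT x|lborel. of_real (indicator {-1<..<t - e} x / (x - t)) * f x + of_real (indicator {t + e<..<1} x / (x - t)) * f x)"
      using elim by (intro Bochner_Integration.integral_add[symmetric] int) auto
    also have "\<dots> = truncated_hilbert e f t"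
      unfolding truncated_hilbert_def
    proof (rule Bochner_Integration.integral_cong[OF refl])
      fix x
      show "of_real (indicator {-1<..<t - e} x / (x - t)) * f x + of_real (indicator {t + e<..<1} x / (x - t)) * f x
        = of_real (if e < \<bar>x - t\<bar> then 1 / (x - t) else 0) * f x"
      proof (cases "\<bar>x\<bar> < 1")
        case True
        then show ?thesis using elim by (auto simp: abs_if split: split_indicator if_splits)
      qed (simp add: bounded_supported_eq_0[OF f])
    qed
    finally show ?case by simp
  qed
  then show ?thesis
    unfolding finite_hilbert_def pv_hilbert_def t2_space_class.Lim_def by (simp only: tendsto_cong)
qed

lemma abs_L0_eq:
  assumes "g \<in> borel_measurable mu" "AE x in mu. f x = g x" "f \<in> borel_measurable mu"
  shows "abs_L0 f = abs_L0 g"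
  using assms Quotient3_rel_abs[OF Quotient3_L0, of f g] by (simp add: ae_eq_def)

lemma T_L0_abs_L0:
  assumes f: "bounded_supported f"
  shows "T_L0 (abs_L0 f) = abs_L0 (pv_hilbert f)"
proof -
  have fm: "f \<in> borel_measurable mu" by (intro borel_measurable_mu bounded_supported_measurable f)
  have pm: "pv_hilbert f \<in> borel_measurable mu" by (intro borel_measurable_mu pv_hilbert_measurable f)
  have eq: "finite_hilbert (rep_L0 (abs_L0 f)) t = pv_hilbert f t" if "t \<in> {-1<..<1}" for t
    using f rep_L0_measurable rep_abs_L0_AE[OF fm] that by (rule finite_hilbert_eq_pv_hilbert)
  have "finite_hilbert (rep_L0 (abs_L0 f)) \<in> borel_measurable mu \<longleftrightarrow> pv_hilbert f \<in> borel_measurable mu"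
    by (rule measurable_cong) (simp add: eq)
  with pm show ?thesis
    unfolding T_L0_def by (intro abs_L0_eq) (auto simp: AE_mu_iff eq)
qed

section \<open>Parseval's identity\<close>

lemma cauchy_weight_ge_half: "\<bar>x\<bar> < 1 \<Longrightarrow> 1 \<le> 2 * cauchy_weight x"
  using abs_le_square_iff[of x 1] by (simp add: cauchy_weight_def add_pos_nonneg)

lemma bounded_supported_mult_weight:
  assumes g: "bounded_supported g" and M: "\<And>x. cmod (g x) \<le> M"
  shows "cmod (g x) \<le> 2 * M * cauchy_weight x"
proof (cases "\<bar>x\<bar> < 1")
  case True
  have "0 \<le> M" using M[of x] norm_ge_zero order_trans by blast
  have "cmod (g x) \<le> M * 1" using M by simp
  also have "\<dots> \<le> M * (2 * cauchy_weight x)"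
    using True \<open>0 \<le> M\<close> by (intro mult_left_mono cauchy_weight_ge_half)
  finally show ?thesis by simp
next
  case False
  have "0 \<le> M" using M[of x] norm_ge_zero order_trans by blast
  then show ?thesis using False g by (simp add: bounded_supported_eq_0)
qed

lemma bounded_supported_bound:
  assumes "bounded_supported g"
  obtains M where "M > 0" "\<And>x. cmod (g x) \<le> M"
proof -
  obtain M where M: "M > 0" "\<And>x. cmod (g x) \<le> M * indicator {-1<..<1} x"
    using bounded_supportedE[OF assms] by blast
  have "cmod (g x) \<le> M" for x
    by (rule order_trans[OF M(2)]) (use M(1) in \<open>simp add: indicator_def\<close>)
  with M(1) show ?thesis by (rule that)
qed

lemma integrable_weighted_mult:
  fixes h :: "real \<Rightarrow> complex"
  assumes g: "bounded_supported g" and [measurable]: "h \<in> borel_measurable borel"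
    and h: "integrable lborel (\<lambda>x. cmod (h x) * cauchy_weight x)"
  shows "integrable lborel (\<lambda>x. h x * g x)"
proof -
  have [measurable]: "g \<in> borel_measurable borel" using g by (rule bounded_supported_measurable)
  obtain M where M: "M > 0" "\<And>x. cmod (g x) \<le> M" using bounded_supported_bound[OF g] by blast
  show ?thesis
  proof (rule Bochner_Integration.integrable_bound[OF integrable_mult_right[OF h, of "2 * M"]])
    show "AE x in lborel. norm (h x * g x) \<le> norm (2 * M * (cmod (h x) * cauchy_weight x))"
    proof (rule AE_I2)
      fix x
      have "norm (h x * g x) \<le> cmod (h x) * (2 * M * cauchy_weight x)"
        unfolding norm_mult by (intro mult_left_mono bounded_supported_mult_weight g M) simp
      also have "\<dots> \<le> norm (2 * M * (cmod (h x) * cauchy_weight x))" by (simp add: mult_ac)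
      finally show "norm (h x * g x) \<le> norm (2 * M * (cmod (h x) * cauchy_weight x))" .
    qed
  qed measurable
qed

lemma integrable_pv_hilbert_mult:
  "bounded_supported f \<Longrightarrow> bounded_supported g \<Longrightarrow> integrable lborel (\<lambda>x. pv_hilbert f x * g x)"
  by (intro integrable_weighted_mult pv_hilbert_measurable pv_hilbert_properties)

lemma reg_hilbert_pairing_tendsto:
  assumes f: "bounded_supported f" and g: "bounded_supported g"
  shows "((\<lambda>s. LINT t|lborel. reg_hilbert s f t * g t) \<longlongrightarrow> pi * (LINT t|lborel. pv_hilbert f t * g t)) (at_right 0)"
proof -
  have [measurable]: "g \<in> borel_measurable borel" "pv_hilbert f \<in> borel_measurable borel" "reg_hilbert s f \<in> borel_measurable borel" for s
    using f g by (auto intro: bounded_supported_measurable pv_hilbert_measurable reg_hilbert_measurable)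
  obtain M where M: "M > 0" "\<And>x. cmod (g x) \<le> M" using bounded_supported_bound[OF g] by blast
  show ?thesis
  proof (rule LIM_zero_cancel, rule tendstoI)
    fix e :: real assume e: "e > 0"
    obtain d where d: "d > 0" "\<And>s. 0 < s \<Longrightarrow> s < d \<Longrightarrow>
        integrable lborel (\<lambda>t. cauchy_weight t * cmod (reg_hilbert s f t - pi * pv_hilbert f t)) \<and>
        (LINT t|lborel. cauchy_weight t * cmod (reg_hilbert s f t - pi * pv_hilbert f t)) \<le> e / (4 * M)"
      using pv_hilbert_properties(3)[OF f, of "e / (4 * M)"] e M(1) by auto
    have "dist ((LINT t|lborel. reg_hilbert s f t * g t) - pi * (LINT t|lborel. pv_hilbert f t * g t)) 0 < e"
      if s: "0 < s" "s < d" for s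
    proof -
      have "integrable lborel (\<lambda>t. reg_hilbert s f t * g t)"
        using integrable_norm[OF integrable_reg_hilbert_weighted[OF f s(1)]]
        by (intro integrable_weighted_mult g) (auto simp: mult.commute)
      then have "(LINT t|lborel. reg_hilbert s f t * g t) - pi * (LINT t|lborel. pv_hilbert f t * g t)
        = (LINT t|lborel. reg_hilbert s f t * g t - pi * (pv_hilbert f t * g t))"
        using integrable_pv_hilbert_mult[OF f g] by simp
      also have "cmod \<dots> \<le> (LINT t|lborel. 2 * M * (cauchy_weight t * cmod (reg_hilbert s f t - pi * pv_hilbert f t)))"
      proof (rule norm_integral_le)
        show "integrable lborel (\<lambda>t. 2 * M * (cauchy_weight t * cmod (reg_hilbert s f t - pi * pv_hilbert f t)))"
          using d(2)[OF s] by simp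
        fix t
        have "cmod (reg_hilbert s f t * g t - pi * (pv_hilbert f t * g t)) = cmod (reg_hilbert s f t - pi * pv_hilbert f t) * cmod (g t)"
          by (simp add: left_diff_distrib mult.assoc flip: norm_mult)
        also have "\<dots> \<le> cmod (reg_hilbert s f t - pi * pv_hilbert f t) * (2 * M * cauchy_weight t)"
          by (intro mult_left_mono bounded_supported_mult_weight g M) simp
        finally show "cmod (reg_hilbert s f t * g t - pi * (pv_hilbert f t * g t)) \<le> 2 * M * (cauchy_weight t * cmod (reg_hilbert s f t - pi * pv_hilbert f t))"
          by (simp only: mult_ac)
      qed measurable
      also have "\<dots> \<le> 2 * M * (e / (4 * M))"
        unfolding integral_mult_right_zero using d(2)[OF s] M(1) by (intro mult_left_mono) auto
      also have "\<dots> < e" using e M(1) by simp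
      finally show ?thesis by simp
    qed
    then show "\<forall>\<^sub>F s in at_right 0. dist ((LINT t|lborel. reg_hilbert s f t * g t) - pi * (LINT t|lborel. pv_hilbert f t * g t)) 0 < e"
      unfolding eventually_at_right_field using d(1) by blast
  qed
qed

lemma reg_hilbert_antisymmetric:
  assumes f: "bounded_supported f" and g: "bounded_supported g" and s: "s > 0"
  shows "(LINT t|lborel. reg_hilbert s f t * g t) = - (LINT t|lborel. reg_hilbert s g t * f t)"
proof -
  have [measurable]: "f \<in> borel_measurable borel" "g \<in> borel_measurable borel"
    using f g by (auto intro: bounded_supported_measurable)
  obtain M where M: "M > 0" "\<And>x. cmod (g x) \<le> M" using bounded_supported_bound[OF g] by blast
  have "(LINT t|lborel. reg_hilbert s f t * g t) = (LINT t|lborel. LINT x|lborel. of_real (conj_poisson s (x - t)) * g t * f x)"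
    unfolding reg_hilbert_def by (simp add: mult_ac flip: integral_mult_right_zero)
  also have "\<dots> = (LINT x|lborel. (LINT t|lborel. of_real (conj_poisson s (x - t)) * g t) * f x)"
  proof (rule bounded_supported_Fubini[OF f])
    show "(\<lambda>(x, t). complex_of_real (conj_poisson s (x - t)) * g t) \<in> borel_measurable (borel \<Otimes>\<^sub>M borel)"
      unfolding conj_poisson_def by measurable
    fix x t :: real
    have "cmod (complex_of_real (conj_poisson s (x - t)) * g t) \<le> 1 / s * (2 * M * cauchy_weight t)"
      unfolding norm_mult norm_of_real using s
      by (intro mult_mono abs_conj_poisson_le bounded_supported_mult_weight g M) auto
    then show "cmod (complex_of_real (conj_poisson s (x - t)) * g t) \<le> (1 / s * (2 * M)) * cauchy_weight t"
      by (simp only: mult.assoc)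
  qed
  also have "\<dots> = (LINT x|lborel. - (reg_hilbert s g x * f x))"
  proof (rule Bochner_Integration.integral_cong[OF refl])
    fix x
    have "conj_poisson s (x - t) = - conj_poisson s (t - x)" for t
      by (simp add: conj_poisson_def power2_commute[of x] minus_divide_left)
    then show "(LINT t|lborel. of_real (conj_poisson s (x - t)) * g t) * f x = - (reg_hilbert s g x * f x)"
      by (simp add: reg_hilbert_def)
  qed
  finally show ?thesis by simp
qed

text \<open>The Hilbert transform is antisymmetric, because this holds for its regularizations.\<close>

lemma pv_hilbert_parseval:
  assumes f: "bounded_supported f" and g: "bounded_supported g"
  shows "(LINT t|lborel. pv_hilbert f t * g t) = - (LINT t|lborel. pv_hilbert g t * f t)"
proof -
  have "((\<lambda>s. LINT t|lborel. reg_hilbert s f t * g t) \<longlongrightarrow> - (pi * (LINT t|lborel. pv_hilbert g t * f t))) (at_right 0)"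
  proof (rule Lim_transform_eventually)
    show "((\<lambda>s. - (LINT t|lborel. reg_hilbert s g t * f t)) \<longlongrightarrow> - (pi * (LINT t|lborel. pv_hilbert g t * f t))) (at_right 0)"
      by (intro tendsto_minus reg_hilbert_pairing_tendsto f g)
    show "\<forall>\<^sub>F s in at_right 0. - (LINT t|lborel. reg_hilbert s g t * f t) = (LINT t|lborel. reg_hilbert s f t * g t)"
      using eventually_at_right_less[of "0::real"] by eventually_elim (simp add: reg_hilbert_antisymmetric[OF f g])
  qed
  from tendsto_unique[OF _ reg_hilbert_pairing_tendsto[OF f g] this]
  have "complex_of_real pi * (LINT t|lborel. pv_hilbert f t * g t) = complex_of_real pi * - (LINT t|lborel. pv_hilbert g t * f t)" by simp
  then show ?thesis by (subst (asm) mult_left_cancel) auto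
qed

section \<open>Complex measures with a density\<close>

text \<open>The supremum over the subsets of \<open>A\<close> is attained at the set where \<open>v\<close> is positive.\<close>

lemma positive_part_density:
  fixes v :: "'a \<Rightarrow> real"
  assumes v: "integrable M v" and \<rho>: "\<And>B. B \<in> sets M \<Longrightarrow> \<rho> B = (LINT x|M. indicator B x * v x)"
  shows "positive_part M \<rho> = density M (\<lambda>x. ennreal (max 0 (v x)))"
proof -
  have [measurable]: "v \<in> borel_measurable M" using v by auto
  let ?D = "density M (\<lambda>x. ennreal (max 0 (v x)))"
  have i: "integrable M (\<lambda>x. indicator B x * v x)" "integrable M (\<lambda>x. indicator B x * max 0 (v x))"
    if "B \<in> sets M" for B
    using integrable_mult_indicator[OF that v] integrable_mult_indicator[OF that, of "\<lambda>x. max 0 (v x)"] v by auto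
  have D: "emeasure ?D B = ennreal (LINT x|M. indicator B x * max 0 (v x))" if B: "B \<in> sets M" for B
  proof -
    have "emeasure ?D B = (\<integral>\<^sup>+x. ennreal (indicator B x * max 0 (v x)) \<partial>M)"
      using B by (auto simp: emeasure_density intro!: nn_integral_cong split: split_indicator)
    also have "\<dots> = ennreal (LINT x|M. indicator B x * max 0 (v x))"
      using i B by (intro nn_integral_eq_integral) auto
    finally show ?thesis .
  qed
  have eq: "(SUP B\<in>{B \<in> sets M. B \<subseteq> A}. ennreal (\<rho> B)) = emeasure ?D A" if A: "A \<in> sets M" for A
  proof (rule antisym)
    show "(SUP B\<in>{B \<in> sets M. B \<subseteq> A}. ennreal (\<rho> B)) \<le> emeasure ?D A"
    proof (rule SUP_least)
      fix B assume B: "B \<in> {B \<in> sets M. B \<subseteq> A}"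
      have "\<rho> B \<le> (LINT x|M. indicator A x * max 0 (v x))"
        unfolding \<rho>[of B, OF CollectD[OF B, THEN conjunct1]]
        using A B i by (intro integral_mono) (auto split: split_indicator)
      then show "ennreal (\<rho> B) \<le> emeasure ?D A"
        unfolding D[OF A] by (rule ennreal_leI)
    qed
    define B where "B = A \<inter> {x \<in> space M. 0 < v x}"
    have B: "B \<in> sets M" "B \<subseteq> A" using A by (auto simp: B_def)
    have "(LINT x|M. indicator A x * max 0 (v x)) = (LINT x|M. indicator B x * v x)"
      by (intro Bochner_Integration.integral_cong) (auto simp: B_def split: split_indicator)
    then have "emeasure ?D A = ennreal (\<rho> B)"
      using D[OF A] \<rho>[OF B(1)] by simp
    also have "\<dots> \<le> (SUP B\<in>{B \<in> sets M. B \<subseteq> A}. ennreal (\<rho> B))"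
      using B by (intro SUP_upper) auto
    finally show "emeasure ?D A \<le> (SUP B\<in>{B \<in> sets M. B \<subseteq> A}. ennreal (\<rho> B))" .
  qed
  have "positive_part M \<rho> = measure_of (space M) (sets M) (emeasure ?D)"
    unfolding positive_part_def using eq
    by (intro measure_of_eq sets.space_closed) (simp add: sets.sigma_sets_eq)
  also have "\<dots> = ?D"
    using measure_of_of_measure[of ?D] by simp
  finally show ?thesis .
qed

lemma integral_positive_part_diff:
  fixes v :: "'a \<Rightarrow> real" and f :: "'a \<Rightarrow> complex"
  assumes v: "integrable M v" and \<rho>: "\<And>B. B \<in> sets M \<Longrightarrow> \<rho> B = (LINT x|M. indicator B x * v x)"
    and f: "f \<in> borel_measurable M" and fv: "integrable M (\<lambda>x. of_real (v x) * f x)" and A: "A \<in> sets M"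
  shows "(LINT x:A|positive_part M \<rho>. f x) - (LINT x:A|positive_part M (\<lambda>B. - \<rho> B). f x)
    = (LINT x|M. indicator A x * (of_real (v x) * f x))"
proof -
  have [measurable]: "v \<in> borel_measurable M" using v by auto
  note f[measurable] A[measurable]
  have pp: "positive_part M \<rho> = density M (\<lambda>x. ennreal (max 0 (v x)))"
    "positive_part M (\<lambda>B. - \<rho> B) = density M (\<lambda>x. ennreal (max 0 (- v x)))"
    using v by (intro positive_part_density; simp add: \<rho>)+
  have i: "integrable M (\<lambda>x. k x *\<^sub>R (indicator A x *\<^sub>R f x))"
    if [measurable]: "k \<in> borel_measurable M" and "\<And>x. \<bar>k x\<bar> \<le> \<bar>v x\<bar>" for k :: "'a \<Rightarrow> real"
    using that(2)
    by (intro Bochner_Integration.integrable_bound[OF fv]) (auto simp: norm_mult intro!: AE_I2 mult_right_mono split: split_indicator)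
  have "(LINT x:A|positive_part M \<rho>. f x) - (LINT x:A|positive_part M (\<lambda>B. - \<rho> B). f x)
    = (LINT x|M. max 0 (v x) *\<^sub>R (indicator A x *\<^sub>R f x)) - (LINT x|M. max 0 (- v x) *\<^sub>R (indicator A x *\<^sub>R f x))"
    unfolding pp set_lebesgue_integral_def by (subst (1 2) integral_density) auto
  also have "\<dots> = (LINT x|M. max 0 (v x) *\<^sub>R (indicator A x *\<^sub>R f x) - max 0 (- v x) *\<^sub>R (indicator A x *\<^sub>R f x))"
    by (intro Bochner_Integration.integral_diff[symmetric] i) auto
  also have "\<dots> = (LINT x|M. indicator A x * (of_real (v x) * f x))"
    by (intro Bochner_Integration.integral_cong) (auto simp: scaleR_conv_of_real max_def split: split_indicator)
  finally show ?thesis .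
qed

lemma complex_measure_integral_density:
  fixes w f :: "'a \<Rightarrow> complex"
  assumes w: "integrable M w" and \<nu>: "\<And>B. B \<in> sets M \<Longrightarrow> \<nu> B = (LINT x|M. indicator B x * w x)"
    and f: "f \<in> borel_measurable M" and fw: "integrable M (\<lambda>x. w x * f x)" and A: "A \<in> sets M"
  shows "complex_measure_integral M \<nu> A f = (LINT x|M. indicator A x * (w x * f x))"
proof -
  have [measurable]: "w \<in> borel_measurable M" using w by auto
  note f[measurable] A[measurable]
  have iB: "integrable M (\<lambda>x. indicator B x * w x)" if "B \<in> sets M" for B
    using integrable_mult_indicator[OF that w] by (simp add: scaleR_conv_of_real of_real_indicator)
  have Re: "Re (\<nu> B) = (LINT x|M. indicator B x * Re (w x))" if "B \<in> sets M" for B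
    unfolding \<nu>[OF that] integral_Re[OF iB[OF that], symmetric]
    by (intro Bochner_Integration.integral_cong) (auto split: split_indicator)
  have Im: "Im (\<nu> B) = (LINT x|M. indicator B x * Im (w x))" if "B \<in> sets M" for B
    unfolding \<nu>[OF that] integral_Im[OF iB[OF that], symmetric]
    by (intro Bochner_Integration.integral_cong) (auto split: split_indicator)
  have i: "integrable M (\<lambda>x. of_real (Re (w x)) * f x)" "integrable M (\<lambda>x. of_real (Im (w x)) * f x)"
    by (rule Bochner_Integration.integrable_bound[OF fw];
        auto simp: norm_mult abs_Re_le_cmod abs_Im_le_cmod intro!: AE_I2 mult_right_mono)+
  have iA: "integrable M (\<lambda>x. indicator A x * (of_real (Re (w x)) * f x))" "integrable M (\<lambda>x. indicator A x * (of_real (Im (w x)) * f x))"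
    using integrable_mult_indicator[OF A i(1)] integrable_mult_indicator[OF A i(2)] by (simp_all add: scaleR_conv_of_real of_real_indicator)
  have "complex_measure_integral M \<nu> A f = (LINT x|M. indicator A x * (of_real (Re (w x)) * f x))
      + \<i> * (LINT x|M. indicator A x * (of_real (Im (w x)) * f x))"
    unfolding complex_measure_integral_def using w f A i
    by (intro arg_cong2[where f = "(+)"] arg_cong2[where f = "(*)"] refl integral_positive_part_diff) (auto simp: Re Im)
  also have "\<dots> = (LINT x|M. indicator A x * (of_real (Re (w x)) * f x) + \<i> * (indicator A x * (of_real (Im (w x)) * f x)))"
    using iA by simp
  also have "\<dots> = (LINT x|M. indicator A x * (w x * f x))"
  proof (rule Bochner_Integration.integral_cong[OF refl])
    fix x
    have "w x * f x = of_real (Re (w x)) * f x + \<i> * (of_real (Im (w x)) * f x)"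
      by (subst complex_eq[of "w x"]) (simp add: algebra_simps)
    then show "indicator A x * (of_real (Re (w x)) * f x) + \<i> * (indicator A x * (of_real (Im (w x)) * f x)) = indicator A x * (w x * f x)"
      by (simp add: algebra_simps)
  qed
  finally show ?thesis .
qed

text \<open>Only the upper bound for the variation is needed; it does not require the variation to be additive.\<close>

lemma nn_integral_variation_le:
  fixes w :: "'a \<Rightarrow> complex"
  assumes w: "integrable M w" and \<nu>: "\<And>B. B \<in> sets M \<Longrightarrow> \<nu> B = (LINT x|M. indicator B x * w x)"
    and F[measurable]: "F \<in> borel_measurable M"
  shows "(\<integral>\<^sup>+x. F x \<partial>variation M \<nu>) \<le> (\<integral>\<^sup>+x. ennreal (cmod (w x)) * F x \<partial>M)"
proof -
  have [measurable]: "w \<in> borel_measurable M" using w by auto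
  let ?D = "density M (\<lambda>x. ennreal (cmod (w x)))"
  have sets: "sets (variation M \<nu>) = sets M"
    unfolding variation_def by (simp add: sets.sigma_sets_eq sets.space_closed)
  have le: "emeasure (variation M \<nu>) A \<le> emeasure ?D A" for A
  proof (cases "A \<in> sets M")
    case A: True
    have B: "ennreal (cmod (\<nu> B)) \<le> emeasure ?D B" if B: "B \<in> sets M" for B
    proof -
      have "ennreal (cmod (\<nu> B)) \<le> (\<integral>\<^sup>+x. ennreal (cmod (indicator B x * w x)) \<partial>M)"
        unfolding \<nu>[OF B] using integrable_mult_indicator[OF B w]
        by (intro integral_norm_bound_ennreal) (simp add: scaleR_conv_of_real of_real_indicator)
      also have "\<dots> = emeasure ?D B"
        using B by (auto simp: emeasure_density norm_mult intro!: nn_integral_cong split: split_indicator)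
      finally show ?thesis .
    qed
    have "(SUP P\<in>{P. finite P \<and> partition_on A P \<and> P \<subseteq> sets M}. \<Sum>B\<in>P. ennreal (cmod (\<nu> B))) \<le> emeasure ?D A"
    proof (rule SUP_least)
      fix P assume P: "P \<in> {P. finite P \<and> partition_on A P \<and> P \<subseteq> sets M}"
      then have "(\<Sum>B\<in>P. ennreal (cmod (\<nu> B))) \<le> (\<Sum>B\<in>P. emeasure ?D B)"
        by (intro sum_mono B) auto
      also have "\<dots> = emeasure ?D (\<Union>B\<in>P. B)"
        using P by (intro sum_emeasure) (auto simp: partition_on_def disjoint_family_on_def disjoint_def)
      also have "(\<Union>B\<in>P. B) = A" using P by (auto simp: partition_on_def)
      finally show "(\<Sum>B\<in>P. ennreal (cmod (\<nu> B))) \<le> emeasure ?D A" .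
    qed
    \<comment> \<open>If the supremum were not a measure, \<open>measure_of\<close> would yield the zero measure.\<close>
    then show ?thesis
      unfolding variation_def by (simp add: emeasure_measure_of_conv)
  next
    case False
    then show ?thesis using sets by (simp add: emeasure_notin_sets)
  qed
  have "variation M \<nu> \<le> ?D"
    using sets_eq_imp_space_eq[OF sets] sets le by (simp add: le_measure_iff le_fun_def)
  then have "(\<integral>\<^sup>+x. F x \<partial>variation M \<nu>) \<le> (\<integral>\<^sup>+x. F x \<partial>?D)"
    using sets by (intro nn_integral_mono_measure) auto
  also have "\<dots> = (\<integral>\<^sup>+x. ennreal (cmod (w x)) * F x \<partial>M)"
    by (intro nn_integral_density) auto
  finally show ?thesis .
qed

section \<open>The vector measure and its integrals\<close>

lemma ae_eq_refl: "f \<in> borel_measurable mu \<Longrightarrow> ae_eq f f"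
  by (simp add: ae_eq_def)

lemma pairing_abs_L0:
  assumes "f \<in> borel_measurable mu" "g \<in> borel_measurable mu"
  shows "pairing (abs_L0 f) (abs_L0 g) = (LINT x|mu. f x * g x)"
  using assms by (intro pairing.abs_eq ae_eq_refl)

lemma pairing_rep_L0: "pairing f g = (LINT x|mu. rep_L0 f x * rep_L0 g x)"
  using pairing_abs_L0[OF rep_L0_measurable rep_L0_measurable, of f g] by (simp add: abs_rep_L0)

lemma abs_L0_in_L1: "integrable mu f \<Longrightarrow> abs_L0 f \<in> L1"
  unfolding L1_def using integrable_L0.abs_eq[of f] ae_eq_refl[of f] by auto

lemma rep_L0_integrable: "f \<in> L1 \<Longrightarrow> integrable mu (rep_L0 f)"
  unfolding L1_def using integrable_L0.abs_eq[of "rep_L0 f"] by (auto simp: abs_rep_L0 intro: ae_eq_refl rep_L0_measurable)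

lemma esssup_abs_L0: "f \<in> borel_measurable mu \<Longrightarrow> esssup_L0 (abs_L0 f) = esssup mu (\<lambda>x. ennreal (cmod (f x)))"
  by (intro esssup_L0.abs_eq ae_eq_refl)

lemma abs_L0_in_Linf:
  assumes [measurable]: "f \<in> borel_measurable mu" and "\<And>x. cmod (f x) \<le> K"
  shows "abs_L0 f \<in> Linf"
proof -
  have "esssup mu (\<lambda>x. ennreal (cmod (f x))) \<le> ennreal K"
    using assms(2) by (intro esssup_I) (auto intro!: ennreal_leI)
  then show ?thesis
    by (simp add: Linf_def esssup_abs_L0 order_le_less_trans[OF _ ennreal_less_top])
qed

lemma integral_mu_bounded_supported:
  assumes "bounded_supported f"
  shows "(LINT x|mu. h x * f x) = (LINT x|lborel. h x * f x)"
proof -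
  have "(LINT x|mu. h x * f x) = (LINT x|lborel. indicator {-1<..<1} x *\<^sub>R (h x * f x))"
    unfolding mu_def by (subst integral_restrict_space) auto
  also have "\<dots> = (LINT x|lborel. h x * f x)"
    using bounded_supported_eq_0[OF assms]
    by (intro Bochner_Integration.integral_cong) (auto split: split_indicator)
  finally show ?thesis .
qed

lemma bounded_supported_indicator_mult:
  assumes f: "bounded_supported f" and A: "A \<in> sets borel"
  shows "bounded_supported (\<lambda>x. indicator A x * f x)"
proof -
  have [measurable]: "f \<in> borel_measurable borel" using f by (rule bounded_supported_measurable)
  obtain M where M: "M > 0" "\<And>x. cmod (f x) \<le> M" using bounded_supported_bound[OF f] by blast
  have "cmod (indicator A x * f x) \<le> M" for x using M by (auto split: split_indicator)
  moreover have "(\<lambda>x. indicator A x * f x) \<in> borel_measurable borel" using A by measurable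
  ultimately show ?thesis using f by (auto simp: bounded_supported_def)
qed

lemma sets_mu_iff: "A \<in> sets mu \<longleftrightarrow> A \<in> sets borel \<and> A \<subseteq> {-1<..<1}"
  unfolding mu_def by (subst sets_restrict_space_iff) auto

lemma bounded_supported_indicator: 
  assumes "A \<in> sets mu"
  shows "bounded_supported (indicator A)"
  using assms unfolding bounded_supported_def sets_mu_iff
  by (auto intro!: exI[of _ 1] simp: indicator_def)

lemma bounded_supported_one: "bounded_supported (indicator {-1<..<1})"
  by (intro bounded_supported_indicator) (simp add: sets_mu_iff)

lemma integrable_mu_pv_hilbert:
  assumes f: "bounded_supported f"
  shows "integrable mu (pv_hilbert f)"
proof -
  have "integrable lborel (\<lambda>x. pv_hilbert f x * indicator {-1<..<1} x)"
    by (intro integrable_pv_hilbert_mult f bounded_supported_one)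
  also have "(\<lambda>x. pv_hilbert f x * indicator {-1<..<1} x) = (\<lambda>x. indicator {-1<..<1} x *\<^sub>R pv_hilbert f x)"
    by (auto simp: fun_eq_iff split: split_indicator)
  finally show ?thesis
    unfolding mu_def by (subst integrable_restrict_space) auto
qed

lemma AE_rep_le_norm_Linf:
  assumes g: "g \<in> Linf"
  shows "AE x in mu. cmod (rep_L0 g x) \<le> norm_Linf g"
proof -
  have e: "esssup_L0 g = esssup mu (\<lambda>x. ennreal (cmod (rep_L0 g x)))"
    using esssup_abs_L0[OF rep_L0_measurable, of g] by (simp add: abs_rep_L0)
  have n: "esssup_L0 g = ennreal (norm_Linf g)" "0 \<le> norm_Linf g"
    using g by (simp_all add: Linf_def norm_Linf_def)
  have "AE x in mu. ennreal (cmod (rep_L0 g x)) \<le> esssup_L0 g"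
    unfolding e by (rule esssup_AE)
  then show ?thesis unfolding n(1) by (simp only: ennreal_le_iff[OF n(2)])
qed

text \<open>Every class in \<open>Linf\<close> has a representative that is bounded everywhere by the norm.\<close>

lemma Linf_bounded_representative:
  assumes g: "g \<in> Linf"
  obtains g' where "bounded_supported g'" "\<And>x. cmod (g' x) \<le> norm_Linf g" "AE x in mu. rep_L0 g x = g' x"
proof -
  define u where "u x = indicator {-1<..<1} x *\<^sub>R rep_L0 g x" for x :: real
  have [measurable]: "u \<in> borel_measurable borel"
    using rep_L0_measurable[of g] unfolding u_def[abs_def] by (simp add: mu_def borel_measurable_restrict_space_iff)
  define g' where "g' x = (if cmod (u x) \<le> norm_Linf g then u x else 0)" for x
  have b: "cmod (g' x) \<le> norm_Linf g" for x by (simp add: g'_def norm_Linf_def)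
  have "g' \<in> borel_measurable borel" unfolding g'_def by measurable
  then have "bounded_supported g'"
    using b unfolding bounded_supported_def by (intro conjI exI[of _ "norm_Linf g"]) (auto simp: g'_def u_def)
  moreover have "AE x in mu. rep_L0 g x = g' x"
    using AE_rep_le_norm_Linf[OF g] unfolding AE_mu_iff by eventually_elim (auto simp: g'_def u_def)
  ultimately show ?thesis using b that by blast
qed

lemma pairing_pv_hilbert:
  assumes f: "bounded_supported f" and g: "bounded_supported g" "AE x in mu. rep_L0 G x = g x"
  shows "pairing (abs_L0 (pv_hilbert f)) G = - (LINT x|mu. pv_hilbert g x * f x)"
proof -
  have gm: "g \<in> borel_measurable mu" and pm: "pv_hilbert f \<in> borel_measurable mu"
    using f g by (auto intro: borel_measurable_mu bounded_supported_measurable pv_hilbert_measurable)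
  have "G = abs_L0 g"
    using abs_L0_eq[OF gm g(2) rep_L0_measurable] by (simp add: abs_rep_L0)
  then have "pairing (abs_L0 (pv_hilbert f)) G = (LINT x|mu. pv_hilbert f x * g x)"
    using pairing_abs_L0[OF pm gm] by simp
  also have "\<dots> = - (LINT x|mu. pv_hilbert g x * f x)"
    using f g by (simp add: integral_mu_bounded_supported pv_hilbert_parseval[OF f g(1)])
  finally show ?thesis .
qed

lemma scalar_measure_eq:
  assumes g: "bounded_supported g" "AE x in mu. rep_L0 G x = g x" and B: "B \<in> sets mu"
  shows "scalar_measure G B = (LINT x|mu. indicator B x * - pv_hilbert g x)"
  using pairing_pv_hilbert[OF bounded_supported_indicator[OF B] g] T_L0_abs_L0[OF bounded_supported_indicator[OF B]]
  by (simp add: scalar_measure_def m_L1_def mult.commute)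

text \<open>The measures \<open>scalar_measure G\<close> have the density \<open>- pv_hilbert g\<close>, so by Parseval's identity
  integration of a bounded function against the vector measure is the Hilbert transform.\<close>

lemma is_m_integral_bounded:
  assumes \<phi>: "bounded_supported \<phi>" and f: "f \<in> borel_measurable mu" "AE x in mu. f x = \<phi> x" and A: "A \<in> sets mu"
  shows "is_m_integral A f (abs_L0 (pv_hilbert (\<lambda>x. indicator A x * \<phi> x)))"
  unfolding is_m_integral_def
proof (intro conjI ballI)
  have A': "A \<in> sets borel" using A by (simp add: sets_mu_iff)
  have b: "bounded_supported (\<lambda>x. indicator A x * \<phi> x)"
    using \<phi> A' by (rule bounded_supported_indicator_mult)
  show "abs_L0 (pv_hilbert (\<lambda>x. indicator A x * \<phi> x)) \<in> L1"
    by (intro abs_L0_in_L1 integrable_mu_pv_hilbert b)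
  fix G assume "G \<in> Linf"
  then obtain g where g: "bounded_supported g" "AE x in mu. rep_L0 G x = g x"
    using Linf_bounded_representative by metis
  have m[measurable]: "\<phi> \<in> borel_measurable mu" "pv_hilbert g \<in> borel_measurable mu"
    using \<phi> g by (auto intro: borel_measurable_mu bounded_supported_measurable pv_hilbert_measurable)
  note f(1)[measurable] A[measurable]
  have int: "integrable mu (\<lambda>x. pv_hilbert g x * f x)"
  proof -
    obtain M where M: "M > 0" "\<And>x. cmod (\<phi> x) \<le> M" using bounded_supported_bound[OF \<phi>] by blast
    have "integrable mu (\<lambda>x. M *\<^sub>R pv_hilbert g x)" using integrable_mu_pv_hilbert[OF g(1)] by simp
    then show ?thesis
    proof (rule Bochner_Integration.integrable_bound)
      show "AE x in mu. norm (pv_hilbert g x * f x) \<le> norm (M *\<^sub>R pv_hilbert g x)"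
        using f(2) by eventually_elim (use M in \<open>auto simp: norm_mult mult.commute intro!: mult_right_mono\<close>)
    qed measurable
  qed
  have "complex_measure_integral mu (scalar_measure G) A f = (LINT x|mu. indicator A x * (- pv_hilbert g x * f x))"
    using g A int integrable_mu_pv_hilbert[OF g(1)] f
    by (intro complex_measure_integral_density) (auto simp: scalar_measure_eq)
  also have "\<dots> = (LINT x|mu. - (pv_hilbert g x * (indicator A x * \<phi> x)))"
    using f(2) by (intro integral_cong_AE) (measurable, auto elim!: eventually_mono)
  finally show "pairing (abs_L0 (pv_hilbert (\<lambda>x. indicator A x * \<phi> x))) G = complex_measure_integral mu (scalar_measure G) A f"
    using pairing_pv_hilbert[OF b g] by simp
qed

lemma variation_integral_bounded:
  assumes \<phi>: "bounded_supported \<phi>" and f: "f \<in> borel_measurable mu" "AE x in mu. f x = \<phi> x"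
    and g: "bounded_supported g" "AE x in mu. rep_L0 G x = g x"
  shows "complex_measure_integrable mu (scalar_measure G) f"
    and "(LINT x|variation mu (scalar_measure G). cmod (f x)) \<le> (LINT x|lborel. cmod (pv_hilbert g x) * cmod (\<phi> x))"
proof -
  let ?V = "variation mu (scalar_measure G)"
  have m[measurable]: "\<phi> \<in> borel_measurable mu" "pv_hilbert g \<in> borel_measurable mu"
    using \<phi> g by (auto intro: borel_measurable_mu bounded_supported_measurable pv_hilbert_measurable)
  note f(1)[measurable]
  have sets: "sets ?V = sets mu"
    unfolding variation_def by (metis sets.sets_measure_of_eq space_mu)
  have fV: "f \<in> borel_measurable ?V"
    using f(1) sets by (simp cong: measurable_cong_sets)
  have int: "integrable lborel (\<lambda>x. cmod (pv_hilbert g x * \<phi> x))"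
    by (intro integrable_norm integrable_pv_hilbert_mult g \<phi>)
  have "(\<integral>\<^sup>+x. ennreal (cmod (f x)) \<partial>?V) \<le> (\<integral>\<^sup>+x. ennreal (cmod (- pv_hilbert g x)) * ennreal (cmod (f x)) \<partial>mu)"
    using g integrable_mu_pv_hilbert[OF g(1)]
    by (intro nn_integral_variation_le) (auto simp: scalar_measure_eq)
  also have "\<dots> = (\<integral>\<^sup>+x. ennreal (cmod (pv_hilbert g x) * cmod (\<phi> x)) \<partial>mu)"
    using f(2) by (intro nn_integral_cong_AE) (auto elim!: eventually_mono simp: ennreal_mult')
  also have "\<dots> = (\<integral>\<^sup>+x. ennreal (cmod (pv_hilbert g x) * cmod (\<phi> x)) \<partial>lborel)"
    unfolding mu_def using bounded_supported_eq_0[OF \<phi>]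
    by (subst nn_integral_restrict_space) (auto intro!: nn_integral_cong split: split_indicator)
  also have "\<dots> = ennreal (LINT x|lborel. cmod (pv_hilbert g x) * cmod (\<phi> x))"
    using int by (intro nn_integral_eq_integral) (auto simp: norm_mult)
  finally have *: "(\<integral>\<^sup>+x. ennreal (cmod (f x)) \<partial>?V) \<le> ennreal (LINT x|lborel. cmod (pv_hilbert g x) * cmod (\<phi> x))" .
  then have i: "integrable ?V f"
    using fV by (intro integrableI_bounded) (auto simp: le_less_trans)
  then show "complex_measure_integrable mu (scalar_measure G) f"
    by (simp add: complex_measure_integrable_def)
  have "ennreal (LINT x|?V. cmod (f x)) \<le> ennreal (LINT x|lborel. cmod (pv_hilbert g x) * cmod (\<phi> x))"
    using * i by (subst (asm) nn_integral_eq_integral) auto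
  then show "(LINT x|?V. cmod (f x)) \<le> (LINT x|lborel. cmod (pv_hilbert g x) * cmod (\<phi> x))"
    by (subst (asm) ennreal_le_iff) auto
qed

text \<open>\<open>Linf\<close> separates the points of \<open>L1\<close>: the difference is paired with its conjugate sign.\<close>

lemma L1_eqI:
  assumes u: "u \<in> L1" and v: "v \<in> L1" and eq: "\<And>g. g \<in> Linf \<Longrightarrow> pairing u g = pairing v g"
  shows "u = v"
proof -
  define d where "d x = rep_L0 u x - rep_L0 v x" for x
  have iu: "integrable mu (rep_L0 u)" and iv: "integrable mu (rep_L0 v)"
    using u v by (auto intro: rep_L0_integrable)
  then have d: "integrable mu d" unfolding d_def by simp
  have [measurable]: "d \<in> borel_measurable mu" using d by auto
  define g where "g x = cnj (sgn (d x))" for x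
  have [measurable]: "g \<in> borel_measurable mu" unfolding g_def sgn_div_norm by measurable
  have g1: "cmod (g x) \<le> 1" for x by (simp add: g_def norm_sgn)
  have gL: "abs_L0 g \<in> Linf" using g1 by (intro abs_L0_in_Linf) auto
  have ig: "integrable mu (\<lambda>x. h x * g x)" if "integrable mu h" for h :: "real \<Rightarrow> complex"
    using g1 that by (intro Bochner_Integration.integrable_bound[OF that])
      (auto simp: norm_mult mult_left_le intro!: AE_I2)
  have pg: "pairing w (abs_L0 g) = (LINT x|mu. rep_L0 w x * g x)" for w
    using pairing_abs_L0[OF rep_L0_measurable[of w], of g] by (simp add: abs_rep_L0)
  have "(LINT x|mu. d x * g x) = 0"
    using eq[OF gL] ig[OF iu] ig[OF iv] by (simp add: d_def left_diff_distrib pg)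
  moreover have "d x * g x = of_real (cmod (d x))" for x
  proof -
    have "d x * g x = (d x * cnj (d x)) / of_real (cmod (d x))" by (simp add: g_def sgn_eq)
    also have "\<dots> = of_real ((cmod (d x))\<^sup>2) / of_real (cmod (d x))" by (simp only: complex_norm_square)
    finally show ?thesis by (simp add: power2_eq_square)
  qed
  ultimately have "(LINT x|mu. cmod (d x)) = 0"
    by (simp add: integral_complex_of_real)
  then have "AE x in mu. cmod (d x) = 0"
    using d by (subst (asm) integral_nonneg_eq_0_iff_AE) auto
  then have "abs_L0 (rep_L0 u) = abs_L0 (rep_L0 v)"
    by (intro abs_L0_eq rep_L0_measurable) (auto simp: d_def)
  then show ?thesis by (simp add: abs_rep_L0)
qed

lemma bounded_in_L1_m:
  assumes \<phi>: "bounded_supported \<phi>"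
  shows "abs_L0 \<phi> \<in> L1_m" and "integration_operator (abs_L0 \<phi>) = abs_L0 (pv_hilbert \<phi>)"
proof -
  let ?f = "rep_L0 (abs_L0 \<phi>)"
  have f: "?f \<in> borel_measurable mu" "AE x in mu. ?f x = \<phi> x"
    by (intro rep_L0_measurable rep_abs_L0_AE borel_measurable_mu bounded_supported_measurable \<phi>)+
  have "complex_measure_integrable mu (scalar_measure g) ?f" if "g \<in> Linf" for g
    using Linf_bounded_representative[OF that] variation_integral_bounded(1)[OF \<phi> f] by metis
  then show "abs_L0 \<phi> \<in> L1_m"
    unfolding L1_m_def m_integrable_def using is_m_integral_bounded[OF \<phi> f] f(1) by blast
  have "(\<lambda>x. indicator {-1<..<1} x * \<phi> x) = \<phi>"
    using bounded_supported_eq_0[OF \<phi>] by (auto simp: fun_eq_iff split: split_indicator)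
  then have m: "is_m_integral {-1<..<1} ?f (abs_L0 (pv_hilbert \<phi>))"
    using is_m_integral_bounded[OF \<phi> f, of "{-1<..<1}"] by (simp add: sets_mu_iff)
  show "integration_operator (abs_L0 \<phi>) = abs_L0 (pv_hilbert \<phi>)"
    unfolding integration_operator_def m_integral_def
  proof (rule the_equality)
    show "is_m_integral {-1<..<1} ?f (abs_L0 (pv_hilbert \<phi>))" by (rule m)
    fix h assume "is_m_integral {-1<..<1} ?f h"
    with m show "h = abs_L0 (pv_hilbert \<phi>)"
      by (intro L1_eqI) (auto simp: is_m_integral_def)
  qed
qed

text \<open>The norm is a supremum of real numbers; for an upper bound it suffices that the index set is
  nonempty.\<close>

lemma norm_L1_m_le:
  assumes \<phi>: "bounded_supported \<phi>"
    and le: "\<And>g. bounded_supported g \<Longrightarrow> (\<And>x. cmod (g x) \<le> 1) \<Longrightarrow> (LINT x|lborel. cmod (pv_hilbert g x) * cmod (\<phi> x)) \<le> C"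
  shows "norm_L1_m (abs_L0 \<phi>) \<le> C"
  unfolding norm_L1_m_def
proof (rule cSUP_least)
  have "abs_L0 (\<lambda>_. 0) \<in> Linf" by (rule abs_L0_in_Linf[of _ 0]) auto
  moreover have "norm_Linf (abs_L0 (\<lambda>_. 0)) \<le> 1"
  proof -
    have "esssup mu (\<lambda>x. ennreal (cmod 0)) \<le> 0" by (rule esssup_I) auto
    then show ?thesis by (simp add: norm_Linf_def esssup_abs_L0)
  qed
  ultimately show "{g \<in> Linf. norm_Linf g \<le> 1} \<noteq> {}" by blast
next
  fix G assume G: "G \<in> {g \<in> Linf. norm_Linf g \<le> 1}"
  then obtain g where g: "bounded_supported g" "\<And>x. cmod (g x) \<le> norm_Linf G" "AE x in mu. rep_L0 G x = g x"
    using Linf_bounded_representative by blast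
  have f: "rep_L0 (abs_L0 \<phi>) \<in> borel_measurable mu" "AE x in mu. rep_L0 (abs_L0 \<phi>) x = \<phi> x"
    by (intro rep_L0_measurable rep_abs_L0_AE borel_measurable_mu bounded_supported_measurable \<phi>)+
  have "(LINT x|variation mu (scalar_measure G). cmod (rep_L0 (abs_L0 \<phi>) x)) \<le> (LINT x|lborel. cmod (pv_hilbert g x) * cmod (\<phi> x))"
    using \<phi> f g(1,3) by (rule variation_integral_bounded)
  also have "\<dots> \<le> C" using G by (intro le g order_trans[OF g(2)]) auto
  finally show "(LINT x|variation mu (scalar_measure G). cmod (rep_L0 (abs_L0 \<phi>) x)) \<le> C" .
qed

text \<open>The number \<open>c\<close> for which \<open>c\<close> times the indicator of \<open>{0..exp (- n)}\<close> has norm \<open>1\<close> in \<open>L log L\<close>: with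
  \<open>a = exp (- n)\<close>, the integral of \<open>ln (2 * exp 1 / t)\<close> over \<open>(0, a)\<close> is \<open>a * (n + (2 + ln 2))\<close>.\<close>

definition spike_height :: "nat \<Rightarrow> real"
  where "spike_height n = exp (real n) / (real n + (2 + ln 2))"

section \<open>Spikes at the origin\<close>

text \<open>The test functions. The factor \<open>\<kappa>\<close> serves to normalize them in other norms.\<close>

definition spike :: "real \<Rightarrow> nat \<Rightarrow> real \<Rightarrow> complex"
  where "spike \<kappa> n x = of_real (\<kappa> * spike_height n) * indicator {0..exp (- real n)} x"

text \<open>Up to the factor \<open>1 / \<pi>\<close>, the Hilbert transform of the indicator of \<open>{0..a}\<close>.\<close>

definition log_ratio :: "real \<Rightarrow> real \<Rightarrow> real"
  where "log_ratio a t = ln \<bar>a - t\<bar> - ln \<bar>t\<bar>"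

lemma exp_neg_nat_bounds: "n \<ge> 1 \<Longrightarrow> 0 < exp (- real n) \<and> 2 * exp (- real n) < 1"
proof -
  assume n: "n \<ge> 1"
  have "2 < exp (1::real)" using exp_ge_add_one_self_aux e_approx_32 by (simp add: abs_if split: if_splits)
  also have "\<dots> \<le> exp (real n)" using n by simp
  finally show ?thesis by (simp add: exp_minus divide_simps)
qed

lemma spike_height_pos: "0 < spike_height n"
proof -
  have "ln (2::real) > 0" by simp
  then show ?thesis unfolding spike_height_def by (intro divide_pos_pos) (auto intro!: add_nonneg_pos)
qed

lemma norm_spike: "cmod (spike \<kappa> n x) = \<bar>\<kappa>\<bar> * spike_height n * indicator {0..exp (- real n)} x"
  using spike_height_pos[of n] unfolding spike_def norm_mult norm_of_real abs_mult
  by (auto split: split_indicator)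

lemma spike_height_mult: "spike_height n * exp (- real n) = 1 / (n + (2 + ln 2))"
  by (simp add: spike_height_def exp_minus)

lemma bounded_supported_spike:
  assumes "n \<ge> 1"
  shows "bounded_supported (spike \<kappa> n)"
proof -
  have "{0..exp (- real n)} \<subseteq> {-1<..<1}"
    using exp_neg_nat_bounds[OF assms] by auto
  then have "bounded_supported (indicator {0..exp (- real n)})"
    by (intro bounded_supported_indicator) (auto simp: sets_mu_iff)
  then obtain M where M: "M > 0" "\<And>x. cmod (indicator {0..exp (- real n)} x) \<le> M"
    and b: "bounded_supported (indicator {0..exp (- real n)})" using bounded_supported_bound by blast
  have "cmod (spike \<kappa> n x) \<le> \<bar>\<kappa> * spike_height n\<bar> * M" for x
    unfolding spike_def norm_mult norm_of_real by (intro mult_left_mono M) auto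
  moreover have "spike \<kappa> n \<in> borel_measurable borel" unfolding spike_def[abs_def] by measurable
  ultimately show ?thesis using bounded_supported_eq_0[OF b] by (auto simp: bounded_supported_def spike_def)
qed

lemma reg_hilbert_spike:
  assumes s: "s > 0"
  shows "reg_hilbert s (spike \<kappa> n) t = of_real (\<kappa> * spike_height n *
    ((1 / 2) * ln ((exp (- real n) - t)\<^sup>2 + s\<^sup>2) - (1 / 2) * ln (t\<^sup>2 + s\<^sup>2)))"
proof -
  let ?c = "\<kappa> * spike_height n" and ?a = "exp (- real n)"
  define F where "F x = (1 / 2) * ln ((x - t)\<^sup>2 + s\<^sup>2)" for x
  have pos: "u\<^sup>2 + s\<^sup>2 > 0" for u using s by (simp add: add_nonneg_pos)
  have nz: "u\<^sup>2 + s\<^sup>2 \<noteq> 0" for u using pos[of u] by (metis less_irrefl)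
  have "(LINT x|lborel. indicator {0..?a} x *\<^sub>R conj_poisson s (x - t)) = F ?a - F 0"
  proof (rule integral_FTC_atLeastAtMost)
    show "(F has_vector_derivative conj_poisson s (x - t)) (at x within {0..?a})" for x
    proof -
      have "((\<lambda>x. (x - t)\<^sup>2 + s\<^sup>2) has_real_derivative 2 * (x - t)) (at x within {0..?a})"
        by (auto intro!: derivative_eq_intros)
      note deriv = DERIV_cmult[OF DERIV_chain2[OF DERIV_ln_divide[OF pos] this], of "1 / 2"]
      have "1 / 2 * (1 / d * (2 * u)) = u / d" for d u :: real by simp
      from deriv[unfolded this] show ?thesis
        unfolding F_def[abs_def] conj_poisson_def has_real_derivative_iff_has_vector_derivative .
    qed
    show "continuous_on {0..?a} (\<lambda>x. conj_poisson s (x - t))"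
      unfolding conj_poisson_def using s by (intro continuous_intros) (auto simp: nz)
  qed simp
  moreover have "reg_hilbert s (spike \<kappa> n) t = (LINT x|lborel. of_real (?c * (indicator {0..?a} x *\<^sub>R conj_poisson s (x - t))))"
    unfolding reg_hilbert_def spike_def by (intro Bochner_Integration.integral_cong) (auto split: split_indicator)
  ultimately show ?thesis
    by (simp add: integral_complex_of_real F_def power2_commute del: of_real_mult)
qed

lemma pv_hilbert_spike:
  assumes n: "n \<ge> 1"
  shows "AE t in lborel. pv_hilbert (spike \<kappa> n) t
    = of_real (\<kappa> * spike_height n / pi * log_ratio (exp (- real n)) t)"
  using pv_hilbert_properties(1)[OF bounded_supported_spike[OF n, of \<kappa>]] AE_lborel_singleton[of 0] AE_lborel_singleton[of "exp (- real n)"]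
proof eventually_elim
  case (elim t)
  let ?c = "\<kappa> * spike_height n" and ?a = "exp (- real n)"
  have "((\<lambda>s. complex_of_real (?c * ((1 / 2) * ln ((?a - t)\<^sup>2 + s\<^sup>2) - (1 / 2) * ln (t\<^sup>2 + s\<^sup>2))))
      \<longlongrightarrow> of_real (?c * ((1 / 2) * ln ((?a - t)\<^sup>2 + 0\<^sup>2) - (1 / 2) * ln (t\<^sup>2 + 0\<^sup>2)))) (at_right 0)"
    using elim by (intro tendsto_intros) auto
  moreover have "(1 / 2) * ln ((?a - t)\<^sup>2 + 0\<^sup>2) - (1 / 2) * ln (t\<^sup>2 + 0\<^sup>2) = log_ratio ?a t"
  proof -
    have "ln (u\<^sup>2) = 2 * ln \<bar>u\<bar>" if "u \<noteq> 0" for u :: real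
      using that ln_realpow[of "\<bar>u\<bar>" 2] by simp
    then show ?thesis using elim by (simp add: log_ratio_def)
  qed
  ultimately have lim: "((\<lambda>s. complex_of_real (?c * ((1 / 2) * ln ((?a - t)\<^sup>2 + s\<^sup>2) - (1 / 2) * ln (t\<^sup>2 + s\<^sup>2))))
      \<longlongrightarrow> of_real (?c * log_ratio ?a t)) (at_right 0)"
    by (simp only:)
  have "\<forall>\<^sub>F s in at_right 0. complex_of_real (?c * ((1 / 2) * ln ((?a - t)\<^sup>2 + s\<^sup>2) - (1 / 2) * ln (t\<^sup>2 + s\<^sup>2)))
      = reg_hilbert s (spike \<kappa> n) t"
    using eventually_at_right_less[of "0::real"] by eventually_elim (simp only: reg_hilbert_spike)
  note Lim_transform_eventually[OF lim this]
  from tendsto_unique[OF _ elim(1) this] have "pi * pv_hilbert (spike \<kappa> n) t = of_real (?c * log_ratio ?a t)" by simp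
  then have "complex_of_real (1 / pi) * (pi * pv_hilbert (spike \<kappa> n) t) = complex_of_real (1 / pi) * of_real (?c * log_ratio ?a t)" by simp
  then show ?case by (simp add: mult_ac)
qed

lemma abs_log_ratio_le:
  assumes a: "a > 0" and t: "2 * a \<le> \<bar>t\<bar>"
  shows "\<bar>log_ratio a t\<bar> \<le> 2 * a / \<bar>t\<bar>"
proof -
  define z where "z = a / t"
  have t0: "t \<noteq> 0" using a t by auto
  have z: "\<bar>z\<bar> \<le> 1 / 2" using a t t0 by (simp add: z_def abs_divide divide_simps)
  have "\<bar>1 - z\<bar> = \<bar>a - t\<bar> / \<bar>t\<bar>"
  proof -
    have "1 - z = (t - a) / t" using t0 by (simp add: z_def diff_divide_distrib)
    then show ?thesis by (simp add: abs_divide abs_minus_commute)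
  qed
  moreover have "a \<noteq> t" using a t by auto
  ultimately have "log_ratio a t = ln (1 - z)"
    using z t0 by (simp add: log_ratio_def ln_div)
  moreover have "ln (1 - z) \<le> - z" using ln_le_minus_one[of "1 - z"] z by simp
  moreover have "- ln (1 - z) \<le> 2 * \<bar>z\<bar>"
  proof -
    have "- ln (1 - z) = ln (1 / (1 - z))" using z by (simp add: ln_div)
    also have "\<dots> \<le> 1 / (1 - z) - 1" using z by (intro ln_le_minus_one) auto
    also have "\<dots> = z / (1 - z)" using z by (simp add: field_simps)
    also have "\<dots> \<le> \<bar>z\<bar> / (1 / 2)" using z by (intro frac_le) auto
    finally show ?thesis by simp
  qed
  ultimately have "\<bar>log_ratio a t\<bar> \<le> 2 * \<bar>z\<bar>" by linarith
  then show ?thesis using a by (simp add: z_def abs_divide)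
qed

lemma continuous_on_x_ln_abs: "continuous_on UNIV (\<lambda>x::real. x * ln \<bar>x\<bar>)"
proof -
  have "isCont (\<lambda>x::real. x * ln \<bar>x\<bar>) x" for x
  proof (cases "x = 0")
    case True
    have "((\<lambda>x::real. x * ln \<bar>x\<bar>) \<longlongrightarrow> 0) (at_right 0)" by real_asymp
    moreover have "((\<lambda>x::real. x * ln \<bar>x\<bar>) \<longlongrightarrow> 0) (at_left 0)" by real_asymp
    ultimately show ?thesis using True by (simp add: isCont_def filterlim_split_at)
  qed (auto intro!: continuous_intros)
  then show ?thesis by (simp add: continuous_on_eq_continuous_at)
qed

text \<open>An antiderivative is \<open>(t - a) * ln \<bar>t - a\<bar> - t * ln \<bar>t\<bar>\<close>, continuous also at the two
  singularities.\<close>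

lemma has_integral_log_ratio:
  assumes a: "0 < a" "a < 1"
  shows "(log_ratio a has_integral a * ln a + (1 - a) * ln (1 - a)) {0..1}"
proof -
  define G where "G t = (t - a) * ln \<bar>t - a\<bar> - t * ln \<bar>t\<bar>" for t
  have "(log_ratio a has_integral (G 1 - G 0)) {0..1}"
  proof (rule fundamental_theorem_of_calculus_interior_strong)
    show "finite {a}" by simp
    show "continuous_on {0..1} G"
    proof -
      have "continuous_on {0..1} (\<lambda>t. (\<lambda>x. x * ln \<bar>x\<bar>) (t - a))"
        by (intro continuous_on_compose2[OF continuous_on_x_ln_abs] continuous_intros) auto
      then show ?thesis unfolding G_def
        by (intro continuous_on_diff continuous_on_subset[OF continuous_on_x_ln_abs]) auto
    qed
    fix t assume t: "t \<in> {0<..<1} - {a}"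
    have d: "((\<lambda>x. ln \<bar>x\<bar>) has_real_derivative 1 / u) (at u)" if "u \<noteq> 0" for u :: real
    proof (cases "u > 0")
      case True
      have "(ln has_real_derivative 1 / u) (at u)" using True by (rule DERIV_ln_divide)
      then show ?thesis
        by (rule DERIV_cong_ev[THEN iffD1, rotated 3])
           (use True in \<open>auto intro!: eventually_nhds_in_open[of "{0<..}", THEN eventually_mono]\<close>)
    next
      case False
      have "((\<lambda>x. ln (- x)) has_real_derivative 1 / u) (at u)"
        using False that by (auto intro!: derivative_eq_intros)
      then show ?thesis
        by (rule DERIV_cong_ev[THEN iffD1, rotated 3])
           (use False that in \<open>auto intro!: eventually_nhds_in_open[of "{..<0}", THEN eventually_mono]\<close>)
    qed
    have d1: "((\<lambda>t. ln \<bar>t - a\<bar>) has_real_derivative 1 / (t - a) * 1) (at t)"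
      using t by (intro DERIV_chain2[OF d]) (auto intro!: derivative_eq_intros)
    have "(G has_real_derivative (1 * ln \<bar>t - a\<bar> + 1 / (t - a) * 1 * (t - a)) - (1 * ln \<bar>t\<bar> + 1 / t * t)) (at t)"
      unfolding G_def using t by (intro DERIV_diff DERIV_mult d1 d) (auto intro!: derivative_eq_intros)
    also have "(1 * ln \<bar>t - a\<bar> + 1 / (t - a) * 1 * (t - a)) - (1 * ln \<bar>t\<bar> + 1 / t * t) = log_ratio a t"
      using t by (simp add: log_ratio_def abs_minus_commute)
    finally have "(G has_real_derivative log_ratio a t) (at t)" .
    then show "(G has_vector_derivative log_ratio a t) (at t)"
      by (simp add: has_real_derivative_iff_has_vector_derivative)
  qed simp
  moreover have "G 1 - G 0 = a * ln a + (1 - a) * ln (1 - a)"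
    using a by (simp add: G_def)
  ultimately show ?thesis by simp
qed

text \<open>The Hilbert transforms of the spikes carry a fixed amount of mass on \<open>(0, 1)\<close>, by the exact
  value of the integral of \<open>log_ratio\<close>.\<close>

lemma Re_integral_pv_hilbert_spike_le:
  assumes n: "n \<ge> 1" and \<kappa>: "\<kappa> > 0"
  shows "Re (LINT t|lborel. pv_hilbert (spike \<kappa> n) t * indicator {0..<1} t) \<le> - \<kappa> / (4 * pi)"
proof -
  let ?L = "real n + (2 + ln 2)"
  define c where "c = spike_height n"
  define a where "a = exp (- real n)"
  have a: "0 < a" "a < 1" using exp_neg_nat_bounds[OF n] n by (auto simp: a_def)
  have c: "c > 0" unfolding c_def by (rule spike_height_pos)
  have L: "?L > 0" by (intro add_nonneg_pos) (auto intro: add_pos_pos)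
  have bs: "bounded_supported (indicator {0..<1::real})"
    by (intro bounded_supported_indicator) (auto simp: sets_mu_iff)
  have int: "integrable lborel (\<lambda>t. pv_hilbert (spike \<kappa> n) t * indicator {0..<1} t)"
    by (intro integrable_pv_hilbert_mult bounded_supported_spike n bs)
  have [measurable]: "pv_hilbert (spike \<kappa> n) \<in> borel_measurable borel"
    by (intro pv_hilbert_measurable bounded_supported_spike n)
  have [measurable]: "log_ratio a \<in> borel_measurable borel" unfolding log_ratio_def[abs_def] by measurable
  have eq: "AE t in lborel. Re (pv_hilbert (spike \<kappa> n) t * indicator {0..<1} t) = indicator {0..1} t *\<^sub>R (\<kappa> * c / pi * log_ratio a t)"
    using pv_hilbert_spike[OF n, of \<kappa>] AE_lborel_singleton[of 1]
    by eventually_elim (auto simp: c_def a_def split: split_indicator simp del: of_real_mult of_real_divide)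
  have set_int: "set_integrable lborel {0..1} (\<lambda>t. \<kappa> * c / pi * log_ratio a t)"
    unfolding set_integrable_def by (rule integrable_cong_AE_imp[OF integrable_Re[OF int] _ eq]) measurable
  have "Re (LINT t|lborel. pv_hilbert (spike \<kappa> n) t * indicator {0..<1} t)
    = (LINT t|lborel. Re (pv_hilbert (spike \<kappa> n) t * indicator {0..<1} t))"
    using int by (rule integral_Re[symmetric])
  also have "\<dots> = (LBINT t:{0..1}. \<kappa> * c / pi * log_ratio a t)"
    unfolding set_lebesgue_integral_def using eq by (intro integral_cong_AE) auto
  also have "\<dots> = integral {0..1} (\<lambda>t. \<kappa> * c / pi * log_ratio a t)"
    by (rule set_borel_integral_eq_integral(2)[OF set_int])
  also have "\<dots> = \<kappa> * c / pi * (a * ln a + (1 - a) * ln (1 - a))"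
    using integral_unique[OF has_integral_mult_right[OF has_integral_log_ratio[OF a]]] by simp
  also have "\<dots> \<le> \<kappa> * c / pi * (a * ln a)"
    using a c \<kappa> by (intro mult_left_mono) (auto intro!: mult_nonneg_nonpos)
  also have "\<dots> = - (\<kappa> / pi * (c * a) * n)"
    by (simp add: a_def)
  also have "\<dots> = - \<kappa> / pi * (n / ?L)"
    unfolding c_def a_def spike_height_mult by simp
  also have "\<dots> \<le> - \<kappa> / pi * (1 / 4)"
  proof (rule mult_left_mono_neg)
    have "ln 2 < (1::real)" using ln_2_less_1 .
    then have "?L \<le> 4 * n" using n by linarith
    then show "1 / 4 \<le> n / ?L" using L by (simp add: divide_simps)
  qed (use \<kappa> in simp)
  finally show ?thesis by simp
qed

text \<open>At positive arguments the decreasing rearrangement of the spike is its height times the indicator of \<open>{..<exp (- n)}\<close>; the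
  upper bound is enough.\<close>

lemma spike_LlogL:
  assumes n: "n \<ge> 1"
  shows "LlogL_integral (abs_L0 (spike 1 n)) \<le> 1"
proof -
  let ?L = "real n + (2 + ln 2)"
  define c where "c = spike_height n"
  define a where "a = exp (- real n)"
  have a: "0 < a" "2 * a < 1" using exp_neg_nat_bounds[OF n] by (auto simp: a_def)
  have c: "c > 0" unfolding c_def by (rule spike_height_pos)
  have L: "?L > 0" by (intro add_nonneg_pos) (auto intro: add_pos_pos)
  have sm: "spike 1 n \<in> borel_measurable mu"
    by (intro borel_measurable_mu bounded_supported_measurable bounded_supported_spike n)
  have dr: "decreasing_rearrangement (abs_L0 (spike 1 n)) t \<le> c * indicator {..<a} t" if t: "t > 0" for t
  proof -
    let ?S = "{s. 0 \<le> s \<and> measure mu {x \<in> space mu. s < cmod (spike 1 n x)} \<le> t}"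
    have "decreasing_rearrangement (abs_L0 (spike 1 n)) t = Inf ?S"
      using sm by (simp add: decreasing_rearrangement.abs_eq ae_eq_refl)
    also have "\<dots> \<le> c * indicator {..<a} t"
    proof (rule cInf_lower)
      show "bdd_below ?S" by (rule bdd_belowI[of _ 0]) auto
      show "c * indicator {..<a} t \<in> ?S"
      proof (cases "t < a")
        case True
        have "{x \<in> space mu. c < cmod (spike 1 n x)} = {}"
          using c by (auto simp: norm_spike simp flip: c_def split: split_indicator)
        then have "measure mu {x \<in> space mu. c < cmod (spike 1 n x)} = 0" by (simp only: measure_empty)
        then show ?thesis using True t c by simp
      next
        case False
        have "{x \<in> space mu. 0 < cmod (spike 1 n x)} = {0..a}"
          using c a by (auto simp: norm_spike simp flip: c_def a_def split: split_indicator_asm)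
        moreover have "measure mu {0..a} = a"
          unfolding mu_def using a by (subst measure_restrict_space) auto
        ultimately show ?thesis using False by simp
      qed
    qed
    finally show ?thesis .
  qed
  define F where "F t = t * (ln 2 + 2) - t * ln \<bar>t\<bar>" for t :: real
  have hi: "((\<lambda>t. ln (2 * exp 1 / t)) has_integral (F a - F 0)) {0..a}"
  proof (rule fundamental_theorem_of_calculus_interior)
    show "continuous_on {0..a} F" unfolding F_def
      by (intro continuous_intros continuous_on_subset[OF continuous_on_x_ln_abs]) auto
    fix t assume t: "t \<in> {0<..<a}"
    have "((\<lambda>t. t * (ln 2 + 2) - t * ln t) has_real_derivative ln (2 * exp 1 / t)) (at t)"
      using t by (auto intro!: derivative_eq_intros simp: ln_div ln_mult)
    then have "(F has_real_derivative ln (2 * exp 1 / t)) (at t)"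
      unfolding F_def
      by (rule DERIV_cong_ev[THEN iffD1, rotated 3])
         (use t in \<open>auto intro!: eventually_nhds_in_open[of "{0<..}", THEN eventually_mono]\<close>)
    then show "(F has_vector_derivative ln (2 * exp 1 / t)) (at t)"
      by (simp add: has_real_derivative_iff_has_vector_derivative)
  qed (use a in simp)
  have nonneg: "0 \<le> ln (2 * exp 1 / t)" if "0 < t" "t \<le> 1" for t :: real
  proof -
    have "t \<le> 1 * 1" using that by simp
    also have "\<dots> \<le> 2 * exp (1::real)" by (intro mult_mono) auto
    finally show ?thesis using that by (intro ln_ge_zero) (simp add: divide_simps)
  qed
  have "LlogL_integral (abs_L0 (spike 1 n)) \<le> (\<integral>\<^sup>+t. ennreal c * (ennreal (ln (2 * exp 1 / t)) * indicator {0..a} t) \<partial>lborel)"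
    unfolding LlogL_integral_def
  proof (rule nn_integral_mono)
    fix t :: real
    show "ennreal (decreasing_rearrangement (abs_L0 (spike 1 n)) t * ln (2 * exp 1 / t)) * indicator {0<..<2} t
      \<le> ennreal c * (ennreal (ln (2 * exp 1 / t)) * indicator {0..a} t)"
    proof (cases "0 < t \<and> t < 2")
      case True
      have "t \<le> 2 * exp 1" using True one_le_exp_iff[of "1::real"] by (simp add: order_trans[of t 2])
      then have l: "0 \<le> ln (2 * exp 1 / t)" using True by (intro ln_ge_zero) (simp add: divide_simps)
      have "decreasing_rearrangement (abs_L0 (spike 1 n)) t * ln (2 * exp 1 / t) \<le> c * indicator {..<a} t * ln (2 * exp 1 / t)"
        using True l by (intro mult_right_mono dr) auto
      then have "ennreal (decreasing_rearrangement (abs_L0 (spike 1 n)) t * ln (2 * exp 1 / t)) \<le> ennreal (c * indicator {..<a} t * ln (2 * exp 1 / t))"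
        by (rule ennreal_leI)
      also have "\<dots> \<le> ennreal c * (ennreal (ln (2 * exp 1 / t)) * indicator {0..a} t)"
        using True l c by (auto simp: ennreal_mult split: split_indicator)
      finally show ?thesis using True by simp
    qed auto
  qed
  also have "\<dots> = ennreal c * (\<integral>\<^sup>+t. ennreal (ln (2 * exp 1 / t)) * indicator {0..a} t \<partial>lborel)"
    by (intro nn_integral_cmult) measurable
  also have "(\<integral>\<^sup>+t. ennreal (ln (2 * exp 1 / t)) * indicator {0..a} t \<partial>lborel) = ennreal (F a - F 0)"
  proof (rule nn_integral_has_integral_lebesgue'[OF _ hi])
    fix t assume "t \<in> {0..a}"
    then show "0 \<le> ln (2 * exp 1 / t)" using nonneg[of t] a by (cases "t = 0") auto
  qed
  also have "F a - F 0 = a * ?L"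
    using a by (simp add: F_def a_def algebra_simps)
  also have "ennreal c * ennreal (a * ?L) = ennreal (c * a * ?L)"
    using c by (simp add: ennreal_mult' mult.assoc)
  also have "c * a * ?L = 1"
    using L spike_height_mult[of n] by (simp add: c_def a_def)
  finally show ?thesis by simp
qed

section \<open>The norm of the spikes as functions integrable for the vector measure\<close>

lemma reg_hilbert_add:
  assumes f: "bounded_supported f" and g: "bounded_supported g" and s: "s > 0"
  shows "reg_hilbert s (\<lambda>x. f x + g x) t = reg_hilbert s f t + reg_hilbert s g t"
proof -
  have i: "integrable lborel (\<lambda>x. of_real (conj_poisson s (x - t)) * k x)" if "bounded_supported k" for k
  proof (rule integrable_bounded_supported_mult[OF that])
    show "cmod (of_real (conj_poisson s (x - t))) \<le> 1 / s" for x
      using s by (simp add: abs_conj_poisson_le)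
  qed measurable
  show ?thesis
    unfolding reg_hilbert_def distrib_left using i[OF f] i[OF g] by (rule Bochner_Integration.integral_add)
qed

lemma abs_conj_poisson_le_inverse:
  assumes "s > 0"
  shows "\<bar>conj_poisson s u\<bar> \<le> 1 / \<bar>u\<bar>"
proof (cases "u = 0")
  case False
  have "\<bar>u\<bar> * \<bar>u\<bar> \<le> u\<^sup>2 + s\<^sup>2" by (simp add: power2_eq_square)
  moreover have "u\<^sup>2 + s\<^sup>2 > 0" using assms by (simp add: add_nonneg_pos)
  ultimately show ?thesis using False
    by (simp add: conj_poisson_def abs_divide divide_simps)
qed (simp add: conj_poisson_def)

lemma has_bochner_integral_FTC_interval:
  fixes F f :: "real \<Rightarrow> real"
  assumes "a \<le> b" "\<And>x. a \<le> x \<Longrightarrow> x \<le> b \<Longrightarrow> (F has_vector_derivative f x) (at x within {a..b})"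
    and "continuous_on {a..b} f"
  shows "has_bochner_integral lborel (\<lambda>x. indicator {a..b} x *\<^sub>R f x) (F b - F a)"
  using integral_FTC_atLeastAtMost[OF assms] borel_integrable_atLeastAtMost'[OF assms(3)]
  by (simp add: has_bochner_integral_iff set_integrable_def)

lemma integral_inverse_abs:
  fixes a :: real
  assumes a: "0 < a" "a \<le> 1"
  shows "has_bochner_integral lborel (\<lambda>x. indicator {a..1} x *\<^sub>R (1 / \<bar>x\<bar>) + indicator {-1..-a} x *\<^sub>R (1 / \<bar>x\<bar>)) (2 * ln (1 / a))"
proof -
  have "has_bochner_integral lborel (\<lambda>x. indicator {a..1} x *\<^sub>R (1 / \<bar>x\<bar>)) (ln 1 - ln a)"
  proof (rule has_bochner_integral_FTC_interval[of a 1 ln "\<lambda>x. 1 / \<bar>x\<bar>"])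
    show "(ln has_vector_derivative 1 / \<bar>x\<bar>) (at x within {a..1})" if "a \<le> x" "x \<le> 1" for x
      using that a by (auto intro!: derivative_eq_intros simp: has_real_derivative_iff_has_vector_derivative[symmetric])
    show "continuous_on {a..1} (\<lambda>x. 1 / \<bar>x\<bar>)" using a by (intro continuous_intros) auto
  qed (use a in simp)
  moreover have "has_bochner_integral lborel (\<lambda>x. indicator {-1..-a} x *\<^sub>R (1 / \<bar>x\<bar>)) (- ln (- (- a)) - - ln (- (- 1)))"
  proof (rule has_bochner_integral_FTC_interval[where F = "\<lambda>x. - ln (- x)"])
    show "((\<lambda>x. - ln (- x)) has_vector_derivative 1 / \<bar>x\<bar>) (at x within {-1..-a})" if "-1 \<le> x" "x \<le> -a" for x
      using that a by (auto intro!: derivative_eq_intros simp: has_real_derivative_iff_has_vector_derivative[symmetric])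
    show "continuous_on {-1..-a} (\<lambda>x. 1 / \<bar>x\<bar>)" using a by (intro continuous_intros) auto
  qed (use a in simp)
  ultimately have "has_bochner_integral lborel (\<lambda>x. indicator {a..1} x *\<^sub>R (1 / \<bar>x\<bar>) + indicator {-1..-a} x *\<^sub>R (1 / \<bar>x\<bar>))
     ((ln 1 - ln a) + (- ln (- (- a)) - - ln (- (- 1))))"
    by (rule has_bochner_integral_add)
  then show ?thesis using a by (simp add: ln_div)
qed

text \<open>The part of \<open>g\<close> on \<open>(-2 * a, 2 * a)\<close> is treated by the \<open>L\<^sup>2\<close> bound. For the other part,
  \<open>\<bar>x - t\<bar> \<ge> \<bar>x\<bar> / 2\<close> bounds the regularized transform by a logarithm.\<close>

lemma integral_cmod_reg_hilbert_le:
  assumes g: "bounded_supported g" and g1: "\<And>x. cmod (g x) \<le> 1" and s: "s > 0" and a: "0 < a" "2 * a < 1"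
  shows "integrable lborel (\<lambda>t. indicator {0..a} t * cmod (reg_hilbert s g t))"
    and "(LINT t|lborel. indicator {0..a} t * cmod (reg_hilbert s g t)) \<le> a * (2 * pi\<^sup>2 + 1 / 2 + 4 * ln (1 / a))"
proof -
  have [measurable]: "g \<in> borel_measurable borel" "reg_hilbert s g \<in> borel_measurable borel"
    using g by (rule bounded_supported_measurable, rule reg_hilbert_measurable)
  define near where "near x = indicator {-2 * a<..<2 * a} x * g x" for x
  define far where "far x = indicator (- {-2 * a<..<2 * a}) x * g x" for x
  have near: "bounded_supported near" and far: "bounded_supported far"
    unfolding near_def[abs_def] far_def[abs_def] by (intro bounded_supported_indicator_mult g; simp)+
  have [measurable]: "reg_hilbert s near \<in> borel_measurable borel" "far \<in> borel_measurable borel"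
    using near far by (auto intro: reg_hilbert_measurable bounded_supported_measurable)
  have near1: "cmod (near x) \<le> 1" for x using g1[of x] by (auto simp: near_def split: split_indicator)
  have split: "reg_hilbert s g t = reg_hilbert s near t + reg_hilbert s far t" for t
  proof -
    have "g = (\<lambda>x. near x + far x)" by (auto simp: near_def far_def fun_eq_iff split: split_indicator)
    then show ?thesis using reg_hilbert_add[OF near far s] by simp
  qed
  have "(LINT x|lborel. cmod (near x)) \<le> (LINT x|lborel. indicator {-2 * a<..<2 * a} x)"
    using a g1 by (intro integral_mono integrable_norm integrable_bounded_supported[OF near] integrable_real_indicator)
      (auto simp: near_def split: split_indicator)
  then have nearL1: "(LINT x|lborel. cmod (near x)) \<le> 4 * a" using a by simp
  have far_le: "cmod (reg_hilbert s far t) \<le> 4 * ln (1 / a)" if t: "t \<in> {0..a}" for t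
  proof -
    let ?k = "\<lambda>x. indicator {2 * a..1} x *\<^sub>R (1 / \<bar>x\<bar>) + indicator {-1..-(2 * a)} x *\<^sub>R (1 / \<bar>x\<bar>)"
    have k: "has_bochner_integral lborel ?k (2 * ln (1 / (2 * a)))"
      using a by (intro integral_inverse_abs) auto
    have "cmod (reg_hilbert s far t) \<le> (LINT x|lborel. 2 * ?k x)"
      unfolding reg_hilbert_def
    proof (rule norm_integral_le)
      have "integrable lborel ?k" using k by (simp only: has_bochner_integral_iff)
      then show "integrable lborel (\<lambda>x. 2 * ?k x)" by (rule integrable_mult_right)
      fix x
      show "cmod (of_real (conj_poisson s (x - t)) * far x) \<le> 2 * ?k x"
      proof (cases "2 * a \<le> \<bar>x\<bar> \<and> \<bar>x\<bar> < 1")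
        case True
        have "cmod (of_real (conj_poisson s (x - t)) * far x) \<le> 1 / \<bar>x - t\<bar> * 1"
          unfolding norm_mult norm_of_real using g1[of x] s
          by (intro mult_mono abs_conj_poisson_le_inverse) (auto simp: far_def split: split_indicator)
        also have "\<dots> \<le> 1 / (\<bar>x\<bar> / 2) * 1"
        proof (intro mult_right_mono divide_left_mono)
          show "\<bar>x\<bar> / 2 \<le> \<bar>x - t\<bar>" "0 < \<bar>x - t\<bar> * (\<bar>x\<bar> / 2)"
            using True t a by (auto simp: abs_if zero_less_mult_iff split: if_splits)
        qed simp_all
        also have "\<dots> \<le> 2 * ?k x"
          using True a by (auto simp: abs_if split: split_indicator if_splits)
        finally show ?thesis .
      next
        case False
        then have "far x = 0"
          using bounded_supported_eq_0[OF g, of x] by (auto simp: far_def split: split_indicator)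
        then show ?thesis by simp
      qed
    qed measurable
    also have "\<dots> = 2 * (2 * ln (1 / (2 * a)))"
      unfolding integral_mult_right_zero using k by (simp only: has_bochner_integral_iff)
    also have "\<dots> = 4 * ln (1 / (2 * a))" by simp
    also have "\<dots> \<le> 4 * ln (1 / a)" using a by (simp add: ln_div ln_mult)
    finally show ?thesis .
  qed
  note sq = integral_reg_hilbert_square[OF near s near1]
  let ?B = "\<lambda>t. (1 / 2) * (cmod (reg_hilbert s near t))\<^sup>2 + (1 / 2 + 4 * ln (1 / a)) * indicator {0..a} t"
  have iB: "integrable lborel ?B"
    using sq(1) a by (intro Bochner_Integration.integrable_add integrable_mult_right integrable_real_indicator) auto
  have le: "indicator {0..a} t * cmod (reg_hilbert s g t) \<le> ?B t" for t
  proof (cases "t \<in> {0..a}")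
    case True
    have "cmod (reg_hilbert s g t) \<le> cmod (reg_hilbert s near t) + cmod (reg_hilbert s far t)"
      unfolding split by (rule norm_triangle_ineq)
    moreover have "cmod (reg_hilbert s near t) \<le> (1 / 2) * (cmod (reg_hilbert s near t))\<^sup>2 + 1 / 2"
      using sum_squares_bound[of "cmod (reg_hilbert s near t)" 1] by simp
    ultimately show ?thesis using far_le[OF True] True by simp
  qed simp
  show i: "integrable lborel (\<lambda>t. indicator {0..a} t * cmod (reg_hilbert s g t))"
    using le by (intro Bochner_Integration.integrable_bound[OF iB]) (auto intro!: AE_I2 order_trans[OF le])
  have "(LINT t|lborel. indicator {0..a} t * cmod (reg_hilbert s g t)) \<le> (LINT t|lborel. ?B t)"
    using i iB le by (rule integral_mono)
  also have "\<dots> = (1 / 2) * (LINT t|lborel. (cmod (reg_hilbert s near t))\<^sup>2) + (1 / 2 + 4 * ln (1 / a)) * a"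
    using sq(1) a by (subst Bochner_Integration.integral_add) (auto intro!: integrable_real_indicator)
  also have "\<dots> \<le> (1 / 2) * (pi\<^sup>2 * 1 * (4 * a)) + (1 / 2 + 4 * ln (1 / a)) * a"
    using order_trans[OF sq(2) mult_left_mono[OF nearL1, of "pi\<^sup>2 * 1"]] by (simp add: mult_ac)
  also have "\<dots> = a * (2 * pi\<^sup>2 + 1 / 2 + 4 * ln (1 / a))" by (simp add: algebra_simps)
  finally show "(LINT t|lborel. indicator {0..a} t * cmod (reg_hilbert s g t)) \<le> a * (2 * pi\<^sup>2 + 1 / 2 + 4 * ln (1 / a))" .
qed

lemma integral_cmod_pv_hilbert_le:
  assumes g: "bounded_supported g" and g1: "\<And>x. cmod (g x) \<le> 1" and a: "0 < a" "2 * a < 1"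
  shows "integrable lborel (\<lambda>t. indicator {0..a} t * cmod (pv_hilbert g t))"
    and "pi * (LINT t|lborel. indicator {0..a} t * cmod (pv_hilbert g t)) \<le> a * (2 * pi\<^sup>2 + 1 / 2 + 4 * ln (1 / a))"
proof -
  let ?R = "a * (2 * pi\<^sup>2 + 1 / 2 + 4 * ln (1 / a))"
  have b: "bounded_supported (indicator {0..a})"
    using a by (intro bounded_supported_indicator) (auto simp: sets_mu_iff)
  have "(\<lambda>t. norm (pv_hilbert g t * indicator {0..a} t)) = (\<lambda>t. indicator {0..a} t * cmod (pv_hilbert g t))"
    by (auto simp: fun_eq_iff norm_mult split: split_indicator)
  with integrable_norm[OF integrable_pv_hilbert_mult[OF g b]]
  show i: "integrable lborel (\<lambda>t. indicator {0..a} t * cmod (pv_hilbert g t))" by simp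
  show "pi * (LINT t|lborel. indicator {0..a} t * cmod (pv_hilbert g t)) \<le> ?R"
  proof (rule field_le_epsilon)
    fix e :: real assume e: "e > 0"
    obtain d where d: "d > 0" "\<And>s. 0 < s \<Longrightarrow> s < d \<Longrightarrow>
        integrable lborel (\<lambda>t. cauchy_weight t * cmod (reg_hilbert s g t - pi * pv_hilbert g t)) \<and>
        (LINT t|lborel. cauchy_weight t * cmod (reg_hilbert s g t - pi * pv_hilbert g t)) \<le> e / 2"
      using pv_hilbert_properties(3)[OF g, of "e / 2"] e by auto
    define s where "s = d / 2"
    have s: "0 < s" "s < d" using d(1) by (auto simp: s_def)
    note ds = d(2)[OF s]
    note R = integral_cmod_reg_hilbert_le[OF g g1 s(1) a]
    have "pi * (LINT t|lborel. indicator {0..a} t * cmod (pv_hilbert g t)) = (LINT t|lborel. pi * (indicator {0..a} t * cmod (pv_hilbert g t)))"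
      by simp
    also have "\<dots> \<le> (LINT t|lborel. indicator {0..a} t * cmod (reg_hilbert s g t) + 2 * (cauchy_weight t * cmod (reg_hilbert s g t - pi * pv_hilbert g t)))"
    proof (rule integral_mono)
      show "integrable lborel (\<lambda>t. pi * (indicator {0..a} t * cmod (pv_hilbert g t)))" using i by (rule integrable_mult_right)
      show "integrable lborel (\<lambda>t. indicator {0..a} t * cmod (reg_hilbert s g t) + 2 * (cauchy_weight t * cmod (reg_hilbert s g t - pi * pv_hilbert g t)))"
        using R(1) ds by (intro Bochner_Integration.integrable_add integrable_mult_right) auto
      fix t
      show "pi * (indicator {0..a} t * cmod (pv_hilbert g t)) \<le> indicator {0..a} t * cmod (reg_hilbert s g t) + 2 * (cauchy_weight t * cmod (reg_hilbert s g t - pi * pv_hilbert g t))"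
      proof (cases "t \<in> {0..a}")
        case True
        let ?d = "cmod (reg_hilbert s g t - pi * pv_hilbert g t)"
        have "pi * cmod (pv_hilbert g t) = cmod (pi * pv_hilbert g t)" by (simp add: norm_mult)
        also have "\<dots> \<le> cmod (reg_hilbert s g t) + ?d"
          using norm_triangle_ineq4[of "reg_hilbert s g t" "reg_hilbert s g t - pi * pv_hilbert g t"] by simp
        also have "?d \<le> 2 * cauchy_weight t * ?d"
          using mult_right_mono[OF cauchy_weight_ge_half[of t], of ?d] True a by auto
        finally show ?thesis using True by (simp add: mult.assoc)
      qed simp
    qed
    also have "\<dots> = (LINT t|lborel. indicator {0..a} t * cmod (reg_hilbert s g t)) + 2 * (LINT t|lborel. cauchy_weight t * cmod (reg_hilbert s g t - pi * pv_hilbert g t))"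
      using R(1) ds by simp
    also have "\<dots> \<le> ?R + 2 * (e / 2)"
      using R(2) ds by (intro add_mono mult_left_mono) auto
    finally show "pi * (LINT t|lborel. indicator {0..a} t * cmod (pv_hilbert g t)) \<le> ?R + e" by simp
  qed
qed

text \<open>The spikes are bounded in the norm of the space of integrable functions, since the logarithm
  \<open>ln (1 / a) = n\<close> is compensated by their normalization.\<close>

lemma norm_L1_m_spike_le:
  assumes n: "n \<ge> 1" and \<kappa>: "\<kappa> = 1 / (2 * pi\<^sup>2 + 5)"
  shows "norm_L1_m (abs_L0 (spike \<kappa> n)) \<le> 1"
proof (rule norm_L1_m_le[OF bounded_supported_spike[OF n]])
  fix g assume g: "bounded_supported g" "\<And>x. cmod (g x) \<le> 1"
  let ?L = "real n + (2 + ln 2)"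
  define c where "c = spike_height n"
  define a where "a = exp (- real n)"
  have a: "0 < a" "2 * a < 1" using exp_neg_nat_bounds[OF n] by (auto simp: a_def)
  have c: "c > 0" unfolding c_def by (rule spike_height_pos)
  have L: "?L \<ge> 1" "?L \<ge> n" using ln_gt_zero[of "2::real"] by (simp_all add: add_nonneg_nonneg)
  have C: "2 * pi\<^sup>2 + 5 > 0" by (simp add: add_nonneg_pos)
  let ?I = "LINT t|lborel. indicator {0..a} t * cmod (pv_hilbert g t)"
  note I = integral_cmod_pv_hilbert_le[OF g a]
  have "?I \<ge> 0" by (intro Bochner_Integration.integral_nonneg) simp
  have "(LINT x|lborel. cmod (pv_hilbert g x) * cmod (spike \<kappa> n x)) = (LINT x|lborel. \<kappa> * c * (indicator {0..a} x * cmod (pv_hilbert g x)))"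
    using \<kappa> C by (intro Bochner_Integration.integral_cong) (auto simp: norm_spike c_def a_def)
  also have "\<dots> = \<kappa> * c * ?I" by simp
  also have "\<dots> \<le> \<kappa> * c * (pi * ?I)"
  proof (rule mult_left_mono)
    have "1 * ?I \<le> pi * ?I" using pi_ge_two \<open>?I \<ge> 0\<close> by (intro mult_right_mono) auto
    then show "?I \<le> pi * ?I" by simp
  qed (use c \<kappa> C in simp)
  also have "\<dots> \<le> \<kappa> * c * (a * (2 * pi\<^sup>2 + 1 / 2 + 4 * ln (1 / a)))"
    using I(2) c \<kappa> C by (intro mult_left_mono) auto
  also have "\<dots> = \<kappa> * ((c * a) * (2 * pi\<^sup>2 + 1 / 2 + 4 * ln (1 / a)))"
    by (simp add: mult_ac)
  also have "ln (1 / a) = n" by (simp add: a_def ln_div)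
  also have "c * a = 1 / ?L" unfolding c_def a_def by (rule spike_height_mult)
  also have "\<kappa> * (1 / ?L * (2 * pi\<^sup>2 + 1 / 2 + 4 * real n)) \<le> \<kappa> * (2 * pi\<^sup>2 + 5)"
  proof (rule mult_left_mono)
    have "2 * p + 1 / 2 + 4 * m \<le> (2 * p + 5) * l" if "1 \<le> l" "m \<le> l" "0 \<le> p" for p m l :: real
      using mult_left_mono[OF that(1), of "2 * p"] that unfolding distrib_right by linarith
    from this[OF L, of "pi\<^sup>2"] have "2 * pi\<^sup>2 + 1 / 2 + 4 * real n \<le> (2 * pi\<^sup>2 + 5) * ?L" by simp
    then show "1 / ?L * (2 * pi\<^sup>2 + 1 / 2 + 4 * real n) \<le> 2 * pi\<^sup>2 + 5"
      using L(1) by (simp only: times_divide_eq_left mult_1_left) (subst pos_divide_le_eq, linarith, assumption)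
  qed (use \<kappa> C in simp)
  also have "\<dots> = 1" using \<kappa> C by simp
  finally show "(LINT x|lborel. cmod (pv_hilbert g x) * cmod (spike \<kappa> n x)) \<le> 1" .
qed

section \<open>Failure of weak compactness\<close>

lemma pairing_in_dual_space:
  assumes g: "g \<in> Linf"
  shows "(\<lambda>f. pairing f g) \<in> dual_space L1 norm_L1"
proof -
  obtain g' where g': "bounded_supported g'" "\<And>x. cmod (g' x) \<le> norm_Linf g" "AE x in mu. rep_L0 g x = g' x"
    using Linf_bounded_representative[OF g] by blast
  have [measurable]: "g' \<in> borel_measurable mu"
    by (intro borel_measurable_mu bounded_supported_measurable g')
  have p: "pairing f g = (LINT x|mu. rep_L0 f x * g' x)" for f
    unfolding pairing_rep_L0
  proof (rule integral_cong_AE)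
    show "AE x in mu. rep_L0 f x * rep_L0 g x = rep_L0 f x * g' x"
      using g'(3) by eventually_elim simp
  qed measurable
  have i: "integrable mu (\<lambda>x. rep_L0 f x * g' x)" if "f \<in> L1" for f
  proof (rule Bochner_Integration.integrable_bound[OF integrable_mult_right[OF integrable_norm[OF rep_L0_integrable[OF that]], of "norm_Linf g"]])
    show "AE x in mu. norm (rep_L0 f x * g' x) \<le> norm (norm_Linf g * norm (rep_L0 f x))"
    proof (rule AE_I2)
      fix x
      have "norm (rep_L0 f x * g' x) \<le> norm (rep_L0 f x) * norm_Linf g"
        unfolding norm_mult by (intro mult_left_mono g') simp
      then show "norm (rep_L0 f x * g' x) \<le> norm (norm_Linf g * norm (rep_L0 f x))"
        by (simp add: norm_Linf_def mult.commute abs_mult)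
    qed
  qed measurable
  have n: "norm_L1 f = (LINT x|mu. cmod (rep_L0 f x))" for f
    using norm_L1.abs_eq[OF ae_eq_refl[OF rep_L0_measurable[of f]]] by (simp add: abs_rep_L0)
  have add: "AE x in mu. rep_L0 (u + v) x = rep_L0 u x + rep_L0 v x" for u v
  proof -
    have "u + v = abs_L0 (\<lambda>x. rep_L0 u x + rep_L0 v x)"
      using plus_L0.abs_eq[OF ae_eq_refl[OF rep_L0_measurable[of u]] ae_eq_refl[OF rep_L0_measurable[of v]]]
      by (simp add: abs_rep_L0)
    then show ?thesis by (simp add: rep_abs_L0_AE)
  qed
  have scale: "AE x in mu. rep_L0 (scale_L0 c u) x = c * rep_L0 u x" for c u
  proof -
    have "scale_L0 c u = abs_L0 (\<lambda>x. c * rep_L0 u x)"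
      using scale_L0.abs_eq[OF ae_eq_refl[OF rep_L0_measurable[of u]]] by (simp add: abs_rep_L0)
    then show ?thesis by (simp add: rep_abs_L0_AE)
  qed
  show ?thesis
    unfolding dual_space_def
  proof (intro CollectI conjI ballI allI exI)
    fix u v assume uv: "u \<in> L1" "v \<in> L1"
    have "pairing (u + v) g = (LINT x|mu. rep_L0 u x * g' x + rep_L0 v x * g' x)"
      unfolding p
    proof (rule integral_cong_AE)
      show "AE x in mu. rep_L0 (u + v) x * g' x = rep_L0 u x * g' x + rep_L0 v x * g' x"
        using add[of u v] by eventually_elim (simp add: distrib_right)
    qed measurable
    also have "\<dots> = pairing u g + pairing v g"
      unfolding p using i[OF uv(1)] i[OF uv(2)] by (rule Bochner_Integration.integral_add)
    finally show "pairing (u + v) g = pairing u g + pairing v g" .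
  next
    fix c u
    have "pairing (scale_L0 c u) g = (LINT x|mu. c * (rep_L0 u x * g' x))"
      unfolding p
    proof (rule integral_cong_AE)
      show "AE x in mu. rep_L0 (scale_L0 c u) x * g' x = c * (rep_L0 u x * g' x)"
        using scale[of c u] by eventually_elim simp
    qed measurable
    then show "pairing (scale_L0 c u) g = c * pairing u g" by (simp add: p)
  next
    fix u assume u: "u \<in> L1"
    have "cmod (pairing u g) \<le> (LINT x|mu. norm_Linf g * cmod (rep_L0 u x))"
      unfolding p
    proof (rule norm_integral_le)
      show "integrable mu (\<lambda>x. norm_Linf g * cmod (rep_L0 u x))"
        using rep_L0_integrable[OF u] by (intro integrable_mult_right integrable_norm)
      show "cmod (rep_L0 u x * g' x) \<le> norm_Linf g * cmod (rep_L0 u x)" for x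
        unfolding norm_mult by (subst mult.commute) (intro mult_right_mono g' norm_ge_zero)
    qed measurable
    then show "cmod (pairing u g) \<le> norm_Linf g * norm_L1 u" by (simp add: n)
  qed
qed

lemma openin_weak_pairing:
  assumes "g \<in> Linf" "open U"
  shows "openin (weak_topology L1 norm_L1) {f \<in> L1. pairing f g \<in> U}"
  unfolding weak_topology_def
proof (rule topology_generated_by_Basis, intro CollectI exI conjI)
  show "{f \<in> L1. pairing f g \<in> U} = {f \<in> L1. (\<lambda>f. pairing f g) f \<in> U}" ..
  show "(\<lambda>f. pairing f g) \<in> dual_space L1 norm_L1" "open U"
    by (rule pairing_in_dual_space[OF assms(1)], rule assms(2))
qed

text \<open>Away from the origin the Hilbert transforms of the spikes tend to zero.\<close>

lemma spike_pairing_tendsto_0: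
  assumes \<kappa>: "\<kappa> > 0" and \<delta>: "\<delta> > 0" and [measurable]: "g \<in> borel_measurable mu"
    and g: "\<And>x. cmod (g x) \<le> 1" "\<And>x. \<bar>x\<bar> < \<delta> \<Longrightarrow> g x = 0"
  shows "(\<lambda>n. pairing (abs_L0 (pv_hilbert (spike \<kappa> (Suc n)))) (abs_L0 g)) \<longlonglongrightarrow> 0"
proof (rule Lim_null_comparison)
  let ?B = "\<lambda>n. \<kappa> / pi * (1 / (real (Suc n) + (2 + ln 2))) * (4 / \<delta>)"
  show "?B \<longlonglongrightarrow> 0" by real_asymp
  have "(\<lambda>n. 2 * exp (- real (Suc n))) \<longlonglongrightarrow> 0" by real_asymp
  then have "\<forall>\<^sub>F n in sequentially. 2 * exp (- real (Suc n)) < \<delta>"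
    using \<delta> by (rule order_tendstoD)
  then show "\<forall>\<^sub>F n in sequentially. norm (pairing (abs_L0 (pv_hilbert (spike \<kappa> (Suc n)))) (abs_L0 g)) \<le> ?B n"
  proof eventually_elim
    case (elim n)
    define a where "a = exp (- real (Suc n))"
    define c where "c = spike_height (Suc n)"
    have a: "a > 0" "2 * a < \<delta>" using elim by (auto simp: a_def)
    have c: "c > 0" unfolding c_def by (rule spike_height_pos)
    let ?u = "pv_hilbert (spike \<kappa> (Suc n))"
    have bs: "bounded_supported (spike \<kappa> (Suc n))" by (intro bounded_supported_spike) simp
    have [measurable]: "?u \<in> borel_measurable mu" by (intro borel_measurable_mu pv_hilbert_measurable bs)
    define v where "v t = complex_of_real (\<kappa> * c / pi * log_ratio a t)" for t
    have [measurable]: "v \<in> borel_measurable mu"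
      unfolding v_def[abs_def] log_ratio_def by (intro borel_measurable_mu) measurable
    have "AE t in mu. ?u t = v t"
      using pv_hilbert_spike[of "Suc n" \<kappa>] unfolding AE_mu_iff
      by (auto elim!: eventually_mono simp: v_def c_def a_def)
    then have "pairing (abs_L0 ?u) (abs_L0 g) = (LINT t|mu. v t * g t)"
      by (subst pairing_abs_L0) (auto intro!: integral_cong_AE elim!: eventually_mono)
    also have "cmod \<dots> \<le> (LINT t|mu. \<kappa> * c / pi * (2 * a / \<delta>))"
    proof (rule norm_integral_le)
      show "integrable mu (\<lambda>t. \<kappa> * c / pi * (2 * a / \<delta>))"
        using finite_measure_mu by (simp add: finite_measure.integrable_const)
      fix t
      show "cmod (v t * g t) \<le> \<kappa> * c / pi * (2 * a / \<delta>)"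
      proof (cases "\<bar>t\<bar> < \<delta>")
        case True
        then show ?thesis using g(2) \<kappa> c a \<delta> by simp
      next
        case False
        have "\<bar>log_ratio a t\<bar> \<le> 2 * a / \<bar>t\<bar>"
          using a False by (intro abs_log_ratio_le) auto
        also have "\<dots> \<le> 2 * a / \<delta>"
          using a False \<delta> by (intro divide_left_mono) auto
        finally have l: "\<bar>log_ratio a t\<bar> \<le> 2 * a / \<delta>" .
        have "cmod (v t * g t) \<le> (\<kappa> * c / pi * \<bar>log_ratio a t\<bar>) * 1"
          unfolding norm_mult v_def norm_of_real abs_mult using g(1)[of t] \<kappa> c
          by (intro mult_mono) auto
        also have "\<dots> \<le> (\<kappa> * c / pi * (2 * a / \<delta>)) * 1"
          using l \<kappa> c by (intro mult_right_mono mult_left_mono) auto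
        finally show ?thesis by simp
      qed
    qed measurable
    also have "\<dots> = 2 * (\<kappa> * c / pi * (2 * a / \<delta>))"
      by (simp add: mu_def measure_restrict_space)
    also have "\<dots> = \<kappa> / pi * (c * a) * (4 / \<delta>)" by simp
    also have "c * a = 1 / (real (Suc n) + (2 + ln 2))"
      unfolding c_def a_def by (rule spike_height_mult)
    finally show ?case .
  qed
qed

text \<open>If \<open>h\<close> annihilates all bounded functions that vanish near the origin, it vanishes almost
  everywhere: it is paired with its conjugate sign cut off near the origin.\<close>

lemma L1_eq_0I:
  assumes h: "h \<in> L1"
    and zero: "\<And>\<delta> g. \<delta> > 0 \<Longrightarrow> g \<in> borel_measurable mu \<Longrightarrow> (\<And>x. cmod (g x) \<le> 1) \<Longrightarrow>
      (\<And>x. \<bar>x\<bar> < \<delta> \<Longrightarrow> g x = 0) \<Longrightarrow> pairing h (abs_L0 g) = 0"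
  shows "AE x in mu. rep_L0 h x = 0"
proof -
  have ih: "integrable mu (rep_L0 h)" using h by (rule rep_L0_integrable)
  have "AE x in mu. \<bar>x\<bar> \<ge> inverse (real (Suc k)) \<longrightarrow> rep_L0 h x = 0" for k
  proof -
    let ?S = "{x::real. inverse (real (Suc k)) \<le> \<bar>x\<bar>}"
    define g where "g x = indicator ?S x * cnj (sgn (rep_L0 h x))" for x
    have S: "?S \<in> sets borel" by measurable
    have [measurable]: "(indicator ?S :: real \<Rightarrow> complex) \<in> borel_measurable mu" "(indicator ?S :: real \<Rightarrow> real) \<in> borel_measurable mu"
      using S by (auto intro!: borel_measurable_mu)
    have gm: "g \<in> borel_measurable mu" unfolding g_def sgn_div_norm by measurable
    have g1: "cmod (g x) \<le> 1" for x by (simp add: g_def norm_mult norm_sgn split: split_indicator)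
    have "pairing h (abs_L0 g) = 0"
    proof (rule zero[of "inverse (real (Suc k))", OF _ gm g1])
      show "g x = 0" if "\<bar>x\<bar> < inverse (real (Suc k))" for x using that by (simp add: g_def)
    qed simp
    moreover have "pairing h (abs_L0 g) = (LINT x|mu. rep_L0 h x * g x)"
      using pairing_abs_L0[OF rep_L0_measurable[of h] gm] by (simp add: abs_rep_L0)
    moreover have "rep_L0 h x * g x = of_real (indicator ?S x * cmod (rep_L0 h x))" for x
    proof -
      have "rep_L0 h x * g x = indicator ?S x * ((rep_L0 h x * cnj (rep_L0 h x)) / of_real (cmod (rep_L0 h x)))"
        by (simp add: g_def sgn_eq)
      also have "\<dots> = indicator ?S x * (of_real ((cmod (rep_L0 h x))\<^sup>2) / of_real (cmod (rep_L0 h x)))"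
        by (simp only: complex_norm_square)
      finally show ?thesis by (simp add: power2_eq_square of_real_indicator)
    qed
    ultimately have "(LINT x|mu. indicator ?S x * cmod (rep_L0 h x)) = 0"
      by (simp only: integral_complex_of_real of_real_eq_0_iff)
    moreover have "integrable mu (\<lambda>x. indicator ?S x * cmod (rep_L0 h x))"
      by (rule Bochner_Integration.integrable_bound[OF integrable_norm[OF ih]])
         (measurable, auto intro!: AE_I2 split: split_indicator)
    ultimately have "AE x in mu. indicator ?S x * cmod (rep_L0 h x) = 0"
      by (subst (asm) integral_nonneg_eq_0_iff_AE) auto
    then show ?thesis by (auto elim!: eventually_mono split: split_indicator_asm)
  qed
  then have all: "AE x in mu. \<forall>k::nat. \<bar>x\<bar> \<ge> inverse (real (Suc k)) \<longrightarrow> rep_L0 h x = 0"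
    by (subst AE_all_countable) blast
  have "AE x in mu. x \<noteq> 0"
    unfolding AE_mu_iff using AE_lborel_singleton[of 0] by eventually_elim simp
  with all show ?thesis
  proof eventually_elim
    case (elim x)
    then have "0 < \<bar>x\<bar>" by simp
    from reals_Archimedean[OF this] obtain k where "inverse (real (Suc k)) < \<bar>x\<bar>" by blast
    then show ?case using elim(1) less_imp_le by blast
  qed
qed

text \<open>In a compact set every sequence has a cluster point; no metrizability is needed for this.\<close>

lemma compactin_sequence_cluster:
  assumes K: "compactin X K" and x: "\<And>n::nat. x n \<in> K"
  obtains h where "h \<in> K" "\<And>U. openin X U \<Longrightarrow> h \<in> U \<Longrightarrow> infinite {n. x n \<in> U}"
proof (rule ccontr)
  note obtains_rule = that
  assume no_cluster: "\<not> thesis"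
  have ex: "\<exists>U. openin X U \<and> h \<in> U \<and> finite {n. x n \<in> U}" if h: "h \<in> K" for h
  proof (rule ccontr)
    assume "\<not> ?thesis"
    then have "infinite {n. x n \<in> U}" if "openin X U" "h \<in> U" for U using that by simp
    with no_cluster show False using obtains_rule[OF h] by simp
  qed
  define \<U> where "\<U> = {U. openin X U \<and> finite {n. x n \<in> U}}"
  have "\<forall>U\<in>\<U>. openin X U" "K \<subseteq> \<Union>\<U>" using ex by (auto simp: \<U>_def)
  then obtain \<F> where \<F>: "finite \<F>" "\<F> \<subseteq> \<U>" "K \<subseteq> \<Union>\<F>"
    using K unfolding compactin_def by meson
  have "(UNIV :: nat set) \<subseteq> (\<Union>U\<in>\<F>. {n. x n \<in> U})" using x \<F>(3) by blast
  moreover have "finite (\<Union>U\<in>\<F>. {n. x n \<in> U})" using \<F> by (auto simp: \<U>_def)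
  ultimately show False using infinite_UNIV_nat finite_subset by blast
qed

lemma not_relatively_weakly_compact_spikes:
  assumes \<kappa>: "\<kappa> > 0" and S: "\<And>n. abs_L0 (pv_hilbert (spike \<kappa> (Suc n))) \<in> S"
  shows "\<not> relatively_weakly_compact L1 norm_L1 S"
proof
  let ?W = "weak_topology L1 norm_L1"
  define x where "x n = abs_L0 (pv_hilbert (spike \<kappa> (Suc n)))" for n
  have bs: "bounded_supported (spike \<kappa> (Suc n))" for n by (intro bounded_supported_spike) simp
  have xL1: "x n \<in> L1" for n
    unfolding x_def by (intro abs_L0_in_L1 integrable_mu_pv_hilbert bs)
  assume "relatively_weakly_compact L1 norm_L1 S"
  then have K: "compactin ?W (?W closure_of S)" by (simp add: relatively_weakly_compact_def)
  have "x n \<in> ?W closure_of S" for n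
    using closure_of_subset_Int[of ?W S] S[of n] xL1[of n] by (auto simp: topspace_weak_topology x_def)
  then obtain h where h: "h \<in> ?W closure_of S"
    and cluster: "\<And>U. openin ?W U \<Longrightarrow> h \<in> U \<Longrightarrow> infinite {n. x n \<in> U}"
    by (rule compactin_sequence_cluster[OF K]) (rule that)
  have hL1: "h \<in> L1"
    using h closure_of_subset_topspace[of ?W S] by (auto simp: topspace_weak_topology)
  have inf: "infinite {n. pairing (x n) g \<in> U}" if "g \<in> Linf" "open U" "pairing h g \<in> U" for g U
  proof -
    have "infinite {n. x n \<in> {f \<in> L1. pairing f g \<in> U}}"
      using that hL1 by (intro cluster openin_weak_pairing) auto
    then show ?thesis using xL1 by simp
  qed
  \<comment> \<open>A cluster point inherits the limits of the pairings with bounded functions.\<close>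
  have zero: "AE t in mu. rep_L0 h t = 0"
  proof (rule L1_eq_0I[OF hL1])
    fix \<delta> :: real and g :: "real \<Rightarrow> complex"
    assume g: "\<delta> > 0" "g \<in> borel_measurable mu" "\<And>x. cmod (g x) \<le> 1" "\<And>x. \<bar>x\<bar> < \<delta> \<Longrightarrow> g x = 0"
    have lim: "(\<lambda>n. pairing (x n) (abs_L0 g)) \<longlonglongrightarrow> 0"
      unfolding x_def using \<kappa> g by (rule spike_pairing_tendsto_0)
    show "pairing h (abs_L0 g) = 0"
    proof (rule ccontr)
      assume nz: "pairing h (abs_L0 g) \<noteq> 0"
      define e where "e = cmod (pairing h (abs_L0 g)) / 2"
      have e: "e > 0" using nz by (simp add: e_def)
      have "open {z::complex. e < cmod z}" by (intro open_Collect_less continuous_intros)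
      moreover have "pairing h (abs_L0 g) \<in> {z. e < cmod z}" using nz by (simp add: e_def)
      moreover have "abs_L0 g \<in> Linf" using g(2,3) by (rule abs_L0_in_Linf)
      ultimately have "infinite {n. pairing (x n) (abs_L0 g) \<in> {z. e < cmod z}}" by (intro inf)
      moreover have "\<forall>\<^sub>F n in sequentially. \<not> e < cmod (pairing (x n) (abs_L0 g))"
        using tendstoD[OF lim e] by eventually_elim simp
      then have "finite {n. pairing (x n) (abs_L0 g) \<in> {z. e < cmod z}}"
        by (simp add: eventually_cofinite flip: cofinite_eq_sequentially)
      ultimately show False by blast
    qed
  qed
  let ?i = "indicator {0..<1::real} :: real \<Rightarrow> complex"
  have bi: "bounded_supported ?i"
    by (intro bounded_supported_indicator) (auto simp: sets_mu_iff)
  have im: "?i \<in> borel_measurable mu" by (intro borel_measurable_mu bounded_supported_measurable bi)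
  have iL: "abs_L0 ?i \<in> Linf" using im by (rule abs_L0_in_Linf[of _ 1]) (simp split: split_indicator)
  have "pairing h (abs_L0 ?i) = (LINT t|mu. rep_L0 h t * ?i t)"
    using pairing_abs_L0[OF rep_L0_measurable[of h] im] by (simp add: abs_rep_L0)
  also have "\<dots> = (LINT t|mu. 0)"
  proof (rule integral_cong_AE)
    show "AE t in mu. rep_L0 h t * ?i t = 0" using zero by eventually_elim simp
  qed (use im in measurable)
  finally have h0: "pairing h (abs_L0 ?i) = 0" by simp
  have "open {z::complex. - \<kappa> / (4 * pi) < Re z}" by (intro open_Collect_less continuous_intros)
  then have "infinite {n. pairing (x n) (abs_L0 ?i) \<in> {z. - \<kappa> / (4 * pi) < Re z}}"
    using \<kappa> by (intro inf iL) (simp_all add: h0)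
  moreover have "Re (pairing (x n) (abs_L0 ?i)) \<le> - \<kappa> / (4 * pi)" for n
  proof -
    have "pairing (x n) (abs_L0 ?i) = (LINT t|mu. pv_hilbert (spike \<kappa> (Suc n)) t * ?i t)"
      unfolding x_def by (intro pairing_abs_L0 im borel_measurable_mu pv_hilbert_measurable bs)
    also have "\<dots> = (LINT t|lborel. pv_hilbert (spike \<kappa> (Suc n)) t * ?i t)"
      using bi by (rule integral_mu_bounded_supported)
    finally show ?thesis using Re_integral_pv_hilbert_spike_le[of "Suc n" \<kappa>] \<kappa> by simp
  qed
  then have "{n. pairing (x n) (abs_L0 ?i) \<in> {z. - \<kappa> / (4 * pi) < Re z}} = {}" by (auto simp: not_less)
  ultimately show False by simp
qed

theorem theorem4p7:
  shows "\<not> weakly_compact_operator LlogL norm_LlogL L1 norm_L1 T_L0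
    \<and> \<not> weakly_compact_operator L1_m norm_L1_m L1 norm_L1 integration_operator"
proof
  have bs: "bounded_supported (spike \<kappa> (Suc n))" for \<kappa> n by (intro bounded_supported_spike) simp
  show "\<not> weakly_compact_operator LlogL norm_LlogL L1 norm_L1 T_L0"
    unfolding weakly_compact_operator_def
  proof (rule not_relatively_weakly_compact_spikes[of 1])
    fix n
    have le: "LlogL_integral (abs_L0 (spike 1 (Suc n))) \<le> 1" by (rule spike_LlogL) simp
    then have "norm_LlogL (abs_L0 (spike 1 (Suc n))) \<le> 1"
      unfolding norm_LlogL_def by (metis enn2real_leI ennreal_1 zero_le_one)
    moreover have "abs_L0 (spike 1 (Suc n)) \<in> LlogL"
      using le by (auto simp: LlogL_def intro: le_less_trans)
    moreover have "abs_L0 (pv_hilbert (spike 1 (Suc n))) = T_L0 (abs_L0 (spike 1 (Suc n)))"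
      by (rule T_L0_abs_L0[OF bs, symmetric])
    ultimately show "abs_L0 (pv_hilbert (spike 1 (Suc n))) \<in> T_L0 ` {f \<in> LlogL. norm_LlogL f \<le> 1}"
      by blast
  qed simp
  show "\<not> weakly_compact_operator L1_m norm_L1_m L1 norm_L1 integration_operator"
    unfolding weakly_compact_operator_def
  proof (rule not_relatively_weakly_compact_spikes)
    \<comment> \<open>With this factor the spikes lie in the unit ball by \<open>norm_L1_m_spike_le\<close>.\<close>
    let ?\<kappa> = "1 / (2 * pi\<^sup>2 + 5)"
    show "0 < ?\<kappa>" by (simp add: add_nonneg_pos)
    fix n
    have "norm_L1_m (abs_L0 (spike ?\<kappa> (Suc n))) \<le> 1" by (rule norm_L1_m_spike_le) simp_all
    moreover note bounded_in_L1_m[OF bs[of ?\<kappa> n]]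
    ultimately show "abs_L0 (pv_hilbert (spike ?\<kappa> (Suc n))) \<in> integration_operator ` {f \<in> L1_m. norm_L1_m f \<le> 1}"
      by force
  qed
qed

end
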